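(* Let $\varphi\in\Phi$ and $1\le q<\infty$. The equivalence $$\|T_qx\|_{\Lambda(\varphi)}\approx\|Ux\|_{\Lambda(\varphi)}+\Big(\frac1n\sum_{k=n+1}^{n^2}(x_k^* )^q\Big)^{1/q}$$ holds for all positive integers $n$ and all real $n\times n$ matrices $x$, with equivalence constants independent of $x$ and $n$, if and only if $$\Gamma_{\varphi,q}:=\sup_{0<t\le1}\frac1{\varphi(t)}\sum_{j=1}^\infty j^{(1/q)-1}\varphi\Big(\frac{t^j}{j!}\Big)<\infty.$$ Moreover, $$\|T_q\|_{\Lambda(\varphi)}\le\Gamma_{\varphi,q}\le q\,e\,\|T_q\|_{\Lambda(\varphi)}.$$
   Context: $\Phi$ is the set of increasing concave functions $\varphi:[0,1]\to[0,1]$, continuous on $(0,1]$, with $\varphi(0)=0$ and $\varphi(1)=1$. For measurable $x$ on $[0,1]$, $x^*$ is the decreasing rearrangement of $|x|$. The Lorentz space $\Lambda(\varphi)$ consists of the functions on $[0,1]$ with finite norm $\|x\|_{\Lambda(\varphi)}=\int_0^1x^*(t)\,d\varphi(t)$. For a real $n\times n$ matrix $x=(x_{ij})$, $x_1^*\ge x_2^*\ge\dots\ge x_{n^2}^*$ is the decreasing rearrangement of the numbers $|x_{ij}|$. Let $S_n$ be the group of permutations of $\{1,\dots,n\}$ and $\ell:S_n\to\{1,\dots,n!\}$ a bijection. For $1\le q<\infty$ define the step function on $[0,1)$ $$T_qx(t)=\Big(\sum_{i=1}^n|x_{i,\pi(i)}|^q\Big)^{1/q},\qquad t\in\Big[\tfrac{\ell(\pi)-1}{n!},\tfrac{\ell(\pi)}{n!}\Big);$$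 the norm $\|T_qx\|_{\Lambda(\varphi)}$ does not depend on $\ell$. Define also $Ux(t)=\sum_{k=1}^n x_k^*\chi_{((k-1)/n,k/n)}(t)$. Finally, $\|T_q\|_{\Lambda(\varphi)}$ denotes the least constant $C\in[0,\infty]$ such that $\|T_qy\|_{\Lambda(\varphi)}\le C\|Uy\|_{\Lambda(\varphi)}$ for every $n$ and every diagonal $n\times n$ matrix $y$. *)

theory Defs
  imports "HOL-Analysis.Analysis" "HOL-Combinatorics.Permutations"
begin

text \<open>Only the restriction of \<open>\<phi>\<close> to \<open>[0,1]\<close> matters. A jump of \<open>\<phi>\<close> at \<open>0\<close> is allowed.\<close>

definition Phi :: "(real \<Rightarrow> real) set" where
  "Phi = {\<phi>. \<phi> ` {0..1} \<subseteq> {0..1} \<and> mono_on {0..1} \<phi> \<and> concave_on {0..1} \<phi> \<and>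
             continuous_on {0<..1} \<phi> \<and> \<phi> 0 = 0 \<and> \<phi> 1 = 1}"

text \<open>Decreasing rearrangement of a function on \<open>[0,1]\<close>; its value at \<open>0\<close> is the essential
  supremum of \<open>\<bar>x\<bar>\<close>, possibly infinite.\<close>

definition rearrangement :: "(real \<Rightarrow> real) \<Rightarrow> real \<Rightarrow> ennreal" where
  "rearrangement x t =
     Inf {s. emeasure lebesgue {u \<in> {0..1}. s < ennreal \<bar>x u\<bar>} \<le> ennreal t}"

text \<open>The Stieltjes measure \<open>d\<phi>\<close> on \<open>[0,1]\<close>. Since \<open>interval_measure\<close> expects a right-continuous
  distribution function on the whole line, \<open>\<phi>\<close> is extended by \<open>0\<close> to the left and by \<open>1\<close> to the
  right, and its value at \<open>0\<close> is replaced by the right limit \<open>\<phi>(0+)\<close>. Thus \<open>{0}\<close> carries the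
  mass \<open>\<phi>(0+) - \<phi>(0)\<close>, as it does in the Riemann-Stieltjes integral over \<open>[0,1]\<close>.\<close>

definition Stieltjes :: "(real \<Rightarrow> real) \<Rightarrow> real measure" where
  "Stieltjes \<phi> = interval_measure
     (\<lambda>t. if t < 0 then 0 else if t = 0 then Lim (at_right 0) \<phi> else if t \<le> 1 then \<phi> t else 1)"

definition Lorentz_norm :: "(real \<Rightarrow> real) \<Rightarrow> (real \<Rightarrow> real) \<Rightarrow> ennreal" where
  "Lorentz_norm \<phi> x = (\<integral>\<^sup>+t\<in>{0..1}. rearrangement x t \<partial>Stieltjes \<phi>)"

lemma emeasure_Stieltjes:
  assumes "\<phi> \<in> Phi" "0 < t" "t \<le> 1"
  shows "emeasure (Stieltjes \<phi>) {0..t} = ennreal (\<phi> t)"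
proof -
  define L where "L = Lim (at_right 0) \<phi>"
  define F where "F = (\<lambda>t. if t < 0 then 0 else if t = 0 then L else if t \<le> 1 then \<phi> t else 1)"
  have mono: "\<phi> x \<le> \<phi> y" if "0 \<le> x" "x \<le> y" "y \<le> 1" for x y
    using assms(1) that by (auto simp: Phi_def mono_on_def)
  have nonneg: "0 \<le> \<phi> x" and le1: "\<phi> x \<le> 1" if "0 \<le> x" "x \<le> 1" for x
    using assms(1) that by (auto simp: Phi_def image_subset_iff)
  have one: "\<phi> 1 = 1" using assms(1) by (simp add: Phi_def)
  have cont: "continuous_on {0<..1} \<phi>" using assms(1) by (simp add: Phi_def)
  have near0: "eventually (\<lambda>x::real. 0 < x \<and> x < e) (at_right 0)" if "0 < e" for e
    using that by (auto simp: eventually_at_right_field)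
  have lim_inf: "(\<phi> \<longlongrightarrow> Inf (\<phi> ` {0<..1})) (at_right 0)"
  proof (rule order_tendstoI)
    have bdd: "bdd_below (\<phi> ` {0<..1})"
      by (rule bdd_belowI[of _ 0]) (auto intro: nonneg)
    fix a assume "a < Inf (\<phi> ` {0<..1})"
    then have "a < \<phi> x" if "0 < x" "x < 1" for x
      using cInf_lower[OF _ bdd, of "\<phi> x"] that by force
    then show "eventually (\<lambda>x. a < \<phi> x) (at_right 0)"
      using near0[of 1] by (auto elim: eventually_mono)
  next
    fix a assume "Inf (\<phi> ` {0<..1}) < a"
    then obtain y where y: "0 < y" "y \<le> 1" "\<phi> y < a"
      using cInf_lessD[of "\<phi> ` {0<..1}" a] by auto
    then have "\<phi> x < a" if "0 < x" "x < y" for x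
      using mono[of x y] that by linarith
    then show "eventually (\<lambda>x. \<phi> x < a) (at_right 0)"
      using near0[of y] y by (auto elim: eventually_mono)
  qed
  then have lim: "(\<phi> \<longlongrightarrow> L) (at_right 0)"
    unfolding L_def by (subst tendsto_Lim) auto
  have L0: "0 \<le> L"
    by (rule tendsto_lowerbound[OF lim])
      (use near0[of 1] in \<open>auto elim!: eventually_mono intro: nonneg\<close>)
  have Lle: "L \<le> \<phi> x" if "0 < x" "x \<le> 1" for x
    by (rule tendsto_upperbound[OF lim])
      (use near0[of x] that in \<open>auto elim!: eventually_mono intro: mono\<close>)
  have L1: "L \<le> 1" using Lle[of 1] one by simp
  have Fmono: "F x \<le> F y" if "x \<le> y" for x y
    using that L0 L1 Lle[of y] mono[of x y] nonneg[of y] le1[of x] by (auto simp: F_def)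
  have Fcont: "continuous (at_right a) F" for a
  proof -
    consider "a < 0" | "a = 0" | "0 < a" "a < 1" | "1 \<le> a" by linarith
    then have "(F \<longlongrightarrow> F a) (at_right a)"
    proof cases
      case 1
      have "eventually (\<lambda>x. F a = F x) (at_right a)"
        unfolding eventually_at_right_field by (rule exI[of _ 0]) (use 1 in \<open>auto simp: F_def\<close>)
      then show ?thesis by (rule tendsto_eventually[OF eventually_mono]) auto
    next
      case 2
      have "eventually (\<lambda>x. \<phi> x = F x) (at_right 0)"
        unfolding eventually_at_right_field by (rule exI[of _ 1]) (auto simp: F_def)
      then have "(F \<longlongrightarrow> L) (at_right 0)" by (rule Lim_transform_eventually[OF lim])
      then show ?thesis using 2 by (simp add: F_def)
    next
      case 3
      have "continuous_on {0<..<1} \<phi>" by (rule continuous_on_subset[OF cont]) auto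
      then have "isCont \<phi> a" using 3 by (simp add: continuous_on_eq_continuous_at)
      then have "(\<phi> \<longlongrightarrow> \<phi> a) (at_right a)"
        by (simp add: isCont_def filterlim_at_split)
      moreover have "eventually (\<lambda>x. \<phi> x = F x) (at_right a)"
        unfolding eventually_at_right_field by (rule exI[of _ 1]) (use 3 in \<open>auto simp: F_def\<close>)
      ultimately have "(F \<longlongrightarrow> \<phi> a) (at_right a)" by (rule Lim_transform_eventually)
      then show ?thesis using 3 by (simp add: F_def)
    next
      case 4
      have "eventually (\<lambda>x. F a = F x) (at_right a)"
        unfolding eventually_at_right_field
        by (rule exI[of _ "a + 1"]) (use 4 one in \<open>auto simp: F_def\<close>)
      then show ?thesis by (rule tendsto_eventually[OF eventually_mono]) auto
    qed
    then show ?thesis by (simp add: continuous_within)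
  qed
  let ?M = "interval_measure F"
  have Ioc: "emeasure ?M {a<..b} = ennreal (F b - F a)" if "a \<le> b" for a b
    using that Fmono Fcont by (intro emeasure_interval_measure_Ioc) auto
  have "(\<Union>k. {-1<..- (1 / real (Suc k))}) \<in> null_sets ?M"
  proof (rule null_sets_UN)
    fix k
    have "emeasure ?M {-1<..- (1 / real (Suc k))} = ennreal (F (- (1 / real (Suc k))) - F (-1))"
      by (rule Ioc) (simp add: field_simps)
    moreover have "- (1 / real (Suc k)) < 0" by (simp del: of_nat_Suc)
    ultimately show "{-1<..- (1 / real (Suc k))} \<in> null_sets ?M"
      by (intro null_setsI) (simp_all add: F_def)
  qed
  moreover have "(\<Union>k. {-1<..- (1 / real (Suc k))}) = {-1<..<0::real}" (is "?A = ?B")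
  proof
    show "?A \<subseteq> ?B"
    proof
      fix x assume "x \<in> ?A"
      then obtain k where x: "-1 < x" "x \<le> - (1 / real (Suc k))" by auto
      have "0 < 1 / real (Suc k)" by simp
      with x(2) have "x < 0" by linarith
      with x(1) show "x \<in> ?B" by simp
    qed
    show "?B \<subseteq> ?A"
    proof
      fix x :: real assume x: "x \<in> ?B"
      then obtain k where "inverse (real (Suc k)) < - x"
        using reals_Archimedean[of "- x"] by auto
      then have "x \<in> {-1<..- (1 / real (Suc k))}" using x by (simp add: inverse_eq_divide)
      then show "x \<in> ?A" by blast
    qed
  qed
  ultimately have null: "{-1<..<0::real} \<in> null_sets ?M" by simp
  have "{0..t} = {-1<..t} - {-1<..<0}" using assms by auto
  then have "emeasure ?M {0..t} = emeasure ?M {-1<..t}"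
    using emeasure_Diff_null_set[OF null, of "{-1<..t}"] by simp
  also have "\<dots> = ennreal (F t - F (-1))" using assms by (intro Ioc) auto
  also have "\<dots> = ennreal (\<phi> t)" using assms by (simp add: F_def)
  finally show ?thesis unfolding Stieltjes_def F_def L_def .
qed

text \<open>An \<open>n \<times> n\<close> matrix is a function \<open>x\<close> of which only the entries \<open>x i j\<close> with
  \<open>i, j \<in> {1..n}\<close> are used.\<close>

definition entry_rearrangement :: "nat \<Rightarrow> (nat \<Rightarrow> nat \<Rightarrow> real) \<Rightarrow> nat \<Rightarrow> real" where
  "entry_rearrangement n x k =
     rev (sort [\<bar>x i j\<bar>. i \<leftarrow> [1..<Suc n], j \<leftarrow> [1..<Suc n]]) ! (k - 1)"

definition diagonal :: "nat \<Rightarrow> (nat \<Rightarrow> nat \<Rightarrow> real) \<Rightarrow> bool" where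
  "diagonal n x \<longleftrightarrow> (\<forall>i\<in>{1..n}. \<forall>j\<in>{1..n}. i \<noteq> j \<longrightarrow> x i j = 0)"

definition enumeration :: "nat \<Rightarrow> ((nat \<Rightarrow> nat) \<Rightarrow> nat) \<Rightarrow> bool" where
  "enumeration n l \<longleftrightarrow> bij_betw l {\<pi>. \<pi> permutes {1..n}} {1..fact n}"

definition T_op ::
    "real \<Rightarrow> nat \<Rightarrow> ((nat \<Rightarrow> nat) \<Rightarrow> nat) \<Rightarrow> (nat \<Rightarrow> nat \<Rightarrow> real) \<Rightarrow> real \<Rightarrow> real" where
  "T_op q n l x t =
     (\<Sum>\<pi> | \<pi> permutes {1..n}. (\<Sum>i=1..n. \<bar>x i (\<pi> i)\<bar> powr q) powr (1 / q) *
        indicator {(real (l \<pi>) - 1) / fact n ..< real (l \<pi>) / fact n} t)"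

definition U_op :: "nat \<Rightarrow> (nat \<Rightarrow> nat \<Rightarrow> real) \<Rightarrow> real \<Rightarrow> real" where
  "U_op n x t =
     (\<Sum>k=1..n. entry_rearrangement n x k * indicator {(real k - 1) / n <..< real k / n} t)"

text \<open>The enumerations of the permutation groups are given as a family \<open>l\<close> indexed by the matrix
  size. They do not affect the Lorentz norms.\<close>

definition T_norm :: "(real \<Rightarrow> real) \<Rightarrow> real \<Rightarrow> (nat \<Rightarrow> (nat \<Rightarrow> nat) \<Rightarrow> nat) \<Rightarrow> ennreal" where
  "T_norm \<phi> q l = Inf {C. \<forall>n\<ge>1. \<forall>y. diagonal n y \<longrightarrow>
     Lorentz_norm \<phi> (T_op q n (l n) y) \<le> C * Lorentz_norm \<phi> (U_op n y)}"

definition Gamma_const :: "(real \<Rightarrow> real) \<Rightarrow> real \<Rightarrow> ennreal" where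
  "Gamma_const \<phi> q = (SUP t\<in>{0<..1}. ennreal (1 / \<phi> t) *
     (\<Sum>j. ennreal (real (Suc j) powr (1 / q - 1) * \<phi> (t ^ Suc j / fact (Suc j)))))"

end

theory Submission
  imports Defs
begin

text \<open>
  The Lorentz norm of a step function with equal cells is \<open>\<Sum>\<^sub>k w\<^sub>k X\<^sub>k\<^sup>*\<close>, where the weights
  \<open>w\<^sub>k\<close> are the increments of \<open>\<phi>\<close>. They decrease, so this is a maximum over all orderings of \<open>X\<close>;
  hence it is subadditive, and additive on functions built from a chain of sets.

  For a set \<open>K\<close> of \<open>k \<le> n\<close> positions, the number \<open>F\<close> of positions met by a random permutation has
  binomial moments at most \<open>(k/n)\<^sup>j / j!\<close>, so the norm of \<open>F powr (1/q)\<close> is at most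
  \<open>\<Gamma> \<phi>(k/n)\<close>. Splitting the \<open>n\<close> largest entries into level sets bounds their contribution by \<open>\<Gamma>\<close> times
  the norm of \<open>U x\<close>. The remaining entries are grouped by size into blocks of \<open>n\<close> positions; a convex
  combination of the block counts still has factorially small tails by Jensen's inequality for
  exponential moments. The lower bound is the second moment method, and \<open>\<Gamma> \<le> q e \<parallel>T\<^sub>q\<parallel>\<close> follows
  from diagonal matrices with \<open>\<lfloor>t n\<rfloor>\<close> ones, where the number of fixed points tends to a Poisson variable.
\<close>

text \<open>Put \<open>p = 1 / q\<close>. A count \<open>H\<close> satisfies \<open>H powr p\<close>
  = sum of the increments \<open>j powr p - (j - 1) powr p\<close> over the level sets {H \<ge> j},
  and the terms \<open>j powr (p - 1)\<close> of \<Gamma> are these increments up to a factor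
  between p and 1. The lower factor p is the origin of q in the last estimate; e is the Poisson
  factor \<open>exp (- t)\<close>, at least \<open>exp (- 1)\<close>, taken out of \<phi> by
  concavity. The obstacle is the part of the matrix beyond the n largest entries. For q > 1 the root
  cannot be taken block by block there: with block weights v, the sum of the
  \<open>v r powr (1 / q)\<close> is not controlled by the root of the sum of the
  \<open>v r\<close>, uniformly in n. So the blocks are mixed first and a tail estimate is proved
  for the mixture as a whole; \<Gamma> then enters only through its series at t = 1. Diagonal
  matrices suffice for necessity: they have no entries beyond the n largest except zeros, and their
  hit counts have exact binomial moments, so that inclusion-exclusion gives exact
  probabilities.\<close>

section \<open>Elementary properties of the functions in \<Phi>\<close>

lemma Phi_mono: "\<phi> \<in> Phi \<Longrightarrow> 0 \<le> s \<Longrightarrow> s \<le> t \<Longrightarrow> t \<le> 1 \<Longrightarrow> \<phi> s \<le> \<phi> t"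
  by (auto simp: Phi_def mono_on_def)

lemma Phi_nonneg: "\<phi> \<in> Phi \<Longrightarrow> 0 \<le> t \<Longrightarrow> t \<le> 1 \<Longrightarrow> 0 \<le> \<phi> t"
  by (auto simp: Phi_def image_subset_iff)

lemma Phi_le_1: "\<phi> \<in> Phi \<Longrightarrow> 0 \<le> t \<Longrightarrow> t \<le> 1 \<Longrightarrow> \<phi> t \<le> 1"
  by (auto simp: Phi_def image_subset_iff)

lemma Phi_0: "\<phi> \<in> Phi \<Longrightarrow> \<phi> 0 = 0"
  by (simp add: Phi_def)

lemma Phi_1: "\<phi> \<in> Phi \<Longrightarrow> \<phi> 1 = 1"
  by (simp add: Phi_def)

text \<open>Concavity on the segment from 0, where \<phi> vanishes. Constants are moved into \<phi>
  in this way: it produces the factor 2 in \<open>U_val_le\<close> and the factor e in the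
  comparison of \<Gamma> with the operator norm.\<close>

lemma Phi_scale:
  assumes "\<phi> \<in> Phi" "0 \<le> c" "c \<le> 1" "0 \<le> t" "t \<le> 1"
  shows "c * \<phi> t \<le> \<phi> (c * t)"
proof -
  have "concave_on {0..1} \<phi>" using assms(1) by (simp add: Phi_def)
  from concave_onD[OF this, of c 0 t] show ?thesis
    using assms Phi_0[OF assms(1)] by simp
qed

lemma Phi_ge: "\<phi> \<in> Phi \<Longrightarrow> 0 \<le> t \<Longrightarrow> t \<le> 1 \<Longrightarrow> t \<le> \<phi> t"
  using Phi_scale[of \<phi> t 1] Phi_1[of \<phi>] by simp

lemma Phi_pos: "\<phi> \<in> Phi \<Longrightarrow> 0 < t \<Longrightarrow> t \<le> 1 \<Longrightarrow> 0 < \<phi> t"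
  using Phi_ge[of \<phi> t] by simp

text \<open>Since \<phi> may jump at 0, continuity is available only at a positive limit approached
  from within (0,1].\<close>

lemma Phi_tendsto:
  assumes "\<phi> \<in> Phi" "(f \<longlongrightarrow> t) F" "0 < t" "\<forall>\<^sub>F n in F. 0 < f n \<and> f n \<le> (1::real)" "t \<le> 1"
  shows "((\<lambda>n. \<phi> (f n)) \<longlongrightarrow> \<phi> t) F"
proof -
  have "continuous_on {0<..1} \<phi>" using assms(1) by (simp add: Phi_def)
  from continuous_on_tendsto_compose[OF this assms(2)] assms(3-5) show ?thesis
    by simp
qed

section \<open>The Stieltjes measure and the norm of step functions\<close>

lemma sets_Stieltjes [simp, measurable_cong]: "sets (Stieltjes \<phi>) = sets borel"
  by (simp add: Stieltjes_def)

text \<open>By continuity of \<phi> on (0,1] no point there is an atom, so half-open cells have the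
  measures expected from \<phi>.\<close>

lemma emeasure_Stieltjes_open:
  assumes phi: "\<phi> \<in> Phi" and t: "0 < t" "t \<le> 1"
  shows "emeasure (Stieltjes \<phi>) {0..<t} = ennreal (\<phi> t)"
proof (rule antisym)
  show "emeasure (Stieltjes \<phi>) {0..<t} \<le> ennreal (\<phi> t)"
    unfolding emeasure_Stieltjes[OF assms, symmetric] by (intro emeasure_mono) auto
  \<comment> \<open>The double successor keeps \<open>?u 0\<close> positive, as
    \<open>emeasure_Stieltjes\<close> requires.\<close>
  let ?u = "\<lambda>n. t * (1 - inverse (real (Suc (Suc n))))"
  have u: "0 < ?u n" "?u n < t" for n
  proof -
    have "0 < inverse (real (Suc (Suc n)))" "inverse (real (Suc (Suc n))) < 1"
      by (auto simp: inverse_less_1_iff)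
    then show "0 < ?u n" "?u n < t"
      using t mult_strict_left_mono[of "1 - inverse (real (Suc (Suc n)))" 1 t] by auto
  qed
  have "(\<lambda>n. inverse (real (Suc (Suc n)))) \<longlonglongrightarrow> 0"
    using LIMSEQ_Suc[OF LIMSEQ_inverse_real_of_nat] .
  then have "?u \<longlonglongrightarrow> t * (1 - 0)"
    by (intro tendsto_intros)
  then have "?u \<longlonglongrightarrow> t" by simp
  moreover have "?u n \<le> 1" for n using u(2)[of n] t(2) by linarith
  ultimately have "(\<lambda>n. \<phi> (?u n)) \<longlonglongrightarrow> \<phi> t"
    using u(1) t by (intro Phi_tendsto[OF phi]) auto
  then have lim: "(\<lambda>n. ennreal (\<phi> (?u n))) \<longlonglongrightarrow> ennreal (\<phi> t)"
    by (rule tendsto_ennrealI)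
  have "ennreal (\<phi> (?u n)) \<le> emeasure (Stieltjes \<phi>) {0..<t}" for n
  proof -
    have "?u n \<le> 1" using u(2)[of n] t(2) by linarith
    then have "ennreal (\<phi> (?u n)) = emeasure (Stieltjes \<phi>) {0..?u n}"
      using emeasure_Stieltjes[OF phi u(1)[of n]] by simp
    also have "\<dots> \<le> emeasure (Stieltjes \<phi>) {0..<t}"
      using u(2)[of n] by (intro emeasure_mono) auto
    finally show ?thesis .
  qed
  then show "ennreal (\<phi> t) \<le> emeasure (Stieltjes \<phi>) {0..<t}"
    by (intro LIMSEQ_le_const2[OF lim]) auto
qed

definition weight :: "(real \<Rightarrow> real) \<Rightarrow> nat \<Rightarrow> nat \<Rightarrow> real" where
  "weight \<phi> N k = \<phi> (real (Suc k) / N) - \<phi> (real k / N)"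

lemma weight_nonneg:
  assumes "\<phi> \<in> Phi" "k < N" shows "0 \<le> weight \<phi> N k"
  using Phi_mono[OF assms(1), of "real k / N" "real (Suc k) / N"] assms(2)
  by (auto simp: weight_def divide_simps)

lemma sum_weight: "\<phi> \<in> Phi \<Longrightarrow> (\<Sum>k<m. weight \<phi> N k) = \<phi> (real m / N)"
  unfolding weight_def by (subst sum_lessThan_telescope) (simp add: Phi_0)

text \<open>Concavity at the midpoint of two adjacent cells compares neighbouring weights; the rest
  is induction.\<close>

lemma weight_antimono:
  assumes phi: "\<phi> \<in> Phi" and "i \<le> j" "j < N"
  shows "weight \<phi> N j \<le> weight \<phi> N i"
proof -
  have step: "weight \<phi> N (Suc k) \<le> weight \<phi> N k" if "Suc k < N" for k
  proof -
    have c: "concave_on {0..1} \<phi>" using phi by (simp add: Phi_def)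
    have "(1 - 1/2) * \<phi> (real k / N) + (1/2) * \<phi> (real (Suc (Suc k)) / N)
        \<le> \<phi> ((1 - 1/2) *\<^sub>R (real k / N) + (1/2) *\<^sub>R (real (Suc (Suc k)) / N))"
      by (rule concave_onD[OF c]) (use that in \<open>auto simp: divide_simps\<close>)
    also have "(1 - 1/2) *\<^sub>R (real k / N) + (1/2) *\<^sub>R (real (Suc (Suc k)) / N) = real (Suc k) / N"
      using that by (simp add: divide_simps)
    finally show ?thesis by (simp add: weight_def field_simps)
  qed
  from \<open>i \<le> j\<close> \<open>j < N\<close> show ?thesis
    by (induction j rule: dec_induct) (auto intro: order_trans[OF step])
qed

lemma emeasure_Stieltjes_cell:
  assumes phi: "\<phi> \<in> Phi" and k: "k < N"
  shows "emeasure (Stieltjes \<phi>) {real k / N ..< real (Suc k) / N} = ennreal (weight \<phi> N k)"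
proof (cases "k = 0")
  \<comment> \<open>The first cell also carries the possible mass at 0. This agrees with the weight
    because the latter subtracts \<open>\<phi> 0 = 0\<close> and not the right limit.\<close>
  case True
  then show ?thesis
    using emeasure_Stieltjes_open[OF phi, of "1 / N"] k by (simp add: weight_def Phi_0[OF phi])
next
  case False
  have 1: "0 < real k / N" "real k / N \<le> 1" "0 < real (Suc k) / N" "real (Suc k) / N \<le> 1"
    "real k / N \<le> real (Suc k) / N"
    using False k by (auto simp: divide_simps)
  have "{real k / N ..< real (Suc k) / N} = {0..< real (Suc k) / N} - {0..<real k / N}"
    by (rule set_eqI) (use 1 in auto)
  also have "emeasure (Stieltjes \<phi>) \<dots> = ennreal (\<phi> (real (Suc k) / N)) - ennreal (\<phi> (real k / N))"
    using 1 by (subst emeasure_Diff)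
      (auto simp: emeasure_Stieltjes_open[OF phi] simp del: of_nat_Suc)
  also have "\<dots> = ennreal (weight \<phi> N k)"
    using 1 Phi_nonneg[OF phi, of "real k / N"] by (simp add: weight_def ennreal_minus)
  finally show ?thesis .
qed

text \<open>The rearrangement depends only on the distribution, so only disjointness and the common
  measure 1/N of the cells matter. This general form covers both the half-open cells of
  \<open>T_op\<close> and the open cells of \<open>U_op\<close>.\<close>

lemma Lorentz_norm_step:
  fixes X :: "'a \<Rightarrow> real" and I :: "'a \<Rightarrow> real set"
  assumes phi: "\<phi> \<in> Phi" and A: "finite A" and N: "card A = N" "0 < N"
    and X: "\<And>w. w \<in> A \<Longrightarrow> 0 \<le> X w"
    and bij: "bij_betw \<tau> {..<N} A"
    and sorted: "\<And>i j. i \<le> j \<Longrightarrow> j < N \<Longrightarrow> X (\<tau> j) \<le> X (\<tau> i)"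
    and I: "\<And>w. w \<in> A \<Longrightarrow> I w \<in> sets lebesgue" "\<And>w. w \<in> A \<Longrightarrow> I w \<subseteq> {0..1}"
    and disj: "disjoint_family_on I A"
    and emI: "\<And>w. w \<in> A \<Longrightarrow> emeasure lebesgue (I w) = ennreal (1 / N)"
    and f: "\<And>u. f u = (\<Sum>w\<in>A. X w * indicator (I w) u)"
  shows "Lorentz_norm \<phi> f = ennreal (\<Sum>k<N. weight \<phi> N k * X (\<tau> k))"
proof -
  have tau: "\<tau> k \<in> A" if "k < N" for k using bij that by (auto simp: bij_betw_def)
  have fin: "f u = X w" if "w \<in> A" "u \<in> I w" for u w
  proof -
    have "X v * indicator (I v) u = (if v = w then X w else 0)" if "v \<in> A" for v
      using disj that \<open>w \<in> A\<close> \<open>u \<in> I w\<close> by (auto simp: disjoint_family_on_def indicator_def)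
    then show ?thesis unfolding f using A \<open>w \<in> A\<close> by (simp add: sum.delta)
  qed
  have fout: "f u = 0" if "\<And>w. w \<in> A \<Longrightarrow> u \<notin> I w" for u
    unfolding f using that by (intro sum.neutral) auto
  have dist: "emeasure lebesgue {u \<in> {0..1}. s < ennreal \<bar>f u\<bar>} = ennreal (card {k\<in>{..<N}. s < ennreal (X (\<tau> k))} / N)" for s
  proof -
    let ?B = "{w\<in>A. s < ennreal (X w)}"
    have "{u \<in> {0..1}. s < ennreal \<bar>f u\<bar>} = (\<Union>w\<in>?B. I w)"
    proof (intro set_eqI iffI)
      fix u assume u: "u \<in> {u \<in> {0..1}. s < ennreal \<bar>f u\<bar>}"
      then obtain w where w: "w \<in> A" "u \<in> I w"
        using fout[of u] by (cases "\<exists>w\<in>A. u \<in> I w") auto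
      with fin[OF w] X[OF w(1)] u show "u \<in> (\<Union>w\<in>?B. I w)" by auto
    next
      fix u assume "u \<in> (\<Union>w\<in>?B. I w)"
      then show "u \<in> {u \<in> {0..1}. s < ennreal \<bar>f u\<bar>}"
        using fin X I(2) by (auto simp: subset_iff)
    qed
    also have "emeasure lebesgue \<dots> = (\<Sum>w\<in>?B. emeasure lebesgue (I w))"
      using A I(1) disj by (intro sum_emeasure[symmetric]) (auto simp: disjoint_family_on_def)
    also have "\<dots> = (\<Sum>w\<in>?B. ennreal (1 / N))"
      using emI by (intro sum.cong) auto
    also have "\<dots> = ennreal (card ?B / N)"
      by (simp add: ennreal_of_nat_eq_real_of_nat ennreal_mult'[symmetric])
    also have "card ?B = card {k\<in>{..<N}. s < ennreal (X (\<tau> k))}"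
      using bij by (intro bij_betw_same_card[of "\<tau>", symmetric] bij_betw_Collect) auto
    finally show ?thesis .
  qed
  have rearr: "rearrangement f t = ennreal (X (\<tau> k))"
    if t: "real k / N \<le> t" "t < real (Suc k) / N" and k: "k < N" for t k
  proof -
    \<comment> \<open>For t in the cell number k, at most k values may exceed s, which means that
      \<open>X (\<tau> k)\<close> does not. The set whose infimum is the rearrangement is therefore
      a closed ray.\<close>
    have "card {i\<in>{..<N}. s < ennreal (X (\<tau> i))} / N \<le> t \<longleftrightarrow> ennreal (X (\<tau> k)) \<le> s" for s
    proof
      assume "ennreal (X (\<tau> k)) \<le> s"
      have "{i\<in>{..<N}. s < ennreal (X (\<tau> i))} \<subseteq> {..<k}"
      proof (intro subsetI, rule ccontr)
        fix i assume i: "i \<in> {i\<in>{..<N}. s < ennreal (X (\<tau> i))}" "i \<notin> {..<k}"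
        then have "ennreal (X (\<tau> i)) \<le> ennreal (X (\<tau> k))"
          by (intro ennreal_leI sorted) auto
        with \<open>ennreal (X (\<tau> k)) \<le> s\<close> have "ennreal (X (\<tau> i)) \<le> s" by (rule order_trans[rotated])
        with i show False by (simp add: leD)
      qed
      then have "card {i\<in>{..<N}. s < ennreal (X (\<tau> i))} \<le> k"
        using card_mono[OF finite_lessThan] by fastforce
      then have "card {i\<in>{..<N}. s < ennreal (X (\<tau> i))} / N \<le> real k / N"
        by (intro divide_right_mono) auto
      with t show "card {i\<in>{..<N}. s < ennreal (X (\<tau> i))} / N \<le> t" by linarith
    next
      assume *: "card {i\<in>{..<N}. s < ennreal (X (\<tau> i))} / N \<le> t"
      show "ennreal (X (\<tau> k)) \<le> s"
      proof (rule ccontr)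
        assume "\<not> ennreal (X (\<tau> k)) \<le> s"
        have "{..<Suc k} \<subseteq> {i\<in>{..<N}. s < ennreal (X (\<tau> i))}"
        proof (intro subsetI)
          fix i assume i: "i \<in> {..<Suc k}"
          then have "ennreal (X (\<tau> k)) \<le> ennreal (X (\<tau> i))"
            using k by (intro ennreal_leI sorted) auto
          moreover have "s < ennreal (X (\<tau> k))"
            using \<open>\<not> ennreal (X (\<tau> k)) \<le> s\<close> by (rule not_le_imp_less)
          ultimately have "s < ennreal (X (\<tau> i))" by (rule order_less_le_trans[rotated])
          with i k show "i \<in> {i\<in>{..<N}. s < ennreal (X (\<tau> i))}" by simp
        qed
        then have "Suc k \<le> card {i\<in>{..<N}. s < ennreal (X (\<tau> i))}"
          using card_mono[of "{i\<in>{..<N}. s < ennreal (X (\<tau> i))}" "{..<Suc k}"] by simp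
        then have "real (Suc k) / N \<le> card {i\<in>{..<N}. s < ennreal (X (\<tau> i))} / N"
          by (intro divide_right_mono) auto
        with t * show False by linarith
      qed
    qed
    moreover have "0 \<le> t" using t(1) by (smt (verit) divide_nonneg_nonneg of_nat_0_le_iff)
    ultimately have "{s. emeasure lebesgue {u \<in> {0..1}. s < ennreal \<bar>f u\<bar>} \<le> ennreal t} = {ennreal (X (\<tau> k))..}"
      unfolding dist by (auto simp: ennreal_le_iff)
    then show ?thesis unfolding rearrangement_def by simp
  qed
  \<comment> \<open>The endpoint 1 belongs to the domain of integration but to no half-open
    cell.\<close>
  have rearr1: "rearrangement f 1 = 0"
  proof -
    have "card {i\<in>{..<N}. 0 < ennreal (X (\<tau> i))} \<le> N"
      using card_mono[OF finite_lessThan, of "{i\<in>{..<N}. 0 < ennreal (X (\<tau> i))}" N] by auto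
    then have "emeasure lebesgue {u \<in> {0..1}. 0 < ennreal \<bar>f u\<bar>} \<le> ennreal 1"
      unfolding dist using N by (intro ennreal_leI) (simp add: divide_simps)
    then have "rearrangement f 1 \<le> 0" unfolding rearrangement_def by (intro Inf_lower) auto
    then show ?thesis by simp
  qed
  let ?c = "\<lambda>k. {real k / N ..< real (Suc k) / N}"
  have "rearrangement f t * indicator {0..1} t = (\<Sum>k<N. ennreal (X (\<tau> k)) * indicator (?c k) t)" for t
  proof (cases "0 \<le> t \<and> t < 1")
    case True
    define k where "k = nat \<lfloor>t * N\<rfloor>"
    have "0 \<le> t * N" using True by simp
    then have k1: "real k \<le> t * N" "t * N < real (Suc k)" unfolding k_def by linarith+
    have "t * N < N" using True N by simp
    with k1 have kN: "k < N" by (metis of_nat_less_iff order_le_less_trans)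
    have k2: "real k / N \<le> t" "t < real (Suc k) / N"
      using k1 N by (auto simp: pos_divide_le_eq pos_less_divide_eq)
    have "ennreal (X (\<tau> i)) * indicator (?c i) t = (if i = k then ennreal (X (\<tau> k)) else 0)" for i
    proof -
      have "t \<in> ?c i \<Longrightarrow> i = k"
      proof -
        assume "t \<in> ?c i"
        then have "real i \<le> t * N" "t * N < real (Suc i)"
          using N by (auto simp: pos_divide_le_eq pos_less_divide_eq)
        with k1 have "real i < real (Suc k)" "real k < real (Suc i)" by linarith+
        then show ?thesis by linarith
      qed
      moreover have "t \<in> ?c k" using k2 by simp
      ultimately show ?thesis by (cases "i = k") (auto simp: indicator_def simp del: of_nat_Suc)
    qed
    then show ?thesis using rearr[OF k2 kN] True kN by simp
  next
    case False
    have "indicator (?c k) t = (0::ennreal)" if "k < N" for k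
    proof -
      have "0 \<le> real k / N" "real (Suc k) / N \<le> 1" using that by (auto simp: divide_simps)
      with False have "t \<notin> ?c k" unfolding atLeastLessThan_iff by linarith
      then show ?thesis by (rule indicator_eq_0_iff[THEN iffD2])
    qed
    moreover have "rearrangement f t * indicator {0..1} t = 0"
      using False rearr1 by (cases "t = 1") (auto simp: indicator_def)
    ultimately show ?thesis by simp
  qed
  then have "Lorentz_norm \<phi> f = (\<integral>\<^sup>+t. (\<Sum>k<N. ennreal (X (\<tau> k)) * indicator (?c k) t) \<partial>Stieltjes \<phi>)"
    unfolding Lorentz_norm_def by simp
  also have "\<dots> = (\<Sum>k<N. ennreal (X (\<tau> k)) * ennreal (weight \<phi> N k))"
    by (subst nn_integral_sum, measurable) (auto simp: nn_integral_cmult_indicator emeasure_Stieltjes_cell[OF phi] simp del: of_nat_Suc)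
  also have "\<dots> = (\<Sum>k<N. ennreal (weight \<phi> N k * X (\<tau> k)))"
    using X tau weight_nonneg[OF phi] by (intro sum.cong) (auto simp: ennreal_mult' mult.commute)
  also have "\<dots> = ennreal (\<Sum>k<N. weight \<phi> N k * X (\<tau> k))"
    using X tau weight_nonneg[OF phi] by (intro sum_ennreal) auto
  finally show ?thesis .
qed

section \<open>The norm on a finite uniform probability space\<close>

text \<open>Summation by parts: decreasing nonnegative coefficients preserve an inequality between
  all partial sums.\<close>

lemma abel_sum_mono:
  fixes a u v :: "nat \<Rightarrow> real"
  assumes a: "\<And>i j. i \<le> j \<Longrightarrow> j < N \<Longrightarrow> a j \<le> a i" "\<And>i. i < N \<Longrightarrow> 0 \<le> a i"
    and le: "\<And>J. J \<le> N \<Longrightarrow> (\<Sum>k<J. u k) \<le> (\<Sum>k<J. v k)"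
  shows "(\<Sum>k<N. a k * u k) \<le> (\<Sum>k<N. a k * v k)"
proof -
  define d where "d k = v k - u k" for k
  have d: "0 \<le> (\<Sum>k<J. d k)" if "J \<le> N" for J
    using le[OF that] by (simp add: d_def sum_subtractf)
  \<comment> \<open>The boundary term of the summation by parts is kept on the left as the induction
    invariant; it is nonnegative at the end.\<close>
  have *: "a M * (\<Sum>k<Suc M. d k) \<le> (\<Sum>k<Suc M. a k * d k)" if "M < N" for M
    using that
  proof (induction M)
    case (Suc M)
    have "a (Suc M) * (\<Sum>k<Suc M. d k) \<le> a M * (\<Sum>k<Suc M. d k)"
      using Suc.prems by (intro mult_right_mono a d) auto
    with Suc.IH Suc.prems
    have "a (Suc M) * (\<Sum>k<Suc M. d k) \<le> (\<Sum>k<Suc M. a k * d k)" by simp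
    then show ?case unfolding sum.lessThan_Suc[of _ "Suc M"] by (simp add: distrib_left)
  qed simp
  have "0 \<le> (\<Sum>k<N. a k * d k)"
  proof (cases N)
    case (Suc M)
    then have "0 \<le> a M * (\<Sum>k<Suc M. d k)" by (intro mult_nonneg_nonneg a d) auto
    with *[of M] Suc show ?thesis by simp
  qed simp
  then show ?thesis by (simp add: d_def right_diff_distrib sum_subtractf)
qed

text \<open>A set with m + 1 elements has a maximum of at least m, whose term is at most
  \<open>b m\<close>; remove it and use induction.\<close>

lemma sum_le_sum_initial:
  fixes b :: "nat \<Rightarrow> real"
  assumes b: "\<And>i j. i \<le> j \<Longrightarrow> j < N \<Longrightarrow> b j \<le> b i" and "S \<subseteq> {..<N}"
  shows "sum b S \<le> (\<Sum>k<card S. b k)"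
  using assms(2)
proof (induction "card S" arbitrary: S)
  case 0
  then show ?case using finite_subset[OF 0(2)] by simp
next
  case (Suc m)
  have fin: "finite S" using finite_subset[OF Suc.prems] by simp
  have ne: "S \<noteq> {}" using Suc.hyps(2) by auto
  let ?M = "Max S"
  have M: "?M \<in> S" using fin ne by simp
  have "S \<subseteq> {..?M}" using fin by auto
  from card_mono[OF _ this] Suc.hyps(2) have "m \<le> ?M" by simp
  then have "b ?M \<le> b m" using M Suc.prems by (intro b) auto
  moreover have "sum b (S - {?M}) \<le> (\<Sum>k<m. b k)"
  proof -
    have c: "m = card (S - {?M})" using Suc.hyps(2) M fin by (simp add: card_Diff_singleton)
    show ?thesis using Suc.hyps(1)[OF c] Suc.prems c by auto
  qed
  ultimately show ?case
    using Suc.hyps(2)[symmetric] sum.remove[OF fin M, of b] by simp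
qed

definition sorted_bij :: "'a set \<Rightarrow> ('a \<Rightarrow> real) \<Rightarrow> (nat \<Rightarrow> 'a) \<Rightarrow> bool" where
  "sorted_bij A X \<tau> \<longleftrightarrow> bij_betw \<tau> {..<card A} A \<and>
     (\<forall>i j. i \<le> j \<longrightarrow> j < card A \<longrightarrow> X (\<tau> j) \<le> X (\<tau> i))"

lemma ex_sorted_bij:
  assumes "finite A" shows "\<exists>\<tau>. sorted_bij A X \<tau>"
proof -
  obtain xs where xs: "set xs = A" "distinct xs"
    using finite_distinct_list[OF assms] by auto
  define ys where "ys = rev (sort_key X xs)"
  have ys: "set ys = A" "distinct ys" "length ys = card A"
    using xs distinct_card[of xs] by (auto simp: ys_def)
  have s: "sorted_wrt (\<ge>) (map X ys)"
    by (simp add: ys_def rev_map[symmetric] sorted_wrt_rev)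
  have "sorted_bij A X (\<lambda>k. ys ! k)"
    unfolding sorted_bij_def
  proof (intro conjI allI impI)
    show "bij_betw (\<lambda>k. ys ! k) {..<card A} A"
      using bij_betw_nth[OF ys(2)] ys by auto
    fix i j assume "i \<le> j" "j < card A"
    then show "X (ys ! j) \<le> X (ys ! i)"
      using sorted_wrt_nth_less[OF s, of i j] ys by (cases "i = j") auto
  qed
  then show ?thesis by blast
qed

text \<open>The norm of \<open>\<Lambda>(\<phi>)\<close> on the probability space \<open>A\<close> with uniform distribution.\<close>

definition dnorm :: "(real \<Rightarrow> real) \<Rightarrow> 'a set \<Rightarrow> ('a \<Rightarrow> real) \<Rightarrow> real" where
  "dnorm \<phi> A X = (\<Sum>k<card A. weight \<phi> (card A) k * X ((SOME \<tau>. sorted_bij A X \<tau>) k))"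

text \<open>The rearrangement inequality. Read through \<tau>, the first J values in the order
  \<sigma> are some J values of the sorted sequence, so the partial sums compare.\<close>

lemma sum_le_sorted_sum:
  assumes phi: "\<phi> \<in> Phi" and \<sigma>: "bij_betw \<sigma> {..<card A} A" and \<tau>: "sorted_bij A X \<tau>"
  shows "(\<Sum>k<card A. weight \<phi> (card A) k * X (\<sigma> k)) \<le> (\<Sum>k<card A. weight \<phi> (card A) k * X (\<tau> k))"
proof (rule abel_sum_mono)
  let ?N = "card A"
  fix J assume J: "J \<le> ?N"
  define \<rho> where "\<rho> = the_inv_into {..<?N} \<tau> \<circ> \<sigma>"
  have b: "bij_betw \<tau> {..<?N} A" using \<tau> by (simp add: sorted_bij_def)
  have bij: "bij_betw \<rho> {..<?N} {..<?N}"
    unfolding \<rho>_def by (rule bij_betw_trans[OF \<sigma> bij_betw_the_inv_into[OF b]])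
  have eq: "\<tau> (\<rho> k) = \<sigma> k" if "k < ?N" for k
    using that \<sigma> b unfolding \<rho>_def comp_def
    by (intro f_the_inv_into_f) (auto simp: bij_betw_def)
  have inj: "inj_on \<rho> {..<J}" using bij J by (auto simp: bij_betw_def intro: inj_on_subset)
  have sub: "\<rho> ` {..<J} \<subseteq> {..<?N}" using bij J by (auto simp: bij_betw_def)
  have "(\<Sum>k<J. X (\<sigma> k)) = (\<Sum>k<J. X (\<tau> (\<rho> k)))"
    using J eq by (intro sum.cong) auto
  also have "\<dots> = (\<Sum>k\<in>\<rho> ` {..<J}. X (\<tau> k))"
    by (simp add: sum.reindex[OF inj])
  also have "\<dots> \<le> (\<Sum>k<card (\<rho> ` {..<J}). X (\<tau> k))"
    using \<tau> by (intro sum_le_sum_initial[OF _ sub]) (auto simp: sorted_bij_def)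
  finally show "(\<Sum>k<J. X (\<sigma> k)) \<le> (\<Sum>k<J. X (\<tau> k))"
    using inj by (simp add: card_image)
qed (use phi weight_antimono weight_nonneg in auto)

lemma dnorm_eq:
  assumes phi: "\<phi> \<in> Phi" and \<tau>: "sorted_bij A X \<tau>"
  shows "dnorm \<phi> A X = (\<Sum>k<card A. weight \<phi> (card A) k * X (\<tau> k))"
proof -
  have s: "sorted_bij A X (SOME \<tau>. sorted_bij A X \<tau>)"
    by (rule someI[of "sorted_bij A X", OF \<tau>])
  have b: "bij_betw \<tau>' {..<card A} A" if "sorted_bij A X \<tau>'" for \<tau>'
    using that by (simp add: sorted_bij_def)
  show ?thesis unfolding dnorm_def
    by (rule antisym[OF sum_le_sorted_sum[OF phi b[OF s] \<tau>] sum_le_sorted_sum[OF phi b[OF \<tau>] s]])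
qed

lemma dnorm_ge:
  assumes phi: "\<phi> \<in> Phi" and "finite A" and \<sigma>: "bij_betw \<sigma> {..<card A} A"
  shows "(\<Sum>k<card A. weight \<phi> (card A) k * X (\<sigma> k)) \<le> dnorm \<phi> A X"
proof -
  obtain \<tau> where "sorted_bij A X \<tau>" using ex_sorted_bij[OF \<open>finite A\<close>] by blast
  then show ?thesis using sum_le_sorted_sum[OF phi \<sigma>] dnorm_eq[OF phi] by metis
qed

lemma dnorm_attained:
  assumes phi: "\<phi> \<in> Phi" and "finite A"
  obtains \<tau> where "bij_betw \<tau> {..<card A} A" "\<And>k. k < card A \<Longrightarrow> \<tau> k \<in> A"
    "dnorm \<phi> A X = (\<Sum>k<card A. weight \<phi> (card A) k * X (\<tau> k))"
proof -
  obtain \<tau> where t: "sorted_bij A X \<tau>" using ex_sorted_bij[OF \<open>finite A\<close>] by blast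
  show ?thesis
    by (rule that[of \<tau>]) (use t dnorm_eq[OF phi t] in \<open>auto simp: sorted_bij_def bij_betw_def\<close>)
qed

lemma dnorm_mono:
  assumes phi: "\<phi> \<in> Phi" and "finite A" and "\<And>w. w \<in> A \<Longrightarrow> X w \<le> Y w"
  shows "dnorm \<phi> A X \<le> dnorm \<phi> A Y"
proof -
  obtain \<tau> where \<tau>: "bij_betw \<tau> {..<card A} A" "\<And>k. k < card A \<Longrightarrow> \<tau> k \<in> A"
    "dnorm \<phi> A X = (\<Sum>k<card A. weight \<phi> (card A) k * X (\<tau> k))"
    using dnorm_attained[OF assms(1,2)] by blast
  note \<tau>(3)
  also have "\<dots> \<le> (\<Sum>k<card A. weight \<phi> (card A) k * Y (\<tau> k))"
    using weight_nonneg[OF phi] \<tau>(2) assms(3) by (intro sum_mono mult_left_mono) auto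
  also have "\<dots> \<le> dnorm \<phi> A Y" by (rule dnorm_ge[OF assms(1,2) \<tau>(1)])
  finally show ?thesis .
qed

lemma dnorm_zero: "dnorm \<phi> A (\<lambda>w. 0) = 0"
  by (simp add: dnorm_def)

lemma dnorm_nonneg:
  assumes "\<phi> \<in> Phi" "finite A" "\<And>w. w \<in> A \<Longrightarrow> 0 \<le> X w"
  shows "0 \<le> dnorm \<phi> A X"
  using dnorm_mono[OF assms(1,2), of "\<lambda>w. 0" X] assms(3) by (simp add: dnorm_zero)

lemma dnorm_add_le:
  assumes phi: "\<phi> \<in> Phi" and "finite A"
  shows "dnorm \<phi> A (\<lambda>w. X w + Y w) \<le> dnorm \<phi> A X + dnorm \<phi> A Y"
proof -
  obtain \<tau> where \<tau>: "bij_betw \<tau> {..<card A} A"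
    "dnorm \<phi> A (\<lambda>w. X w + Y w) = (\<Sum>k<card A. weight \<phi> (card A) k * (X (\<tau> k) + Y (\<tau> k)))"
    using dnorm_attained[OF assms] by blast
  then show ?thesis
    using dnorm_ge[OF assms \<tau>(1), of X] dnorm_ge[OF assms \<tau>(1), of Y]
    by (simp add: distrib_left sum.distrib)
qed

lemma dnorm_cmult:
  assumes phi: "\<phi> \<in> Phi" and "finite A" and "0 \<le> c"
  shows "dnorm \<phi> A (\<lambda>w. c * X w) = c * dnorm \<phi> A X"
proof -
  obtain \<tau> where t: "sorted_bij A X \<tau>" using ex_sorted_bij[OF \<open>finite A\<close>] by blast
  then have "sorted_bij A (\<lambda>w. c * X w) \<tau>"
    using \<open>0 \<le> c\<close> by (auto simp: sorted_bij_def intro: mult_left_mono)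
  from dnorm_eq[OF phi t] dnorm_eq[OF phi this] show ?thesis
    by (simp add: sum_distrib_left algebra_simps)
qed

lemma dnorm_sum_le:
  assumes phi: "\<phi> \<in> Phi" and "finite A" and "finite J"
  shows "dnorm \<phi> A (\<lambda>w. \<Sum>j\<in>J. X j w) \<le> (\<Sum>j\<in>J. dnorm \<phi> A (X j))"
  using \<open>finite J\<close>
proof (induction J rule: finite_induct)
  case (insert j J)
  then show ?case using dnorm_add_le[OF assms(1,2), of "X j" "\<lambda>w. \<Sum>j\<in>J. X j w"] by simp
qed (simp add: dnorm_zero)

text \<open>On functions built from a chain of sets the norm is additive, since one ordering of \<open>A\<close> sorts
  all the indicator functions simultaneously.\<close>

lemma dnorm_chain:
  assumes phi: "\<phi> \<in> Phi" and fin: "finite A" and J: "finite J"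
    and c: "\<And>j. j \<in> J \<Longrightarrow> 0 \<le> c j"
    and sub: "\<And>j. j \<in> J \<Longrightarrow> B j \<subseteq> A"
    and chain: "\<And>i j. i \<in> J \<Longrightarrow> j \<in> J \<Longrightarrow> B i \<subseteq> B j \<or> B j \<subseteq> B i"
  shows "dnorm \<phi> A (\<lambda>w. \<Sum>j\<in>J. c j * indicator (B j) w) = (\<Sum>j\<in>J. c j * \<phi> (card (B j) / card A))"
proof -
  let ?N = "card A"
  \<comment> \<open>Sort by the number of chain members containing a point. Along a chain, a point
    with at least the count of another lies in every set that contains the other.\<close>
  obtain \<tau> where t: "sorted_bij A (\<lambda>w. \<Sum>j\<in>J. indicator (B j) w) \<tau>"
    using ex_sorted_bij[OF fin] by blast
  have bij: "bij_betw \<tau> {..<?N} A" using t by (simp add: sorted_bij_def)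
  have ind: "\<tau> k \<in> B j" if "\<tau> k' \<in> B j" "k \<le> k'" "k' < ?N" "j \<in> J" for k k' j
  proof (rule ccontr)
    assume *: "\<tau> k \<notin> B j"
    have "(\<Sum>i\<in>J. indicator (B i) (\<tau> k)) < (\<Sum>i\<in>J. indicator (B i) (\<tau> k') :: real)"
    proof (rule sum_strict_mono_ex1[OF J])
      show "\<forall>i\<in>J. indicator (B i) (\<tau> k) \<le> (indicator (B i) (\<tau> k') :: real)"
        using chain[of _ j] that * by (auto simp: indicator_def)
      show "\<exists>i\<in>J. indicator (B i) (\<tau> k) < (indicator (B i) (\<tau> k') :: real)"
        using that * by (intro bexI[of _ j]) (auto simp: indicator_def)
    qed
    moreover have "(\<Sum>i\<in>J. indicator (B i) (\<tau> k')) \<le> (\<Sum>i\<in>J. indicator (B i) (\<tau> k) :: real)"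
      using t that by (auto simp: sorted_bij_def)
    ultimately show False by simp
  qed
  have "sorted_bij A (\<lambda>w. \<Sum>j\<in>J. c j * indicator (B j) w) \<tau>"
    unfolding sorted_bij_def
  proof (intro conjI allI impI bij)
    fix i j assume "i \<le> j" "j < ?N"
    then show "(\<Sum>l\<in>J. c l * indicator (B l) (\<tau> j)) \<le> (\<Sum>l\<in>J. c l * indicator (B l) (\<tau> i))"
      using ind[of j _ i] c by (intro sum_mono mult_left_mono) (auto simp: indicator_def)
  qed
  then have "dnorm \<phi> A (\<lambda>w. \<Sum>j\<in>J. c j * indicator (B j) w)
      = (\<Sum>k<?N. weight \<phi> ?N k * (\<Sum>j\<in>J. c j * indicator (B j) (\<tau> k)))"
    by (rule dnorm_eq[OF phi])
  also have "\<dots> = (\<Sum>j\<in>J. c j * (\<Sum>k<?N. weight \<phi> ?N k * indicator (B j) (\<tau> k)))"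
    unfolding sum_distrib_left by (subst sum.swap) (simp add: algebra_simps)
  also have "\<dots> = (\<Sum>j\<in>J. c j * \<phi> (card (B j) / ?N))"
  proof (intro sum.cong refl arg_cong2[where f = "(*)"])
    fix j assume j: "j \<in> J"
    let ?S = "{k\<in>{..<?N}. \<tau> k \<in> B j}"
    have cS: "card ?S = card (B j)"
    proof -
      have "bij_betw \<tau> {k\<in>{..<?N}. \<tau> k \<in> B j} {w\<in>A. w \<in> B j}"
        using bij by (rule bij_betw_Collect) auto
      moreover have "{w\<in>A. w \<in> B j} = B j" using sub[OF j] by auto
      ultimately show ?thesis using bij_betw_same_card by metis
    qed
    \<comment> \<open>The positions of the points of \<open>B j\<close> form an initial segment, so
      their weights telescope to a value of \<phi>.\<close>
    have "?S = {..<card ?S}"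
    proof (cases "?S = {}")
      case False
      have fS: "finite ?S" by simp
      obtain M where M: "M \<in> ?S" "\<forall>k\<in>?S. k \<le> M"
        using Max_in[OF fS False] Max_ge[OF fS] by blast
      have "{..M} \<subseteq> ?S"
      proof
        fix k assume "k \<in> {..M}"
        then show "k \<in> ?S" using M(1) ind[of M j k] j by simp
      qed
      moreover have "?S \<subseteq> {..M}" using M(2) by blast
      ultimately have "?S = {..M}" by (rule antisym[rotated])
      then have *: "?S = {..<Suc M}" by (simp only: lessThan_Suc_atMost)
      show ?thesis unfolding * by simp
    next
      case True
      show ?thesis unfolding True by simp
    qed
    then have S: "?S = {..<card (B j)}" unfolding cS .
    have "(\<Sum>k<?N. weight \<phi> ?N k * indicator (B j) (\<tau> k)) = (\<Sum>k\<in>?S. weight \<phi> ?N k)"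
      by (rule sum.mono_neutral_cong_right) auto
    then show "(\<Sum>k<?N. weight \<phi> ?N k * indicator (B j) (\<tau> k)) = \<phi> (card (B j) / ?N)"
      unfolding S sum_weight[OF phi] .
  qed
  finally show ?thesis .
qed

text \<open>The uniform weights 1/N have smaller partial sums than the increments of \<phi>, because
  t \<le> \<phi>(t). It turns moment estimates into lower bounds for the norm.\<close>

lemma mean_le_dnorm:
  assumes phi: "\<phi> \<in> Phi" and fin: "finite A" and X: "\<And>w. w \<in> A \<Longrightarrow> 0 \<le> X w"
  shows "(\<Sum>w\<in>A. X w) / card A \<le> dnorm \<phi> A X"
proof (cases "A = {}")
  case False
  let ?N = "card A"
  have N: "0 < ?N" using False fin by (simp add: card_gt_0_iff)
  obtain \<tau> where t: "sorted_bij A X \<tau>" using ex_sorted_bij[OF fin] by blast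
  then have bij: "bij_betw \<tau> {..<?N} A" by (simp add: sorted_bij_def)
  have "(\<Sum>w\<in>A. X w) / ?N = (\<Sum>k<?N. X (\<tau> k) * (1 / ?N))"
    using sum.reindex_bij_betw[OF bij, of X] by (simp add: sum_divide_distrib[symmetric])
  also have "\<dots> \<le> (\<Sum>k<?N. X (\<tau> k) * weight \<phi> ?N k)"
  proof (rule abel_sum_mono)
    fix J assume "J \<le> ?N"
    then have "real J / ?N \<le> \<phi> (real J / ?N)" using N by (intro Phi_ge[OF phi]) auto
    then show "(\<Sum>k<J. 1 / ?N) \<le> (\<Sum>k<J. weight \<phi> ?N k)" by (simp add: sum_weight[OF phi])
  qed (use t X bij in \<open>auto simp: sorted_bij_def bij_betw_def\<close>)
  also have "\<dots> = dnorm \<phi> A X" by (simp add: dnorm_eq[OF phi t] mult.commute)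
  finally show ?thesis .
qed (simp add: dnorm_def)

section \<open>Hit counts of random permutations: moments and tails\<close>

abbreviation perms :: "nat \<Rightarrow> (nat \<Rightarrow> nat) set" where
  "perms n \<equiv> {\<pi>. \<pi> permutes {1..n}}"

lemma finite_perms: "finite (perms n)"
  by (simp add: finite_permutations)

lemma card_perms: "card (perms n) = fact n"
  by (rule card_permutations) auto

definition hits :: "(nat \<times> nat) set \<Rightarrow> (nat \<Rightarrow> nat) \<Rightarrow> nat" where
  "hits K \<pi> = card {p\<in>K. \<pi> (fst p) = snd p}"

lemma hits_le_card: "finite K \<Longrightarrow> hits K \<pi> \<le> card K"
  unfolding hits_def by (rule card_mono) auto

text \<open>Composition with the inverse of \<open>\<pi>0\<close> turns the permutations through A
  into those that fix the rows of A pointwise.\<close>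

lemma card_perms_extending:
  assumes \<pi>0: "\<pi>0 permutes {1..n}" and A: "A \<subseteq> {1..n} \<times> {1..n}" "\<And>p. p \<in> A \<Longrightarrow> \<pi>0 (fst p) = snd p"
  shows "card {\<pi>\<in>perms n. \<forall>p\<in>A. \<pi> (fst p) = snd p} = fact (n - card A)"
proof -
  let ?D = "fst ` A"
  have inj: "inj_on fst A"
    using A(2) by (intro inj_onI) (metis prod_eq_iff)
  have D: "?D \<subseteq> {1..n}" using A(1) by auto
  have "bij_betw (\<lambda>\<sigma>. \<pi>0 \<circ> \<sigma>) {\<sigma>. \<sigma> permutes ({1..n} - ?D)} {\<pi>\<in>perms n. \<forall>p\<in>A. \<pi> (fst p) = snd p}"
  proof (rule bij_betw_byWitness[where f' = "\<lambda>\<pi>. inv \<pi>0 \<circ> \<pi>"])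
    show "\<forall>\<sigma>\<in>{\<sigma>. \<sigma> permutes ({1..n} - ?D)}. inv \<pi>0 \<circ> (\<pi>0 \<circ> \<sigma>) = \<sigma>"
      using permutes_inv_o(2)[OF \<pi>0] by (simp add: o_assoc)
    show "\<forall>\<pi>\<in>{\<pi>\<in>perms n. \<forall>p\<in>A. \<pi> (fst p) = snd p}. \<pi>0 \<circ> (inv \<pi>0 \<circ> \<pi>) = \<pi>"
      using permutes_inv_o(1)[OF \<pi>0] by (simp add: o_assoc)
    show "(\<lambda>\<sigma>. \<pi>0 \<circ> \<sigma>) ` {\<sigma>. \<sigma> permutes ({1..n} - ?D)} \<subseteq> {\<pi>\<in>perms n. \<forall>p\<in>A. \<pi> (fst p) = snd p}"
    proof (intro image_subsetI)
      fix \<sigma> assume "\<sigma> \<in> {\<sigma>. \<sigma> permutes ({1..n} - ?D)}"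
      then have \<sigma>: "\<sigma> permutes ({1..n} - ?D)" by simp
      then have "\<sigma> permutes {1..n}" by (rule permutes_subset) auto
      moreover have "\<sigma> (fst p) = fst p" if "p \<in> A" for p
        using that by (intro permutes_not_in[OF \<sigma>]) auto
      ultimately show "\<pi>0 \<circ> \<sigma> \<in> {\<pi>\<in>perms n. \<forall>p\<in>A. \<pi> (fst p) = snd p}"
        using \<pi>0 A(2) by (auto intro: permutes_compose)
    qed
    show "(\<lambda>\<pi>. inv \<pi>0 \<circ> \<pi>) ` {\<pi>\<in>perms n. \<forall>p\<in>A. \<pi> (fst p) = snd p} \<subseteq> {\<sigma>. \<sigma> permutes ({1..n} - ?D)}"
    proof (intro image_subsetI)
      fix \<pi> assume "\<pi> \<in> {\<pi>\<in>perms n. \<forall>p\<in>A. \<pi> (fst p) = snd p}"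
      then have \<pi>: "\<pi> permutes {1..n}" "\<forall>p\<in>A. \<pi> (fst p) = snd p" by auto
      have "inv \<pi>0 \<circ> \<pi> permutes {1..n}"
        using \<pi>(1) permutes_inv[OF \<pi>0] by (rule permutes_compose)
      moreover have "(inv \<pi>0 \<circ> \<pi>) x = x" if "x \<in> {1..n} - ({1..n} - ?D)" for x
      proof -
        from that obtain p where p: "p \<in> A" "x = fst p" by auto
        then show ?thesis using \<pi>(2) A(2)[OF p(1)] permutes_inverses(2)[OF \<pi>0, of x] by simp
      qed
      ultimately show "inv \<pi>0 \<circ> \<pi> \<in> {\<sigma>. \<sigma> permutes ({1..n} - ?D)}"
        using permutes_superset[of "inv \<pi>0 \<circ> \<pi>" "{1..n}" "{1..n} - ?D"] by blast
    qed
  qed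
  then have "card {\<pi>\<in>perms n. \<forall>p\<in>A. \<pi> (fst p) = snd p} = card {\<sigma>. \<sigma> permutes ({1..n} - ?D)}"
    by (rule bij_betw_same_card[symmetric])
  also have "\<dots> = fact (n - card A)"
    using D card_image[OF inj] finite_subset[OF D]
    by (intro card_permutations) (auto simp: card_Diff_subset)
  finally show ?thesis .
qed

lemma card_perms_extending_le:
  assumes "A \<subseteq> {1..n} \<times> {1..n}"
  shows "card {\<pi>\<in>perms n. \<forall>p\<in>A. \<pi> (fst p) = snd p} \<le> fact (n - card A)"
proof (cases "{\<pi>\<in>perms n. \<forall>p\<in>A. \<pi> (fst p) = snd p} = {}")
  case False
  then obtain \<pi>0 where "\<pi>0 permutes {1..n}" "\<forall>p\<in>A. \<pi>0 (fst p) = snd p" by auto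
  with card_perms_extending[OF _ assms, of \<pi>0] show ?thesis by simp
next
  case True
  show ?thesis unfolding True by simp
qed

lemma card_perms_through:
  assumes "i \<in> {1..n}" "j \<in> {1..n}"
  shows "card {\<pi>\<in>perms n. \<pi> i = j} = fact (n - 1)"
  using card_perms_extending[OF permutes_swap_id[OF assms], of "{(i, j)}"] assms by simp

text \<open>Double counting of pairs of a permutation and a j-subset of the positions that it meets.
  Binomial moments are convenient because permutations through j prescribed positions are easy to
  count.\<close>

lemma sum_hits_choose:
  assumes "finite K"
  shows "(\<Sum>\<pi>\<in>perms n. hits K \<pi> choose j) =
    (\<Sum>A | A \<subseteq> K \<and> card A = j. card {\<pi>\<in>perms n. \<forall>p\<in>A. \<pi> (fst p) = snd p})"
proof -
  have fA: "finite {A. A \<subseteq> K \<and> card A = j}"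
    using assms by (auto intro: finite_subset[of _ "Pow K"])
  have "hits K \<pi> choose j = (\<Sum>A | A \<subseteq> K \<and> card A = j. of_bool (\<forall>p\<in>A. \<pi> (fst p) = snd p))" for \<pi>
  proof -
    have "hits K \<pi> choose j = card {A. A \<subseteq> {p\<in>K. \<pi> (fst p) = snd p} \<and> card A = j}"
      unfolding hits_def using assms by (subst n_subsets) auto
    also have "{A. A \<subseteq> {p\<in>K. \<pi> (fst p) = snd p} \<and> card A = j}
       = {A \<in> {A. A \<subseteq> K \<and> card A = j}. \<forall>p\<in>A. \<pi> (fst p) = snd p}" by blast
    also have "card \<dots> = (\<Sum>A | A \<subseteq> K \<and> card A = j. of_bool (\<forall>p\<in>A. \<pi> (fst p) = snd p))"
      using fA by (simp add: sum_of_bool_eq Int_def)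
    finally show ?thesis .
  qed
  then have "(\<Sum>\<pi>\<in>perms n. hits K \<pi> choose j) =
    (\<Sum>\<pi>\<in>perms n. \<Sum>A | A \<subseteq> K \<and> card A = j. of_bool (\<forall>p\<in>A. \<pi> (fst p) = snd p))" by simp
  also have "\<dots> = (\<Sum>A | A \<subseteq> K \<and> card A = j. \<Sum>\<pi>\<in>perms n. of_bool (\<forall>p\<in>A. \<pi> (fst p) = snd p))"
    by (rule sum.swap)
  also have "\<dots> = (\<Sum>A | A \<subseteq> K \<and> card A = j. card {\<pi>\<in>perms n. \<forall>p\<in>A. \<pi> (fst p) = snd p})"
    using finite_perms[of n] by (simp add: sum_of_bool_eq Int_def)
  finally show ?thesis .
qed

lemma sum_hits_choose_le:
  assumes K: "K \<subseteq> {1..n} \<times> {1..n}"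
  shows "(\<Sum>\<pi>\<in>perms n. hits K \<pi> choose j) \<le> (card K choose j) * fact (n - j)"
proof -
  have fin: "finite K" using K by (rule finite_subset) auto
  have "(\<Sum>\<pi>\<in>perms n. hits K \<pi> choose j) \<le> (\<Sum>A | A \<subseteq> K \<and> card A = j. fact (n - j))"
    unfolding sum_hits_choose[OF fin]
    by (rule sum_mono) (use K card_perms_extending_le in \<open>auto dest: subset_trans\<close>)
  also have "\<dots> = (card K choose j) * fact (n - j)"
    using fin by (simp add: n_subsets)
  finally show ?thesis .
qed

text \<open>The identity passes through every set of diagonal positions, so the count of extensions
  is exact here.\<close>

lemma sum_fixed_choose:
  assumes k: "k \<le> n"
  shows "(\<Sum>\<pi>\<in>perms n. hits ((\<lambda>i. (i, i)) ` {1..k}) \<pi> choose j) = (k choose j) * fact (n - j)"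
proof -
  let ?K = "(\<lambda>i. (i, i)) ` {1..k}"
  have c: "card ?K = k" by (simp add: card_image inj_on_def)
  have "(\<Sum>\<pi>\<in>perms n. hits ?K \<pi> choose j) = (\<Sum>A | A \<subseteq> ?K \<and> card A = j. fact (n - j))"
    unfolding sum_hits_choose[OF finite_imageI[OF finite_atLeastAtMost]]
  proof (rule sum.cong[OF refl])
    fix A assume A: "A \<in> {A. A \<subseteq> ?K \<and> card A = j}"
    then have "A \<subseteq> {1..n} \<times> {1..n}" using k by fastforce
    from card_perms_extending[OF permutes_id this] A
    show "card {\<pi>\<in>perms n. \<forall>p\<in>A. \<pi> (fst p) = snd p} = fact (n - j)" by fastforce
  qed
  also have "\<dots> = (k choose j) * fact (n - j)"
    using n_subsets[of ?K j] c by (simp only: finite_imageI finite_atLeastAtMost sum_constant of_nat_id)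
  finally show ?thesis .
qed

text \<open>\<open>falling_ratio n k j\<close> is the quotient \<open>k (k - 1) \<dots> (k - j + 1) / (n (n - 1) \<dots> (n - j + 1))\<close>.\<close>

definition falling_ratio :: "nat \<Rightarrow> nat \<Rightarrow> nat \<Rightarrow> real" where
  "falling_ratio n k j = real (k choose j) * fact j * fact (n - j) / fact n"

lemma falling_ratio_0: "falling_ratio n k 0 = 1"
  by (simp add: falling_ratio_def)

lemma falling_ratio_Suc:
  assumes "j < n"
  shows "falling_ratio n k (Suc j) = falling_ratio n k j * ((real k - real j) / (real n - real j))"
proof -
  have "(k choose Suc j) * Suc j = (k choose j) * (k - j)"
    by (metis binomial_absorb_comp binomial_absorption mult.commute)
  then have "real (k choose Suc j) * real (Suc j) = real (k choose j) * real (k - j)"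
    by (metis of_nat_mult)
  also have "\<dots> = real (k choose j) * (real k - real j)"
    by (cases "j \<le> k") (auto simp: of_nat_diff)
  finally have 1: "real (k choose Suc j) * real (Suc j) = real (k choose j) * (real k - real j)" .
  have "fact (n - j) = (real n - real j) * fact (n - Suc j)"
    using assms by (subst fact_reduce) (auto simp: of_nat_diff)
  then have 2: "fact (n - Suc j) = fact (n - j) / (real n - real j)"
    using assms by simp
  have "falling_ratio n k (Suc j) = (real (k choose Suc j) * real (Suc j)) * fact j * fact (n - Suc j) / fact n"
    unfolding falling_ratio_def fact_Suc by (simp only: mult_ac of_nat_mult)
  also have "\<dots> = falling_ratio n k j * ((real k - real j) / (real n - real j))"
    unfolding 1 2 falling_ratio_def by (simp add: mult_ac)
  finally show ?thesis .
qed

lemma falling_ratio_nonneg: "0 \<le> falling_ratio n k j"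
  by (simp add: falling_ratio_def)

lemma falling_ratio_eq_0: "k < j \<Longrightarrow> falling_ratio n k j = 0"
  by (simp add: falling_ratio_def)

text \<open>Each factor (k - j)/(n - j) is at most k/n as long as j < k, and from j = k on the
  product vanishes.\<close>

lemma falling_ratio_le:
  assumes "k \<le> n" shows "falling_ratio n k j \<le> (real k / real n) ^ j"
proof (induction j)
  case (Suc j)
  show ?case
  proof (cases "j < k")
    case True
    then have "(real k - real j) / (real n - real j) \<le> real k / real n"
      using assms by (simp add: divide_simps) (simp add: algebra_simps mult_left_mono)
    then have "falling_ratio n k j * ((real k - real j) / (real n - real j)) \<le> (real k / real n) ^ j * (real k / real n)"
      using Suc True assms by (intro mult_mono) auto
    then show ?thesis using True assms by (simp add: falling_ratio_Suc mult.commute)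
  qed (simp add: falling_ratio_eq_0)
qed (simp add: falling_ratio_0)

lemma falling_ratio_le_1: "k \<le> n \<Longrightarrow> falling_ratio n k j \<le> 1"
  by (rule order_trans[OF falling_ratio_le]) (auto intro!: power_le_one simp: divide_le_eq_1)

lemma choose_fact_eq: "real ((k choose j) * fact (n - j)) / fact n = falling_ratio n k j / fact j"
  by (simp add: falling_ratio_def)

lemma mean_hits_choose_le:
  assumes "K \<subseteq> {1..n} \<times> {1..n}"
  shows "(\<Sum>\<pi>\<in>perms n. real (hits K \<pi> choose j)) / fact n \<le> falling_ratio n (card K) j / fact j"
  using sum_hits_choose_le[OF assms, of j] unfolding choose_fact_eq[symmetric] of_nat_sum[symmetric]
  by (intro divide_right_mono) (auto simp only: of_nat_le_iff, simp)

text \<open>Markov's inequality for the binomial moment of order j, since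
  \<open>hits K \<pi> choose j\<close> is at least 1 on the event. The bounds are the arguments of
  \<phi> in \<open>Gamma_const\<close>.\<close>

lemma prob_hits_ge:
  assumes K: "K \<subseteq> {1..n} \<times> {1..n}" "card K \<le> n"
  shows "real (card {\<pi>\<in>perms n. j \<le> hits K \<pi>}) / fact n \<le> (real (card K) / n) ^ j / fact j"
proof -
  have "real (card {\<pi>\<in>perms n. j \<le> hits K \<pi>}) = (\<Sum>\<pi>\<in>perms n. of_bool (j \<le> hits K \<pi>))"
    using finite_perms[of n] by (simp add: sum_of_bool_eq Int_def)
  also have "\<dots> \<le> (\<Sum>\<pi>\<in>perms n. real (hits K \<pi> choose j))"
    by (intro sum_mono) (auto simp: Suc_le_eq)
  finally have "real (card {\<pi>\<in>perms n. j \<le> hits K \<pi>}) / fact n \<le> (\<Sum>\<pi>\<in>perms n. real (hits K \<pi> choose j)) / fact n"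
    by (rule divide_right_mono) simp
  also note mean_hits_choose_le[OF K(1)]
  also have "falling_ratio n (card K) j / fact j \<le> (real (card K) / n) ^ j / fact j"
    by (intro divide_right_mono falling_ratio_le K) simp
  finally show ?thesis .
qed

text \<open>Binomial expansion of the power and the bound 1/j! for every binomial moment. The
  right-hand side is the same mean for a Poisson variable with parameter 1.\<close>

lemma mean_exp_hits_le:
  fixes z :: real
  assumes K: "K \<subseteq> {1..n} \<times> {1..n}" "card K \<le> n" and z: "0 \<le> z"
  shows "(\<Sum>\<pi>\<in>perms n. (1 + z) ^ hits K \<pi>) / fact n \<le> exp z"
proof -
  have fin: "finite K" using K(1) by (rule finite_subset) auto
  have "(1 + z) ^ hits K \<pi> = (\<Sum>j\<le>card K. z ^ j * real (hits K \<pi> choose j))" for \<pi>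
  proof -
    have "(z + 1) ^ hits K \<pi> = (\<Sum>j\<le>hits K \<pi>. z ^ j * real (hits K \<pi> choose j))"
      unfolding binomial_ring by (simp add: mult.commute)
    also have "\<dots> = (\<Sum>j\<le>card K. z ^ j * real (hits K \<pi> choose j))"
      using hits_le_card[OF fin, of \<pi>] by (intro sum.mono_neutral_left) auto
    finally show ?thesis by (simp add: add.commute)
  qed
  then have "(\<Sum>\<pi>\<in>perms n. (1 + z) ^ hits K \<pi>) / fact n =
      (\<Sum>j\<le>card K. z ^ j * ((\<Sum>\<pi>\<in>perms n. real (hits K \<pi> choose j)) / fact n))"
    unfolding sum_divide_distrib sum_distrib_left
    by (simp add: sum_divide_distrib, subst sum.swap) simp
  also have "\<dots> \<le> (\<Sum>j\<le>card K. z ^ j * (1 / fact j))"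
  proof (intro sum_mono mult_left_mono)
    fix j
    have "(\<Sum>\<pi>\<in>perms n. real (hits K \<pi> choose j)) / fact n \<le> falling_ratio n (card K) j / fact j"
      by (rule mean_hits_choose_le[OF K(1)])
    also have "\<dots> \<le> 1 / fact j" by (intro divide_right_mono falling_ratio_le_1 K) simp
    finally show "(\<Sum>\<pi>\<in>perms n. real (hits K \<pi> choose j)) / fact n \<le> 1 / fact j" .
  qed (use z in auto)
  also have "\<dots> \<le> (\<Sum>j. z ^ j /\<^sub>R fact j)"
    using z summable_exp_generic[of z]
    by (intro order_trans[OF _ sum_le_suminf[of _ "{..card K}"]]) (auto simp: divide_inverse mult.commute)
  also have "\<dots> = exp z" by (simp add: exp_def)
  finally show ?thesis .
qed

lemma sum_incidence:
  assumes P: "P \<subseteq> {1..n} \<times> {1..n}"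
  shows "(\<Sum>\<pi>\<in>perms n. \<Sum>p\<in>P. w p * of_bool (\<pi> (fst p) = snd p)) = fact (n - 1) * (\<Sum>p\<in>P. w p :: real)"
proof -
  have "(\<Sum>\<pi>\<in>perms n. \<Sum>p\<in>P. w p * of_bool (\<pi> (fst p) = snd p))
      = (\<Sum>p\<in>P. w p * (\<Sum>\<pi>\<in>perms n. of_bool (\<pi> (fst p) = snd p)))"
    by (subst sum.swap) (simp add: sum_distrib_left)
  also have "\<dots> = (\<Sum>p\<in>P. w p * fact (n - 1))"
  proof (intro sum.cong refl arg_cong2[where f = "(*)"])
    fix p assume "p \<in> P"
    then have "fst p \<in> {1..n}" "snd p \<in> {1..n}" using P by auto
    from card_perms_through[OF this] show "(\<Sum>\<pi>\<in>perms n. of_bool (\<pi> (fst p) = snd p)) = (fact (n - 1) :: real)"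
      using finite_perms[of n] by (simp add: sum_of_bool_eq Int_def)
  qed
  finally show ?thesis by (simp only: sum_distrib_right[symmetric] mult.commute)
qed

text \<open>Expand the square over pairs of positions: at most (n - 1)! permutations pass through
  one position and at most (n - 2)! through two different ones. Keeping the second bound for equal
  positions as well completes the square of the sum.\<close>

lemma sum_incidence_square_le:
  assumes P: "P \<subseteq> {1..n} \<times> {1..n}" and w: "\<And>p. p \<in> P \<Longrightarrow> 0 \<le> w p"
  shows "(\<Sum>\<pi>\<in>perms n. (\<Sum>p\<in>P. w p * of_bool (\<pi> (fst p) = snd p))\<^sup>2)
    \<le> fact (n - 1) * (\<Sum>p\<in>P. (w p)\<^sup>2) + fact (n - 2) * (\<Sum>p\<in>P. w p :: real)\<^sup>2"
proof -
  have fin: "finite P" using P by (rule finite_subset) auto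
  let ?c = "\<lambda>p r. (\<Sum>\<pi>\<in>perms n. of_bool (\<pi> (fst p) = snd p) * of_bool (\<pi> (fst r) = snd r)) :: real"
  have c: "?c p r \<le> fact (n - 1) * of_bool (p = r) + fact (n - 2)" if "p \<in> P" "r \<in> P" for p r
  proof -
    have "?c p r = (\<Sum>\<pi>\<in>perms n. of_bool (\<forall>s\<in>{p, r}. \<pi> (fst s) = snd s))"
      by (intro sum.cong) auto
    also have "\<dots> = real (card {\<pi>\<in>perms n. \<forall>s\<in>{p, r}. \<pi> (fst s) = snd s})"
      using finite_perms[of n] by (simp add: sum_of_bool_eq Int_def)
    also have "\<dots> \<le> real (fact (n - card {p, r}))"
      using that P by (intro of_nat_mono card_perms_extending_le) auto
    also have "\<dots> \<le> fact (n - 1) * of_bool (p = r) + fact (n - 2)"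
      by (cases "p = r") (auto simp: numeral_2_eq_2)
    finally show ?thesis .
  qed
  have "(\<Sum>\<pi>\<in>perms n. (\<Sum>p\<in>P. w p * of_bool (\<pi> (fst p) = snd p))\<^sup>2) = (\<Sum>\<pi>\<in>perms n. \<Sum>p\<in>P. \<Sum>r\<in>P. w p * w r * (of_bool (\<pi> (fst p) = snd p) * of_bool (\<pi> (fst r) = snd r)))"
    unfolding power2_eq_square sum_product by (intro sum.cong) auto
  also have "\<dots> = (\<Sum>p\<in>P. \<Sum>r\<in>P. w p * w r * ?c p r)"
    by (subst sum.swap, intro sum.cong refl, subst sum.swap) (simp only: sum_distrib_left)
  also have "\<dots> \<le> (\<Sum>p\<in>P. \<Sum>r\<in>P. w p * w r * (fact (n - 1) * of_bool (p = r) + fact (n - 2)))"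
    by (intro sum_mono mult_left_mono c mult_nonneg_nonneg w)
  also have "\<dots> = (\<Sum>p\<in>P. \<Sum>r\<in>P. (if p = r then fact (n - 1) * (w p)\<^sup>2 else 0) + fact (n - 2) * (w p * w r))"
    by (intro sum.cong) (auto simp: algebra_simps power2_eq_square)
  also have "\<dots> = fact (n - 1) * (\<Sum>p\<in>P. (w p)\<^sup>2) + fact (n - 2) * (\<Sum>p\<in>P. w p)\<^sup>2"
    using fin unfolding power2_eq_square[of "sum w P"] sum_product
    by (simp add: sum.distrib sum.delta sum_distrib_left)
  finally show ?thesis .
qed

text \<open>Bonferroni's inequality. With t = k/n the mean is exactly t and the second binomial
  moment is at most t^2/2, hence at most t/2.\<close>

lemma prob_hits_pos_ge:
  assumes K: "K \<subseteq> {1..n} \<times> {1..n}" "card K \<le> n" and n: "1 \<le> n"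
  shows "real (card K) / n / 2 \<le> real (card {\<pi>\<in>perms n. 0 < hits K \<pi>}) / fact n"
proof -
  have fin: "finite K" using K(1) by (rule finite_subset) auto
  let ?k = "real (card K) / n"
  have k: "0 \<le> ?k" "?k \<le> 1" using K(2) n by auto
  have fn: "fact n = real n * fact (n - 1)" using n by (simp add: fact_reduce)
  have "hits K \<pi> = (\<Sum>p\<in>K. 1 * of_bool (\<pi> (fst p) = snd p))" for \<pi>
    unfolding hits_def using fin by (simp add: sum_of_bool_eq Int_def)
  then have "(\<Sum>\<pi>\<in>perms n. real (hits K \<pi>)) = fact (n - 1) * card K"
    using sum_incidence[OF K(1), of "\<lambda>_. 1"] by simp
  then have 1: "(\<Sum>\<pi>\<in>perms n. real (hits K \<pi>)) / fact n = ?k"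
    unfolding fn using n by simp
  have 2: "(\<Sum>\<pi>\<in>perms n. real (hits K \<pi> choose 2)) / fact n \<le> ?k / 2"
  proof -
    have "(\<Sum>\<pi>\<in>perms n. real (hits K \<pi> choose 2)) / fact n \<le> falling_ratio n (card K) 2 / fact 2"
      by (rule mean_hits_choose_le[OF K(1)])
    also have "\<dots> \<le> ?k ^ 2 / fact 2"
      by (intro divide_right_mono falling_ratio_le K) simp
    also have "\<dots> \<le> ?k ^ 1 / fact 2"
      using k by (intro divide_right_mono power_decreasing) auto
    also have "\<dots> = ?k / 2" by simp
    finally show ?thesis .
  qed
  have b: "real h - real (h choose 2) \<le> of_bool (0 < h)" for h :: nat
  proof (cases h)
    case (Suc m)
    have "real (h choose 2) = real h * (real h - 1) / 2"
      using Suc by (simp add: choose_two real_of_nat_div) (simp add: algebra_simps)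
    moreover have "0 \<le> real m * (real m - 1)" by (cases m) auto
    ultimately show ?thesis using Suc by (simp add: divide_simps) (simp add: algebra_simps)
  qed simp
  have "?k / 2 \<le> (\<Sum>\<pi>\<in>perms n. real (hits K \<pi>)) / fact n - (\<Sum>\<pi>\<in>perms n. real (hits K \<pi> choose 2)) / fact n"
    using 1 2 by simp
  also have "\<dots> = (\<Sum>\<pi>\<in>perms n. real (hits K \<pi>) - real (hits K \<pi> choose 2)) / fact n"
    by (simp add: sum_subtractf diff_divide_distrib)
  also have "\<dots> \<le> (\<Sum>\<pi>\<in>perms n. of_bool (0 < hits K \<pi>)) / fact n"
    by (intro divide_right_mono sum_mono b) simp
  also have "(\<Sum>\<pi>\<in>perms n. of_bool (0 < hits K \<pi>)) = real (card {\<pi>\<in>perms n. 0 < hits K \<pi>})"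
    using finite_perms[of n] by (simp add: sum_of_bool_eq Int_def)
  finally show ?thesis by simp
qed

section \<open>Poisson limit for diagonal positions\<close>

lemma prob_fixed_eq:
  assumes k: "k \<le> n"
  shows "real (card {\<pi>\<in>perms n. hits ((\<lambda>i. (i, i)) ` {1..k}) \<pi> = j}) / fact n =
    (\<Sum>i\<le>n. (-1) ^ i / fact i * falling_ratio n k (j + i)) / fact j"
proof -
  let ?h = "hits ((\<lambda>i. (i, i)) ` {1..k})"
  have hn: "?h \<pi> \<le> n" for \<pi>
    using hits_le_card[of "(\<lambda>i. (i, i)) ` {1..k}" \<pi>] card_image_le[of "{1..k}" "\<lambda>i. (i, i)"] k by simp
  \<comment> \<open>Pointwise inclusion-exclusion: regrouping the product of binomials leaves
    \<open>h choose j\<close> times an alternating row sum of order h - j, which is zero for h > j.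
    The range i \<le> n is long enough because h \<le> n.\<close>
  have pt: "of_bool (h = j) = (\<Sum>i\<le>n. (-1) ^ i * real ((j + i) choose j) * real (h choose (j + i)))"
    if "h \<le> n" for h
  proof -
    have "real ((j + i) choose j) * real (h choose (j + i)) = real (h choose j) * real ((h - j) choose i)" for i
    proof (cases "j + i \<le> h")
      case True
      then show ?thesis using choose_mult[of j "j + i" h]
        by (simp add: of_nat_mult[symmetric] mult.commute del: of_nat_mult)
    next
      case False
      then have "h choose (j + i) = 0" "h < j \<or> h - j < i" by auto
      then show ?thesis by (auto simp: binomial_eq_0)
    qed
    then have "(\<Sum>i\<le>n. (-1) ^ i * real ((j + i) choose j) * real (h choose (j + i)))
       = real (h choose j) * (\<Sum>i\<le>n. (-1) ^ i * real ((h - j) choose i))"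
      by (simp add: sum_distrib_left mult_ac)
    also have "(\<Sum>i\<le>n. (-1) ^ i * real ((h - j) choose i)) = (\<Sum>i\<le>h - j. (-1) ^ i * real ((h - j) choose i))"
      using that by (intro sum.mono_neutral_right) auto
    also have "real (h choose j) * \<dots> = of_bool (h = j)"
    proof (cases h j rule: linorder_cases)
      case greater
      then show ?thesis using choose_alternating_sum[of "h - j", where 'a = real] by simp
    qed auto
    finally show ?thesis by simp
  qed
  have "real (card {\<pi>\<in>perms n. ?h \<pi> = j}) = (\<Sum>\<pi>\<in>perms n. of_bool (?h \<pi> = j))"
    using finite_perms[of n] by (simp add: sum_of_bool_eq Int_def)
  also have "\<dots> = (\<Sum>\<pi>\<in>perms n. \<Sum>i\<le>n. (-1) ^ i * real ((j + i) choose j) * real (?h \<pi> choose (j + i)))"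
    by (intro sum.cong refl pt hn)
  also have "\<dots> = (\<Sum>i\<le>n. (-1) ^ i * real ((j + i) choose j) * real (\<Sum>\<pi>\<in>perms n. ?h \<pi> choose (j + i)))"
    by (subst sum.swap) (simp add: sum_distrib_left)
  also have "\<dots> = (\<Sum>i\<le>n. (-1) ^ i * real ((j + i) choose j) * real ((k choose (j + i)) * fact (n - (j + i))))"
    by (simp only: sum_fixed_choose[OF k])
  finally have "real (card {\<pi>\<in>perms n. ?h \<pi> = j}) / fact n
    = (\<Sum>i\<le>n. (-1) ^ i * real ((j + i) choose j) * (real ((k choose (j + i)) * fact (n - (j + i))) / fact n))"
    by (simp add: sum_divide_distrib)
  also have "\<dots> = (\<Sum>i\<le>n. (-1) ^ i * (1 / (fact j * fact i)) * falling_ratio n k (j + i))"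
    unfolding choose_fact_eq by (simp add: binomial_fact)
  also have "\<dots> = (\<Sum>i\<le>n. (-1) ^ i / fact i * falling_ratio n k (j + i)) / fact j"
    by (simp add: sum_divide_distrib mult.commute)
  finally show ?thesis .
qed

lemma falling_ratio_tendsto:
  assumes "(\<lambda>n. real (k n) / real n) \<longlonglongrightarrow> t"
  shows "(\<lambda>n. falling_ratio n (k n) j) \<longlonglongrightarrow> t ^ j"
proof (induction j)
  case (Suc j)
  have j: "(\<lambda>n. real j / real n) \<longlonglongrightarrow> 0" by (rule lim_const_over_n)
  have "(\<lambda>n. (real (k n) / n - real j / n) / (1 - real j / n)) \<longlonglongrightarrow> (t - 0) / (1 - 0)"
    by (intro tendsto_intros assms j) simp
  then have "(\<lambda>n. falling_ratio n (k n) j * ((real (k n) / n - real j / n) / (1 - real j / n))) \<longlonglongrightarrow> t ^ j * t"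
    by (intro tendsto_mult Suc) simp
  moreover have "\<forall>\<^sub>F n in sequentially. falling_ratio n (k n) j * ((real (k n) / n - real j / n) / (1 - real j / n)) = falling_ratio n (k n) (Suc j)"
    using eventually_gt_at_top[of j]
  proof eventually_elim
    case (elim n)
    then have "(real (k n) / n - real j / n) / (1 - real j / n) = (real (k n) - real j) / (real n - real j)"
      by (simp add: divide_simps)
    then show ?case using elim by (simp add: falling_ratio_Suc)
  qed
  ultimately show ?case by (simp add: Lim_transform_eventually mult.commute)
qed (simp add: falling_ratio_0)

text \<open>The falling ratios tend to powers of t and are at most 1, so Tannery's theorem with the
  majorant 1/i! allows the limit under the inclusion-exclusion sum.\<close>

lemma prob_fixed_tendsto:
  assumes k: "\<And>n. k n \<le> n" "(\<lambda>n. real (k n) / real n) \<longlonglongrightarrow> t"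
  shows "(\<lambda>n. real (card {\<pi>\<in>perms n. hits ((\<lambda>i. (i, i)) ` {1..k n}) \<pi> = j}) / fact n)
    \<longlonglongrightarrow> t ^ j / fact j * exp (- t)"
proof -
  let ?a = "\<lambda>i n. (-1) ^ i / fact i * falling_ratio n (k n) (j + i)"
  have "(\<lambda>n. \<Sum>i. ?a i n) \<longlonglongrightarrow> (\<Sum>i. (-1) ^ i / fact i * t ^ (j + i))"
  proof (rule tannerys_theorem[THEN conjunct2, THEN conjunct2])
    show "(\<lambda>n. ?a i n) \<longlonglongrightarrow> (-1) ^ i / fact i * t ^ (j + i)" for i
      by (intro tendsto_mult tendsto_const falling_ratio_tendsto k)
    show "\<forall>\<^sub>F (i, n) in at_top \<times>\<^sub>F sequentially. norm (?a i n) \<le> inverse (fact i)"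
      by (rule always_eventually)
        (auto simp: abs_mult divide_inverse falling_ratio_nonneg intro!: mult_left_le falling_ratio_le_1 k)
    show "summable (\<lambda>i. inverse (fact i) :: real)"
      using summable_exp[of 1] by simp
  qed simp
  moreover have "(\<Sum>i. (-1) ^ i / fact i * t ^ (j + i)) = t ^ j * exp (- t)"
  proof -
    have "(\<lambda>i. t ^ j * ((- t) ^ i /\<^sub>R fact i)) sums (t ^ j * exp (- t))"
      by (intro sums_mult exp_converges)
    moreover have "t ^ j * ((- t) ^ i /\<^sub>R fact i) = (-1) ^ i / fact i * t ^ (j + i)" for i
      by (simp add: power_add power_minus[of t] divide_inverse)
    ultimately show ?thesis by (simp add: sums_iff)
  qed
  \<comment> \<open>For i > n the ratio has j + i > k n and is zero, so the finite sum is the whole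
    series.\<close>
  moreover have "(\<Sum>i. ?a i n) = (\<Sum>i\<le>n. ?a i n)" for n
    using k(1)[of n] by (intro suminf_finite) (auto simp: falling_ratio_eq_0)
  ultimately have "(\<lambda>n. (\<Sum>i\<le>n. ?a i n) / fact j) \<longlonglongrightarrow> t ^ j * exp (- t) / fact j"
    by (intro tendsto_divide tendsto_const) auto
  then show ?thesis unfolding prob_fixed_eq[OF k(1)] by simp
qed

section \<open>Concave powers, level sets and the series of \<Gamma>\<close>

lemma powr_add_le_add_powr:
  fixes u v p :: real
  assumes p: "0 < p" "p \<le> 1" and "0 \<le> u" "0 \<le> v"
  shows "(u + v) powr p \<le> u powr p + v powr p"
proof (cases "u + v = 0")
  case False
  then have s: "0 < u + v" using assms by simp
  have le: "y \<le> y powr p" if "0 \<le> y" "y \<le> 1" for y :: real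
    using powr_mono'[of p 1 y] that p by (cases "y = 0") auto
  have "1 = u / (u + v) + v / (u + v)" using s by (simp add: add_divide_distrib[symmetric])
  also have "\<dots> \<le> (u / (u + v)) powr p + (v / (u + v)) powr p"
    using s assms by (intro add_mono le) auto
  finally have "(u + v) powr p * 1 \<le> (u + v) powr p * ((u / (u + v)) powr p + (v / (u + v)) powr p)"
    by (intro mult_left_mono) auto
  also have "\<dots> = u powr p + v powr p"
    using s assms by (simp add: distrib_left powr_mult[symmetric])
  finally show ?thesis by simp
qed (use assms in auto)

text \<open>Concavity of the power function. Its derivative may be singular at 0, so u = 0 is left
  to subadditivity.\<close>

lemma powr_increment_antimono:
  fixes u v c p :: real
  assumes p: "0 < p" "p \<le> 1" and "0 \<le> u" "u \<le> v" "0 \<le> c"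
  shows "(v + c) powr p - v powr p \<le> (u + c) powr p - u powr p"
proof (cases "u = 0")
  case True
  then show ?thesis using powr_add_le_add_powr[OF p, of v c] assms by simp
next
  case False
  with assms have u: "0 < u" by simp
  show ?thesis
  proof (rule DERIV_nonpos_imp_nonincreasing[OF \<open>u \<le> v\<close>])
    fix y assume y: "u \<le> y" "y \<le> v"
    have "((\<lambda>y. (y + c) powr p - y powr p) has_real_derivative
        p * (y + c) powr (p - 1) - p * y powr (p - 1)) (at y)"
      using y u \<open>0 \<le> c\<close> by (auto intro!: derivative_eq_intros)
    moreover have "(y + c) powr (p - 1) \<le> y powr (p - 1)"
      using y u p \<open>0 \<le> c\<close> by (intro powr_mono2') auto
    then have "p * (y + c) powr (p - 1) - p * y powr (p - 1) \<le> 0"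
      using p by (simp add: mult_left_mono)
    ultimately show "\<exists>d. ((\<lambda>y. (y + c) powr p - y powr p) has_real_derivative d) (at y) \<and> d \<le> 0"
      by blast
  qed
qed

text \<open>Divided by \<open>real (Suc j) powr p\<close> and with y = j/(j + 1), the claims are 1 -
  y^p \<le> 1 - y and p (1 - y) \<le> 1 - y^p. The second is the weighted inequality of arithmetic
  and geometric means for y and 1.\<close>

lemma powr_Suc_diff_bounds:
  fixes p :: real
  assumes p: "0 < p" "p \<le> 1"
  shows "real (Suc j) powr p - real j powr p \<le> real (Suc j) powr (p - 1)"
    and "p * real (Suc j) powr (p - 1) \<le> real (Suc j) powr p - real j powr p"
proof -
  let ?y = "real j / real (Suc j)"
  have y: "0 \<le> ?y" "?y \<le> 1" by auto
  have eq: "real j powr p = real (Suc j) powr p * ?y powr p"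
    by (subst powr_mult[symmetric]) (auto simp del: of_nat_Suc)
  have pow: "real (Suc j) powr p = real (Suc j) powr (p - 1) * real (Suc j)"
    by (simp add: powr_diff del: of_nat_Suc)
  have y1: "1 - ?y = 1 / real (Suc j)" by (simp add: field_simps)
  have "?y \<le> ?y powr p"
    using powr_mono'[of p 1 ?y] y p by (cases "?y = 0") (auto simp del: of_nat_Suc)
  then have "real (Suc j) powr p * (1 - ?y powr p) \<le> real (Suc j) powr p * (1 - ?y)"
    by (intro mult_left_mono) auto
  also have "\<dots> = real (Suc j) powr (p - 1)"
    unfolding y1 by (subst pow) simp
  finally show "real (Suc j) powr p - real j powr p \<le> real (Suc j) powr (p - 1)"
    unfolding eq by (simp add: right_diff_distrib)
  have "?y powr p \<le> 1 - p * (1 - ?y)"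
  proof (cases "j = 0")
    case False
    with Youngs_inequality_0[of p "1 - p" ?y 1] p show ?thesis by (simp add: algebra_simps)
  qed (use p in auto)
  then have "real (Suc j) powr p * (p * (1 - ?y)) \<le> real (Suc j) powr p * (1 - ?y powr p)"
    by (intro mult_left_mono) auto
  moreover have "real (Suc j) powr p * (p * (1 - ?y)) = p * real (Suc j) powr (p - 1)"
    unfolding y1 by (subst pow) simp
  ultimately show "p * real (Suc j) powr (p - 1) \<le> real (Suc j) powr p - real j powr p"
    unfolding eq by (simp add: right_diff_distrib)
qed

lemma abel_summation:
  fixes b G :: "nat \<Rightarrow> real"
  shows "(\<Sum>k<n. b k * (G (Suc k) - G k)) = (\<Sum>j<n. (b j - b (Suc j)) * G (Suc j)) + b n * G n - b 0 * G 0"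
  by (induction n) (auto simp: algebra_simps)

lemma dnorm_cong:
  assumes "\<phi> \<in> Phi" "finite A" "\<And>w. w \<in> A \<Longrightarrow> X w = Y w"
  shows "dnorm \<phi> A X = dnorm \<phi> A Y"
  using assms by (intro antisym dnorm_mono) auto

text \<open>The power telescopes over the level sets {H \<ge> j + 1}, which form a chain, so
  \<open>dnorm_chain\<close> gives an equality.\<close>

lemma dnorm_powr_nat:
  fixes H :: "'a \<Rightarrow> nat"
  assumes phi: "\<phi> \<in> Phi" and fin: "finite A" and "0 < p" and J: "\<And>w. w \<in> A \<Longrightarrow> H w \<le> J"
  shows "dnorm \<phi> A (\<lambda>w. real (H w) powr p) =
    (\<Sum>j<J. (real (Suc j) powr p - real j powr p) * \<phi> (card {w\<in>A. Suc j \<le> H w} / card A))"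
proof -
  have eq: "real (H w) powr p = (\<Sum>j<J. (real (Suc j) powr p - real j powr p) * indicator {w\<in>A. Suc j \<le> H w} w)"
    if "w \<in> A" for w
  proof -
    have "real (H w) powr p = (\<Sum>j<H w. real (Suc j) powr p - real j powr p)"
      by (subst sum_lessThan_telescope) simp
    also have "\<dots> = (\<Sum>j<J. (real (Suc j) powr p - real j powr p) * indicator {w\<in>A. Suc j \<le> H w} w)"
      using J[OF that] that by (intro sum.mono_neutral_cong_left) (auto simp: Suc_le_eq)
    finally show ?thesis .
  qed
  have "dnorm \<phi> A (\<lambda>w. real (H w) powr p) =
      dnorm \<phi> A (\<lambda>w. \<Sum>j<J. (real (Suc j) powr p - real j powr p) * indicator {w\<in>A. Suc j \<le> H w} w)"
    by (rule dnorm_cong[OF phi fin eq])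
  also have "\<dots> = (\<Sum>j<J. (real (Suc j) powr p - real j powr p) * \<phi> (card {w\<in>A. Suc j \<le> H w} / card A))"
  proof (rule dnorm_chain[OF phi fin])
    show "{w\<in>A. Suc i \<le> H w} \<subseteq> {w\<in>A. Suc j \<le> H w} \<or> {w\<in>A. Suc j \<le> H w} \<subseteq> {w\<in>A. Suc i \<le> H w}" for i j
      using le_cases[of i j] by fastforce
  qed (use \<open>0 < p\<close> in \<open>auto intro: powr_mono2\<close>)
  finally show ?thesis .
qed

text \<open>The finite form of \<open>\<Gamma>\<^sub>\<phi>\<^sub>,\<^sub>q \<le> g\<close>, with \<open>p = 1 / q\<close>.\<close>

definition Gamma_bound :: "(real \<Rightarrow> real) \<Rightarrow> real \<Rightarrow> real \<Rightarrow> bool" where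
  "Gamma_bound \<phi> p g \<longleftrightarrow> (\<forall>t J. 0 < t \<longrightarrow> t \<le> 1 \<longrightarrow>
     (\<Sum>j<J. real (Suc j) powr (p - 1) * \<phi> (t ^ Suc j / fact (Suc j))) \<le> g * \<phi> t)"

lemma Gamma_bound_ge_1:
  assumes "\<phi> \<in> Phi" "Gamma_bound \<phi> p g" shows "1 \<le> g"
proof -
  have "(\<Sum>j<Suc 0. real (Suc j) powr (p - 1) * \<phi> (1 ^ Suc j / fact (Suc j))) \<le> g * \<phi> 1"
    using assms(2) unfolding Gamma_bound_def by (metis order_refl zero_less_one)
  then show ?thesis using Phi_1[OF assms(1)] by simp
qed

lemma prob_in_unit: "finite A \<Longrightarrow> B \<subseteq> A \<Longrightarrow> 0 \<le> real (card B) / card A \<and> real (card B) / card A \<le> 1"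
  by (auto simp: divide_le_eq_1 card_mono)

text \<open>This is the source of \<Gamma>: the factorial tails and the upper increment bound turn
  the level-set formula into its series at t = card K / n.\<close>

lemma dnorm_hits_le:
  assumes phi: "\<phi> \<in> Phi" and p: "0 < p" "p \<le> 1" and g: "Gamma_bound \<phi> p g"
    and K: "K \<subseteq> {1..n} \<times> {1..n}" "card K \<le> n" "K \<noteq> {}"
  shows "dnorm \<phi> (perms n) (\<lambda>\<pi>. real (hits K \<pi>) powr p) \<le> g * \<phi> (real (card K) / n)"
proof -
  let ?t = "real (card K) / n"
  have fin: "finite K" using K(1) by (rule finite_subset) auto
  then have "0 < card K" using K(3) by (simp add: card_gt_0_iff)
  then have t: "0 < ?t" "?t \<le> 1" using K(2) by (auto simp: divide_le_eq_1)
  have pw: "?t ^ j / fact j \<le> 1" for j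
  proof -
    have "?t ^ j / fact j \<le> 1 / 1"
      using power_le_one[OF less_imp_le[OF t(1)] t(2), of j] fact_ge_1[of j, where 'a = real]
      by (intro frac_le) auto
    then show ?thesis by simp
  qed
  have "dnorm \<phi> (perms n) (\<lambda>\<pi>. real (hits K \<pi>) powr p) = (\<Sum>j<card K. (real (Suc j) powr p - real j powr p) *
      \<phi> (card {\<pi>\<in>perms n. Suc j \<le> hits K \<pi>} / fact n))"
    using dnorm_powr_nat[OF phi finite_perms p(1) hits_le_card[OF fin], of n] by (simp only: card_perms of_nat_fact)
  also have "\<dots> \<le> (\<Sum>j<card K. real (Suc j) powr (p - 1) * \<phi> (?t ^ Suc j / fact (Suc j)))"
  proof (intro sum_mono mult_mono powr_Suc_diff_bounds p)
    fix j
    have u: "0 \<le> real (card {\<pi>\<in>perms n. Suc j \<le> hits K \<pi>}) / fact n" by simp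
    show le: "\<phi> (card {\<pi>\<in>perms n. Suc j \<le> hits K \<pi>} / fact n) \<le> \<phi> (?t ^ Suc j / fact (Suc j))"
      by (rule Phi_mono[OF phi u prob_hits_ge[OF K(1,2)] pw])
    show "0 \<le> \<phi> (card {\<pi>\<in>perms n. Suc j \<le> hits K \<pi>} / fact n)"
      by (rule Phi_nonneg[OF phi u order_trans[OF prob_hits_ge[OF K(1,2)] pw]])
  qed auto
  also have "\<dots> \<le> g * \<phi> ?t" using g t unfolding Gamma_bound_def by blast
  finally show ?thesis .
qed

text \<open>Markov's inequality for (1 + z)^G at level 3 i with z = 3 i has the quotient exp(3 i)/(1
  + 3 i)^(3 i); the point is that it is at most 1/i!. By i! \<le> i^i and e \<le> 3 it reduces to 27
  i \<le> (1 + 3 i)^3.\<close>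

lemma fact_exp_le: "1 \<le> i \<Longrightarrow> fact i * exp (3 * real i) \<le> (1 + 3 * real i) ^ (3 * i)"
proof -
  assume i: "1 \<le> i"
  have "exp (3 * real i) = (exp 1 ^ 3) ^ i"
    by (simp add: exp_of_nat_mult[symmetric] power_mult[symmetric] mult.commute)
  also have "\<dots> \<le> (3 ^ 3) ^ i"
    using exp_le by (intro power_mono) auto
  finally have "fact i * exp (3 * real i) \<le> real i ^ i * 27 ^ i"
    using fact_le_power[of i, where 'a = real] by (intro mult_mono) auto
  also have "\<dots> = (27 * real i) ^ i" by (simp add: power_mult_distrib)
  also have "\<dots> \<le> ((1 + 3 * real i) ^ 3) ^ i"
  proof (intro power_mono)
    have "real i \<le> real i ^ 3" using i self_le_power[of "real i" 3] by simp
    moreover have "(1 + 3 * real i) ^ 3 = 1 + 9 * real i + 27 * real i ^ 2 + 27 * real i ^ 3"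
      by (simp add: power3_eq_cube power2_eq_square algebra_simps)
    moreover have "0 \<le> real i ^ 2" by simp
    ultimately show "27 * real i \<le> (1 + 3 * real i) ^ 3" by linarith
  qed simp
  finally show ?thesis by (simp add: power_mult[symmetric] mult.commute)
qed

text \<open>By Jensen's inequality a convex combination of the \<open>F r\<close> inherits their exponential moments, so
  its distribution is dominated, after scaling by \<open>3\<close>, by the tails \<open>1 / i!\<close>.\<close>

lemma dnorm_mixture_le:
  fixes F :: "'r \<Rightarrow> 'a \<Rightarrow> nat" and v :: "'r \<Rightarrow> real"
  assumes phi: "\<phi> \<in> Phi" and p: "0 < p" "p \<le> 1" and g: "Gamma_bound \<phi> p g"
    and A: "finite A" "A \<noteq> {}" and R: "finite R" and v: "\<And>r. r \<in> R \<Longrightarrow> 0 \<le> v r"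
    and exp_moment: "\<And>r z. r \<in> R \<Longrightarrow> 0 \<le> z \<Longrightarrow> (\<Sum>w\<in>A. (1 + z) ^ F r w) / card A \<le> exp z"
  shows "dnorm \<phi> A (\<lambda>w. (\<Sum>r\<in>R. v r * F r w) powr p) \<le> (3 * sum v R) powr p * (1 + g)"
proof (cases "sum v R = 0")
  case True
  then have "v r = 0" if "r \<in> R" for r using sum_nonneg_eq_0_iff[OF R v] that by auto
  then show ?thesis using True by (simp add: dnorm_zero)
next
  case False
  define V where "V = sum v R"
  have V: "0 < V" using False v by (simp add: V_def less_le sum_nonneg)
  define G where "G w = (\<Sum>r\<in>R. v r / V * F r w)" for w
  \<comment> \<open>Rounding up makes the level-set formula applicable; the scale 3 is the one for
    which \<open>fact_exp_le\<close> yields factorial tails.\<close>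
  define H where "H w = nat \<lceil>G w / 3\<rceil>" for w
  have G: "0 \<le> G w" for w unfolding G_def using v V by (intro sum_nonneg) auto
  have "R \<noteq> {}" using False by auto
  have N: "0 < real (card A)" using A by (simp add: card_gt_0_iff)
  have jensen: "(1 + z) powr G w \<le> (\<Sum>r\<in>R. v r / V * (1 + z) ^ F r w)" if "0 < z" for z w
  proof -
    have "exp (\<Sum>r\<in>R. (v r / V) *\<^sub>R (F r w * ln (1 + z))) \<le> (\<Sum>r\<in>R. v r / V * exp (F r w * ln (1 + z)))"
      using v V by (intro convex_on_sum[OF R \<open>R \<noteq> {}\<close> exp_convex])
        (auto simp: sum_divide_distrib[symmetric] V_def[symmetric])
    moreover have "(\<Sum>r\<in>R. (v r / V) *\<^sub>R (F r w * ln (1 + z))) = G w * ln (1 + z)"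
      by (simp add: G_def sum_distrib_right mult.assoc)
    moreover have "exp (F r w * ln (1 + z)) = (1 + z) ^ F r w" for r
      using that by (simp add: powr_realpow[symmetric] powr_def)
    ultimately show ?thesis using that by (simp add: powr_def)
  qed
  \<comment> \<open>If the ceiling reaches i + 1 then G exceeds 3 i, and Markov's inequality is
    applied to \<open>(1 + ?z) powr G w\<close>.\<close>
  have tail: "real (card {w\<in>A. Suc i \<le> H w}) / card A \<le> 1 / fact i" if i: "1 \<le> i" for i
  proof -
    let ?z = "3 * real i"
    let ?B = "{w\<in>A. Suc i \<le> H w}"
    have GB: "3 * real i \<le> G w" if "w \<in> ?B" for w
    proof -
      have "Suc i \<le> H w" using that by simp
      then have "int i < \<lceil>G w / 3\<rceil>" unfolding H_def by linarith
      then have "real i < G w / 3" by (simp add: less_ceiling_iff)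
      then show ?thesis by simp
    qed
    have "real (card ?B) * (1 + ?z) ^ (3 * i) = (\<Sum>w\<in>?B. (1 + ?z) ^ (3 * i))" by simp
    also have "\<dots> \<le> (\<Sum>w\<in>?B. (1 + ?z) powr G w)"
    proof (rule sum_mono)
      fix w assume "w \<in> ?B"
      have "(1 + ?z) ^ (3 * i) = (1 + ?z) powr (3 * real i)"
        by (subst powr_realpow[symmetric]) auto
      also have "\<dots> \<le> (1 + ?z) powr G w" using GB[OF \<open>w \<in> ?B\<close>] by (intro powr_mono) auto
      finally show "(1 + ?z) ^ (3 * i) \<le> (1 + ?z) powr G w" .
    qed
    also have "\<dots> \<le> (\<Sum>w\<in>A. (1 + ?z) powr G w)" using A by (intro sum_mono2) auto
    also have "\<dots> \<le> (\<Sum>w\<in>A. \<Sum>r\<in>R. v r / V * (1 + ?z) ^ F r w)"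
      using i by (intro sum_mono jensen) auto
    also have "\<dots> = (\<Sum>r\<in>R. v r / V * (\<Sum>w\<in>A. (1 + ?z) ^ F r w))"
      by (subst sum.swap) (simp add: sum_distrib_left)
    also have "\<dots> \<le> (\<Sum>r\<in>R. v r / V * (exp ?z * card A))"
    proof (intro sum_mono mult_left_mono)
      fix r assume "r \<in> R"
      from exp_moment[OF this, of ?z] show "(\<Sum>w\<in>A. (1 + ?z) ^ F r w) \<le> exp ?z * card A"
        using N by (simp add: divide_le_eq)
    qed (use v V in auto)
    also have "\<dots> = exp ?z * card A"
      using V by (simp add: sum_distrib_right[symmetric] sum_divide_distrib[symmetric] V_def[symmetric])
    finally have *: "real (card ?B) * (1 + ?z) ^ (3 * i) \<le> exp ?z * card A" .
    have "real (card ?B) * (fact i * exp ?z) \<le> real (card ?B) * (1 + ?z) ^ (3 * i)"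
      by (intro mult_left_mono fact_exp_le i) simp
    also note *
    finally have "(real (card ?B) * fact i) * exp ?z \<le> card A * exp ?z" by (simp only: mult_ac)
    then have "real (card ?B) * fact i \<le> card A" by (rule mult_right_le_imp_le) simp
    then show ?thesis using N by (simp add: divide_simps)
  qed
  let ?J = "\<Sum>w\<in>A. H w"
  have "dnorm \<phi> A (\<lambda>w. real (H w) powr p) =
    (\<Sum>j<Suc ?J. (real (Suc j) powr p - real j powr p) * \<phi> (card {w\<in>A. Suc j \<le> H w} / card A))"
    using A by (intro dnorm_powr_nat phi p) (auto intro: le_SucI member_le_sum)
  also have "\<dots> \<le> (\<Sum>j<Suc ?J. real (Suc j) powr (p - 1) * \<phi> (card {w\<in>A. Suc j \<le> H w} / card A))"
  proof (intro sum_mono mult_right_mono powr_Suc_diff_bounds p)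
    fix j show "0 \<le> \<phi> (card {w\<in>A. Suc j \<le> H w} / card A)"
      using prob_in_unit[OF A(1), of "{w\<in>A. Suc j \<le> H w}"] by (intro Phi_nonneg[OF phi]) auto
  qed
  \<comment> \<open>The tail bound 1/i! belongs to level i + 1. The first level is therefore split
    off and bounded by 1; the shifted rest is dominated by the series of \<Gamma> at t = 1.\<close>
  also have "\<dots> = \<phi> (card {w\<in>A. Suc 0 \<le> H w} / card A) +
      (\<Sum>j<?J. real (Suc (Suc j)) powr (p - 1) * \<phi> (card {w\<in>A. Suc (Suc j) \<le> H w} / card A))"
    by (subst sum.lessThan_Suc_shift) simp
  also have "\<dots> \<le> 1 + (\<Sum>j<?J. real (Suc j) powr (p - 1) * \<phi> (1 ^ Suc j / fact (Suc j)))"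
  proof (intro add_mono sum_mono mult_mono)
    show "\<phi> (card {w\<in>A. Suc 0 \<le> H w} / card A) \<le> 1"
      using prob_in_unit[OF A(1), of "{w\<in>A. Suc 0 \<le> H w}"] by (intro Phi_le_1[OF phi]) auto
    fix j
    show "real (Suc (Suc j)) powr (p - 1) \<le> real (Suc j) powr (p - 1)"
      using p by (intro powr_mono2') auto
    have u: "0 \<le> real (card {w\<in>A. Suc (Suc j) \<le> H w}) / card A" by simp
    have le1: "1 ^ Suc j / fact (Suc j) \<le> (1::real)"
      using fact_ge_1[of "Suc j", where 'a = real] by (simp add: divide_le_eq del: fact_Suc)
    have t: "real (card {w\<in>A. Suc (Suc j) \<le> H w}) / card A \<le> 1 ^ Suc j / fact (Suc j)"
      using tail[of "Suc j"] by simp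
    show "\<phi> (card {w\<in>A. Suc (Suc j) \<le> H w} / card A) \<le> \<phi> (1 ^ Suc j / fact (Suc j))"
      by (rule Phi_mono[OF phi u t le1])
    show "0 \<le> \<phi> (card {w\<in>A. Suc (Suc j) \<le> H w} / card A)"
      by (rule Phi_nonneg[OF phi u order_trans[OF t le1]])
  qed auto
  also have "\<dots> \<le> 1 + g"
    using g[unfolded Gamma_bound_def, rule_format, of 1 ?J] by (simp add: Phi_1[OF phi] del: fact_Suc power_one)
  finally have H: "dnorm \<phi> A (\<lambda>w. real (H w) powr p) \<le> 1 + g" .
  have "dnorm \<phi> A (\<lambda>w. (\<Sum>r\<in>R. v r * F r w) powr p) \<le> dnorm \<phi> A (\<lambda>w. (3 * V) powr p * real (H w) powr p)"
  proof (rule dnorm_mono[OF phi A(1)])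
    fix w
    have "(\<Sum>r\<in>R. v r * F r w) = V * G w" using V by (simp add: G_def sum_distrib_left)
    also have "\<dots> \<le> V * (3 * real (H w))"
    proof (intro mult_left_mono)
      have "G w / 3 \<le> real (H w)" unfolding H_def by linarith
      then show "G w \<le> 3 * real (H w)" by simp
    qed (use V in simp)
    finally have "(\<Sum>r\<in>R. v r * F r w) powr p \<le> (3 * V * real (H w)) powr p"
      using v p by (intro powr_mono2) (auto intro!: sum_nonneg simp: mult_ac)
    then show "(\<Sum>r\<in>R. v r * F r w) powr p \<le> (3 * V) powr p * real (H w) powr p"
      using V by (simp add: powr_mult)
  qed
  also have "\<dots> = (3 * V) powr p * dnorm \<phi> A (\<lambda>w. real (H w) powr p)"
    by (intro dnorm_cmult phi A) simp
  also have "\<dots> \<le> (3 * V) powr p * (1 + g)"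
    using H by (intro mult_left_mono) auto
  finally show ?thesis by (simp add: V_def)
qed

text \<open>On decreasing sequences the \<open>\<ell>\<^sub>q\<close> norm is dominated by the Lorentz norm \<open>\<ell>\<^sub>q\<^sub>,\<^sub>1\<close>.\<close>

lemma lq_le_lq1:
  fixes a :: "nat \<Rightarrow> real" and E :: "nat \<Rightarrow> bool"
  assumes q: "1 \<le> q" and a: "\<And>i j. i \<le> j \<Longrightarrow> j < n \<Longrightarrow> a j \<le> a i" "\<And>i. i < n \<Longrightarrow> 0 \<le> a i"
    and "m \<le> n"
  shows "(\<Sum>k<m. a k powr q * of_bool (E k)) powr (1 / q)
    \<le> (\<Sum>k<m. a k * ((\<Sum>i<Suc k. of_bool (E i)) powr (1 / q) - (\<Sum>i<k. of_bool (E i)) powr (1 / q)))"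
  using \<open>m \<le> n\<close>
proof (induction m)
  case (Suc m)
  let ?p = "1 / q"
  have p: "0 < ?p" "?p \<le> 1" using q by auto
  let ?Y = "\<Sum>k<m. a k powr q * of_bool (E k)" and ?F = "\<Sum>i<m. of_bool (E i) :: real"
  have IH: "?Y powr ?p \<le> (\<Sum>k<m. a k * ((\<Sum>i<Suc k. of_bool (E i)) powr ?p - (\<Sum>i<k. of_bool (E i)) powr ?p))"
    using Suc by simp
  show ?case
  proof (cases "E m")
    case True
    \<comment> \<open>Every earlier term met is at least \<open>a m powr q\<close>. Lowering
      \<open>?Y\<close> to \<open>?F * a m powr q\<close> can only enlarge the increment of the
      concave power, and there the factor \<open>a m\<close> comes out.\<close>
    have "?F * a m powr q \<le> ?Y"
      unfolding sum_distrib_right using Suc.prems a q by (intro sum_mono) (auto intro!: powr_mono2)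
    moreover have "0 \<le> ?F * a m powr q" by (intro mult_nonneg_nonneg sum_nonneg) auto
    ultimately have "(?Y + a m powr q) powr ?p - ?Y powr ?p
        \<le> (?F * a m powr q + a m powr q) powr ?p - (?F * a m powr q) powr ?p"
      using p by (intro powr_increment_antimono) auto
    also have "?F * a m powr q + a m powr q = (?F + 1) * a m powr q" by (simp add: algebra_simps)
    also have "((?F + 1) * a m powr q) powr ?p - (?F * a m powr q) powr ?p = a m * ((?F + 1) powr ?p - ?F powr ?p)"
    proof -
      have "(x * a m powr q) powr ?p = a m * x powr ?p" if "0 \<le> x" for x
        using Suc.prems a(2)[of m] q that by (simp add: powr_mult powr_powr)
      moreover have "0 \<le> ?F" by (rule sum_nonneg) simp
      ultimately show ?thesis by (simp only: right_diff_distrib add_nonneg_nonneg zero_le_one)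
    qed
    finally show ?thesis using IH True by simp
  next
    case False
    then show ?thesis using IH by simp
  qed
qed simp


section \<open>Estimates for one matrix with ranked entries\<close>

text \<open>X stands for the absolute values of the entries. Ranks start at 0: \<open>s k\<close> is
  the position of the entry of rank k + 1, and \<open>s (n - 1)\<close> the last one seen by
  U.\<close>

locale ranked_matrix =
  fixes \<phi> :: "real \<Rightarrow> real" and q :: real and n :: nat and X :: "nat \<times> nat \<Rightarrow> real" and s :: "nat \<Rightarrow> nat \<times> nat"
  assumes phi: "\<phi> \<in> Phi" and q: "1 \<le> q" and n: "1 \<le> n"
    and sorted: "sorted_bij ({1..n} \<times> {1..n}) X s"
    and X_nonneg: "\<And>i. 0 \<le> X i"
begin

definition hit :: "nat \<Rightarrow> (nat \<Rightarrow> nat) \<Rightarrow> bool" where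
  "hit k \<pi> \<longleftrightarrow> \<pi> (fst (s k)) = snd (s k)"

definition T :: "(nat \<Rightarrow> nat) \<Rightarrow> real" where
  "T \<pi> = (\<Sum>i\<in>{1..n} \<times> {1..n}. X i powr q * of_bool (\<pi> (fst i) = snd i)) powr (1 / q)"

definition U_val :: real where
  "U_val = (\<Sum>k<n. weight \<phi> n k * X (s k))"

text \<open>A permutation meets each position with probability 1/n, so this is the mean over all
  permutations of the part of the q-th power sum beyond the n largest entries.\<close>

definition rest_mean :: real where
  "rest_mean = (\<Sum>k\<in>{n..<n * n}. X (s k) powr q) / n"

text \<open>With the value zero from rank n on, summation by parts has no boundary term, and the
  differences are the heights of the level sets of the n largest entries.\<close>

definition b :: "nat \<Rightarrow> real" where
  "b k = (if k < n then X (s k) else 0)"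

lemma p: "0 < 1 / q" "1 / q \<le> 1"
  using q by auto

lemma rest_mean_nonneg: "0 \<le> rest_mean"
  unfolding rest_mean_def by (intro divide_nonneg_nonneg sum_nonneg) auto

lemma n_le_sq: "n \<le> n * n"
  using n by simp

lemma s_bij: "bij_betw s {..<n * n} ({1..n} \<times> {1..n})"
  using sorted by (simp add: sorted_bij_def card_cartesian_product)

lemma X_antimono: "i \<le> j \<Longrightarrow> j < n * n \<Longrightarrow> X (s j) \<le> X (s i)"
  using sorted by (simp add: sorted_bij_def card_cartesian_product)

lemma s_image_sub: "J \<subseteq> {..<n * n} \<Longrightarrow> s ` J \<subseteq> {1..n} \<times> {1..n}"
  using s_bij by (auto simp: bij_betw_def)

lemma card_s_image: "J \<subseteq> {..<n * n} \<Longrightarrow> card (s ` J) = card J"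
  using s_bij by (intro card_image) (auto simp: bij_betw_def intro: inj_on_subset)

lemma hits_s_image_eq: "{i\<in>s ` J. \<pi> (fst i) = snd i} = s ` {k\<in>J. hit k \<pi>}"
  by (auto simp: hit_def)

lemma hits_s_image:
  assumes "J \<subseteq> {..<n * n}" shows "real (hits (s ` J) \<pi>) = (\<Sum>k\<in>J. of_bool (hit k \<pi>))"
proof -
  have fin: "finite J" using assms by (rule finite_subset) simp
  have "hits (s ` J) \<pi> = card {k\<in>J. hit k \<pi>}"
    unfolding hits_def hits_s_image_eq using card_s_image[of "{k\<in>J. hit k \<pi>}"] assms by auto
  then show ?thesis using fin by (simp add: sum_of_bool_eq Int_def)
qed

lemma T_eq: "T \<pi> = (\<Sum>k<n * n. X (s k) powr q * of_bool (hit k \<pi>)) powr (1 / q)"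
  unfolding T_def hit_def using sum.reindex_bij_betw[OF s_bij, of "\<lambda>i. X i powr q * of_bool (\<pi> (fst i) = snd i)"]
  by simp

lemma sum_split_n:
  fixes f :: "nat \<Rightarrow> real"
  shows "(\<Sum>k<n * n. f k) = (\<Sum>k<n. f k) + (\<Sum>k\<in>{n..<n * n}. f k)"
  using sum.atLeastLessThan_concat[of 0 n "n * n" f] n_le_sq by (simp add: atLeast0LessThan)

lemma b_diff_nonneg: "0 \<le> b j - b (Suc j)"
  using X_antimono[of j "Suc j"] X_nonneg order_less_le_trans[OF _ n_le_sq, of "Suc j"] by (simp add: b_def)

lemma b_summation:
  assumes "G 0 = 0"
  shows "(\<Sum>k<n. X (s k) * (G (Suc k) - G k)) = (\<Sum>j<n. (b j - b (Suc j)) * G (Suc j))"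
proof -
  have "(\<Sum>k<n. X (s k) * (G (Suc k) - G k)) = (\<Sum>k<n. b k * (G (Suc k) - G k))"
    by (intro sum.cong) (auto simp: b_def)
  then show ?thesis using abel_summation[of b G n] assms by (simp add: b_def[of n])
qed

lemma U_val_eq: "U_val = (\<Sum>j<n. (b j - b (Suc j)) * \<phi> (real (Suc j) / n))"
  using b_summation[of "\<lambda>j. \<phi> (real j / n)"] Phi_0[OF phi]
  by (simp add: U_val_def weight_def mult.commute)

text \<open>Pointwise, \<open>lq_le_lq1\<close> and summation by parts lead to a nonnegative
  combination of powers of hit counts. \<open>U_val\<close> is the same combination of the values
  \<phi>(j/n), so after the triangle inequality the counts are compared one by one.\<close>

lemma dnorm_head_le:
  assumes g: "Gamma_bound \<phi> (1 / q) g"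
  shows "dnorm \<phi> (perms n) (\<lambda>\<pi>. (\<Sum>k<n. X (s k) powr q * of_bool (hit k \<pi>)) powr (1 / q)) \<le> g * U_val"
proof -
  let ?F = "\<lambda>j \<pi>. real (hits (s ` {..<j}) \<pi>)"
  have sub: "{..<j} \<subseteq> {..<n * n}" if "j \<le> n" for j
    using order_trans[OF that n_le_sq] by simp
  have "dnorm \<phi> (perms n) (\<lambda>\<pi>. (\<Sum>k<n. X (s k) powr q * of_bool (hit k \<pi>)) powr (1 / q))
    \<le> dnorm \<phi> (perms n) (\<lambda>\<pi>. \<Sum>j<n. (b j - b (Suc j)) * ?F (Suc j) \<pi> powr (1 / q))"
  proof (rule dnorm_mono[OF phi finite_perms])
    fix \<pi>
    let ?G = "\<lambda>j. (\<Sum>i<j. of_bool (hit i \<pi>) :: real) powr (1 / q)"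
    have "(\<Sum>k<n. X (s k) powr q * of_bool (hit k \<pi>)) powr (1 / q) \<le> (\<Sum>k<n. X (s k) * (?G (Suc k) - ?G k))"
      using n_le_sq by (intro lq_le_lq1 q X_antimono X_nonneg) auto
    also have "\<dots> = (\<Sum>j<n. (b j - b (Suc j)) * ?G (Suc j))"
      by (rule b_summation) simp
    also have "\<dots> = (\<Sum>j<n. (b j - b (Suc j)) * ?F (Suc j) \<pi> powr (1 / q))"
      using hits_s_image[OF sub] by (intro sum.cong refl) (metis Suc_leI lessThan_iff)
    finally show "(\<Sum>k<n. X (s k) powr q * of_bool (hit k \<pi>)) powr (1 / q)
      \<le> (\<Sum>j<n. (b j - b (Suc j)) * ?F (Suc j) \<pi> powr (1 / q))" .
  qed
  also have "\<dots> \<le> (\<Sum>j<n. dnorm \<phi> (perms n) (\<lambda>\<pi>. (b j - b (Suc j)) * ?F (Suc j) \<pi> powr (1 / q)))"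
    by (rule dnorm_sum_le[OF phi finite_perms]) simp
  also have "\<dots> = (\<Sum>j<n. (b j - b (Suc j)) * dnorm \<phi> (perms n) (\<lambda>\<pi>. ?F (Suc j) \<pi> powr (1 / q)))"
    by (intro sum.cong refl dnorm_cmult phi finite_perms b_diff_nonneg)
  also have "\<dots> \<le> (\<Sum>j<n. (b j - b (Suc j)) * (g * \<phi> (real (Suc j) / n)))"
  proof (intro sum_mono mult_left_mono b_diff_nonneg)
    fix j assume "j \<in> {..<n}"
    then have j: "Suc j \<le> n" by simp
    from dnorm_hits_le[OF phi p g s_image_sub[OF sub[OF j]]] card_s_image[OF sub[OF j]] j
    show "dnorm \<phi> (perms n) (\<lambda>\<pi>. ?F (Suc j) \<pi> powr (1 / q)) \<le> g * \<phi> (real (Suc j) / n)"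
      by (simp add: lessThan_Suc)
  qed
  also have "\<dots> = g * U_val"
    unfolding U_val_eq by (simp add: sum_distrib_left mult_ac)
  finally show ?thesis .
qed

text \<open>For diagonal matrices this keeps the constant g itself, as the inequality between the
  operator norm and \<Gamma> demands.\<close>

lemma dnorm_T_sparse_le:
  assumes "Gamma_bound \<phi> (1 / q) g" and "\<And>k. n \<le> k \<Longrightarrow> k < n * n \<Longrightarrow> X (s k) = 0"
  shows "dnorm \<phi> (perms n) T \<le> g * U_val"
proof -
  have "(\<Sum>k\<in>{n..<n * n}. X (s k) powr q * of_bool (hit k \<pi>)) = 0" for \<pi>
    using assms(2) by (intro sum.neutral) auto
  then have "T = (\<lambda>\<pi>. (\<Sum>k<n. X (s k) powr q * of_bool (hit k \<pi>)) powr (1 / q))"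
    unfolding T_eq sum_split_n by auto
  with dnorm_head_le[OF assms(1)] show ?thesis by simp
qed

text \<open>Each block is weighted by its largest q-th power, which is at most the mean over the
  preceding block. The first block has no predecessor beyond rank n; it is responsible for the term
  \<open>X (s (n - 1))\<close>.\<close>

lemma dnorm_rest_le:
  assumes g: "Gamma_bound \<phi> (1 / q) g"
  shows "dnorm \<phi> (perms n) (\<lambda>\<pi>. (\<Sum>k\<in>{n..<n * n}. X (s k) powr q * of_bool (hit k \<pi>)) powr (1 / q))
    \<le> 3 * (1 + g) * (X (s (n - 1)) + rest_mean powr (1 / q))"
proof -
  define v where "v r = X (s (r * n)) powr q" for r
  let ?blk = "\<lambda>r. {r * n..<r * n + n}"
  have blk: "?blk r \<subseteq> {..<n * n}" if "r < n" for r
  proof -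
    have "r * n + n \<le> n * n" using that by (metis Suc_leI add.commute mult_Suc mult_le_mono1)
    then show ?thesis by auto
  qed
  have blocks: "(\<Sum>k\<in>{n..<n * n}. f k) = (\<Sum>r\<in>{1..<n}. sum f (?blk r))" for f :: "nat \<Rightarrow> real"
  proof -
    have "(\<Sum>k<n. f k) + (\<Sum>k\<in>{n..<n * n}. f k) = (\<Sum>r<n. sum f (?blk r))"
      unfolding sum_split_n[symmetric] by (rule sum.nat_group[symmetric])
    also have "\<dots> = sum f (?blk 0) + (\<Sum>r\<in>{1..<n}. sum f (?blk r))"
      using n by (simp add: lessThan_atLeast0 sum.atLeast_Suc_lessThan)
    finally show ?thesis by (simp add: lessThan_atLeast0)
  qed
  have ge0: "0 \<le> (\<Sum>k\<in>{n..<n * n}. X (s k) powr q * of_bool (hit k \<pi>))" for \<pi>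
    by (intro sum_nonneg) auto
  have "dnorm \<phi> (perms n) (\<lambda>\<pi>. (\<Sum>k\<in>{n..<n * n}. X (s k) powr q * of_bool (hit k \<pi>)) powr (1 / q))
    \<le> dnorm \<phi> (perms n) (\<lambda>\<pi>. (\<Sum>r\<in>{1..<n}. v r * real (hits (s ` ?blk r) \<pi>)) powr (1 / q))"
  proof (intro dnorm_mono phi finite_perms powr_mono2 ge0)
    fix \<pi>
    show "(\<Sum>k\<in>{n..<n * n}. X (s k) powr q * of_bool (hit k \<pi>)) \<le> (\<Sum>r\<in>{1..<n}. v r * real (hits (s ` ?blk r) \<pi>))"
      unfolding blocks
    proof (rule sum_mono)
      fix r assume r: "r \<in> {1..<n}"
      then have sub: "?blk r \<subseteq> {..<n * n}" using blk by simp
      show "(\<Sum>k\<in>?blk r. X (s k) powr q * of_bool (hit k \<pi>)) \<le> v r * real (hits (s ` ?blk r) \<pi>)"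
        unfolding hits_s_image[OF sub] sum_distrib_left v_def
      proof (intro sum_mono mult_right_mono powr_mono2)
        fix k assume "k \<in> ?blk r"
        then show "X (s k) \<le> X (s (r * n))" using sub by (intro X_antimono) auto
      qed (use q X_nonneg in auto)
    qed
  qed (use p in auto)
  also have "\<dots> \<le> (3 * sum v {1..<n}) powr (1 / q) * (1 + g)"
  proof (rule dnorm_mixture_le[OF phi p g finite_perms])
    fix r :: nat and z :: real assume r: "r \<in> {1..<n}" and z: "0 \<le> z"
    then have sub: "?blk r \<subseteq> {..<n * n}" using blk by simp
    show "(\<Sum>\<pi>\<in>perms n. (1 + z) ^ hits (s ` ?blk r) \<pi>) / card (perms n) \<le> exp z"
      using mean_exp_hits_le[OF s_image_sub[OF sub] _ z] card_s_image[OF sub] by (simp only: card_perms) simp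
  qed (use card_perms[of n] in \<open>auto simp: v_def permutes_id intro: exI[of _ id]\<close>)
  also have "\<dots> \<le> 3 * (X (s (n - 1)) + rest_mean powr (1 / q)) * (1 + g)"
  proof (intro mult_right_mono)
    have v_le: "n * v (Suc r) \<le> (\<Sum>k\<in>?blk r. X (s k) powr q)" if "Suc r < n" for r
    proof -
      have "(\<Sum>k\<in>?blk r. v (Suc r)) \<le> (\<Sum>k\<in>?blk r. X (s k) powr q)"
        unfolding v_def
      proof (intro sum_mono powr_mono2 X_antimono)
        fix k assume "k \<in> ?blk r"
        then show "k \<le> Suc r * n" by simp
        show "Suc r * n < n * n" using that n by (intro mult_strict_right_mono) auto
      qed (use q X_nonneg in auto)
      then show ?thesis by simp
    qed
    have "sum v {1..<n} \<le> X (s (n - 1)) powr q + rest_mean"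
    proof (cases "n = 1")
      case True
      then have "sum v {1..<n} = 0" by simp
      then show ?thesis using rest_mean_nonneg by simp
    next
      case False
      then have n2: "1 < n" using n by simp
      have "sum v {1..<n} = v 1 + (\<Sum>r\<in>{1..<n - 1}. v (Suc r))"
        using n2 by (simp add: sum.atLeast_Suc_lessThan sum.shift_bounds_Suc_ivl[symmetric])
      also have "\<dots> \<le> X (s (n - 1)) powr q + (\<Sum>r\<in>{1..<n}. (\<Sum>k\<in>?blk r. X (s k) powr q) / n)"
      proof (rule add_mono)
        show "v 1 \<le> X (s (n - 1)) powr q"
          unfolding v_def using n2 q X_nonneg by (intro powr_mono2 X_antimono) auto
        have "(\<Sum>r\<in>{1..<n - 1}. v (Suc r)) \<le> (\<Sum>r\<in>{1..<n - 1}. (\<Sum>k\<in>?blk r. X (s k) powr q) / n)"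
        proof (rule sum_mono)
          fix r assume "r \<in> {1..<n - 1}"
          then have "n * v (Suc r) \<le> (\<Sum>k\<in>?blk r. X (s k) powr q)" by (intro v_le) auto
          then show "v (Suc r) \<le> (\<Sum>k\<in>?blk r. X (s k) powr q) / n"
            using n by (simp add: le_divide_eq mult.commute)
        qed
        also have "\<dots> \<le> (\<Sum>r\<in>{1..<n}. (\<Sum>k\<in>?blk r. X (s k) powr q) / n)"
          by (intro sum_mono2) (auto intro!: divide_nonneg_nonneg sum_nonneg)
        finally show "(\<Sum>r\<in>{1..<n - 1}. v (Suc r)) \<le> (\<Sum>r\<in>{1..<n}. (\<Sum>k\<in>?blk r. X (s k) powr q) / n)" .
      qed
      also have "\<dots> = X (s (n - 1)) powr q + rest_mean"
        unfolding rest_mean_def blocks by (simp add: sum_divide_distrib)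
      finally show ?thesis .
    qed
    moreover have "0 \<le> sum v {1..<n}" by (intro sum_nonneg) (simp add: v_def)
    ultimately have "(3 * sum v {1..<n}) powr (1 / q) \<le> (3 * (X (s (n - 1)) powr q + rest_mean)) powr (1 / q)"
      using p by (intro powr_mono2) auto
    also have "\<dots> = 3 powr (1 / q) * (X (s (n - 1)) powr q + rest_mean) powr (1 / q)"
      by (subst powr_mult) (auto simp: rest_mean_def intro!: divide_nonneg_nonneg sum_nonneg add_nonneg_nonneg)
    also have "\<dots> \<le> 3 * (X (s (n - 1)) + rest_mean powr (1 / q))"
    proof (rule mult_mono)
      show "3 powr (1 / q) \<le> (3::real)" using powr_mono[OF p(2), of 3] by simp
      have "(X (s (n - 1)) powr q + rest_mean) powr (1 / q) \<le> (X (s (n - 1)) powr q) powr (1 / q) + rest_mean powr (1 / q)"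
        by (intro powr_add_le_add_powr p) (auto simp: rest_mean_def intro!: divide_nonneg_nonneg sum_nonneg)
      also have "(X (s (n - 1)) powr q) powr (1 / q) = X (s (n - 1))"
        using q X_nonneg by (simp add: powr_powr)
      finally show "(X (s (n - 1)) powr q + rest_mean) powr (1 / q) \<le> X (s (n - 1)) + rest_mean powr (1 / q)" .
    qed auto
    finally show "(3 * sum v {1..<n}) powr (1 / q) \<le> 3 * (X (s (n - 1)) + rest_mean powr (1 / q))" .
  qed (use Gamma_bound_ge_1[OF phi g] in simp)
  finally show ?thesis by (simp only: mult_ac)
qed

text \<open>\<open>U_val\<close> is a weighted average of the n largest entries, since the weights
  add up to \<open>\<phi> 1 = 1\<close>.\<close>

lemma nth_le_U_val: "X (s (n - 1)) \<le> U_val"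
proof -
  have "X (s (n - 1)) = (\<Sum>k<n. weight \<phi> n k) * X (s (n - 1))"
    using sum_weight[OF phi, of n n] Phi_1[OF phi] n by simp
  also have "\<dots> \<le> U_val"
    unfolding U_val_def sum_distrib_right
  proof (intro sum_mono mult_left_mono X_antimono)
    show "n - 1 < n * n" using n n_le_sq by linarith
  qed (auto intro: weight_nonneg[OF phi])
  finally show ?thesis .
qed

lemma dnorm_T_le:
  assumes g: "Gamma_bound \<phi> (1 / q) g"
  shows "dnorm \<phi> (perms n) T \<le> (3 + 4 * g) * (U_val + rest_mean powr (1 / q))"
proof -
  let ?H = "\<lambda>\<pi>. (\<Sum>k<n. X (s k) powr q * of_bool (hit k \<pi>)) powr (1 / q)"
  let ?R = "\<lambda>\<pi>. (\<Sum>k\<in>{n..<n * n}. X (s k) powr q * of_bool (hit k \<pi>)) powr (1 / q)"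
  have g1: "1 \<le> g" by (rule Gamma_bound_ge_1[OF phi g])
  have "dnorm \<phi> (perms n) T \<le> dnorm \<phi> (perms n) (\<lambda>\<pi>. ?H \<pi> + ?R \<pi>)"
    unfolding T_eq sum_split_n
    by (intro dnorm_mono phi finite_perms powr_add_le_add_powr p sum_nonneg) auto
  also have "\<dots> \<le> dnorm \<phi> (perms n) ?H + dnorm \<phi> (perms n) ?R"
    by (rule dnorm_add_le[OF phi finite_perms])
  also have "\<dots> \<le> g * U_val + 3 * (1 + g) * (X (s (n - 1)) + rest_mean powr (1 / q))"
    by (intro add_mono dnorm_head_le dnorm_rest_le g)
  also have "\<dots> \<le> g * U_val + 3 * (1 + g) * (U_val + rest_mean powr (1 / q))"
    using nth_le_U_val g1 by (intro add_left_mono mult_left_mono add_right_mono) auto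
  \<comment> \<open>The added term equalises the two coefficients at g + 3 (1 + g) = 3 + 4
    g.\<close>
  also have "\<dots> \<le> g * U_val + 3 * (1 + g) * (U_val + rest_mean powr (1 / q)) + g * rest_mean powr (1 / q)"
    using g1 by simp
  also have "\<dots> = (3 + 4 * g) * (U_val + rest_mean powr (1 / q))" by (simp add: algebra_simps)
  finally show ?thesis .
qed

text \<open>A permutation meets one of the first j positions with probability at least j/(2 n), and
  \<phi>(t) \<le> 2 \<phi>(t/2). These events form a chain, on which the norm is additive, and the
  step function built on them is pointwise the largest of the n leading entries that \<pi>
  meets.\<close>

lemma U_val_le: "U_val \<le> 2 * dnorm \<phi> (perms n) T"
proof -
  let ?B = "\<lambda>j. {\<pi>\<in>perms n. 0 < hits (s ` {..<Suc j}) \<pi>}"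
  have sub: "{..<j} \<subseteq> {..<n * n}" if "j \<le> n" for j
    using order_trans[OF that n_le_sq] by simp
  have hits_iff: "0 < hits (s ` {..<j}) \<pi> \<longleftrightarrow> (\<exists>k<j. hit k \<pi>)" for j \<pi>
    unfolding hits_def hits_s_image_eq by (auto simp: card_gt_0_iff)
  have "U_val \<le> (\<Sum>j<n. (b j - b (Suc j)) * (2 * \<phi> (card (?B j) / card (perms n))))"
    unfolding U_val_eq
  proof (intro sum_mono mult_left_mono b_diff_nonneg)
    fix j assume "j \<in> {..<n}"
    then have j: "Suc j \<le> n" by simp
    let ?t = "real (Suc j) / n"
    have t: "0 \<le> ?t" "?t \<le> 1" using j by (auto simp: divide_le_eq_1)
    have "(1 / 2) * \<phi> ?t \<le> \<phi> ((1 / 2) * ?t)" using t by (intro Phi_scale phi) auto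
    also have "\<dots> \<le> \<phi> (card (?B j) / card (perms n))"
    proof (rule Phi_mono[OF phi])
      show "1 / 2 * ?t \<le> card (?B j) / card (perms n)"
        using prob_hits_pos_ge[OF s_image_sub[OF sub[OF j]] _ n] card_s_image[OF sub[OF j]] j
        by (simp only: card_perms) simp
      show "card (?B j) / card (perms n) \<le> 1"
        using prob_in_unit[OF finite_perms, of "?B j" n] by auto
    qed (use t in auto)
    finally show "\<phi> ?t \<le> 2 * \<phi> (card (?B j) / card (perms n))" by simp
  qed
  also have "\<dots> = 2 * (\<Sum>j<n. (b j - b (Suc j)) * \<phi> (card (?B j) / card (perms n)))"
    by (simp add: sum_distrib_left mult_ac)
  also have "(\<Sum>j<n. (b j - b (Suc j)) * \<phi> (card (?B j) / card (perms n)))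
      = dnorm \<phi> (perms n) (\<lambda>\<pi>. \<Sum>j<n. (b j - b (Suc j)) * indicator (?B j) \<pi>)"
  proof (rule dnorm_chain[symmetric, OF phi finite_perms])
    show "?B i \<subseteq> ?B j \<or> ?B j \<subseteq> ?B i" for i j
    proof (cases "i \<le> j")
      case True
      then have "?B i \<subseteq> ?B j" unfolding hits_iff using order_less_le_trans by fastforce
      then show ?thesis ..
    next
      case False
      then have "?B j \<subseteq> ?B i" unfolding hits_iff using order_less_le_trans by fastforce
      then show ?thesis ..
    qed
  qed (use b_diff_nonneg in auto)
  also have "dnorm \<phi> (perms n) (\<lambda>\<pi>. \<Sum>j<n. (b j - b (Suc j)) * indicator (?B j) \<pi>) \<le> dnorm \<phi> (perms n) T"
  proof (rule dnorm_mono[OF phi finite_perms])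
    fix \<pi> assume \<pi>: "\<pi> \<in> perms n"
    let ?G = "\<lambda>j. of_bool (\<exists>k<j. hit k \<pi>) :: real"
    have T_ge: "X (s k) \<le> T \<pi>" if "k < n" "hit k \<pi>" for k
    proof -
      have "X (s k) = (X (s k) powr q) powr (1 / q)" using q X_nonneg by (simp add: powr_powr)
      also have "\<dots> \<le> T \<pi>"
        unfolding T_eq
      proof (intro powr_mono2)
        show "X (s k) powr q \<le> (\<Sum>k<n * n. X (s k) powr q * of_bool (hit k \<pi>))"
          using member_le_sum[of k "{..<n * n}" "\<lambda>k. X (s k) powr q * of_bool (hit k \<pi>)"] that n_le_sq by simp
      qed (use p in auto)
      finally show ?thesis .
    qed
    have "(\<Sum>k<m. X (s k) * (?G (Suc k) - ?G k)) \<le> of_bool (\<exists>k<m. hit k \<pi>) * T \<pi>" if "m \<le> n" for m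
      using that
    proof (induction m)
      case (Suc m)
      have "X (s m) * (?G (Suc m) - ?G m) \<le> (?G (Suc m) - ?G m) * T \<pi>"
        using T_ge[of m] Suc.prems by (auto simp: less_Suc_eq)
      with Suc show ?case by (simp add: left_diff_distrib)
    qed simp
    from this[of n] have "(\<Sum>k<n. X (s k) * (?G (Suc k) - ?G k)) \<le> T \<pi>"
      by (rule order_trans) (auto simp: T_def)
    moreover have "(\<Sum>k<n. X (s k) * (?G (Suc k) - ?G k)) = (\<Sum>j<n. (b j - b (Suc j)) * ?G (Suc j))"
      by (rule b_summation) simp
    moreover have "indicator (?B j) \<pi> = ?G (Suc j)" for j
      using \<pi> by (simp add: hits_iff indicator_def)
    ultimately show "(\<Sum>j<n. (b j - b (Suc j)) * indicator (?B j) \<pi>) \<le> T \<pi>" by simp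
  qed
  finally show ?thesis by simp
qed

text \<open>Second moment method: if the entries beyond the \<open>n\<close>-th are small compared with the mean \<open>M\<close> of
  their \<open>q\<close>-th powers along a permutation, then that sum has second moment at most \<open>3 M\<^sup>2\<close>.\<close>

lemma rest_mean_le: "rest_mean powr (1 / q) \<le> X (s (n - 1)) + 4 * dnorm \<phi> (perms n) T"
proof (cases "rest_mean \<le> X (s (n - 1)) powr q")
  case True
  have "rest_mean powr (1 / q) \<le> (X (s (n - 1)) powr q) powr (1 / q)"
    using True p by (intro powr_mono2) (auto simp: rest_mean_def intro!: divide_nonneg_nonneg sum_nonneg)
  also have "\<dots> = X (s (n - 1))" using q X_nonneg by (simp add: powr_powr)
  finally show ?thesis
    using dnorm_nonneg[OF phi finite_perms, of n T] by (simp add: T_def)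
next
  case False
  define M where "M = rest_mean"
  define P where "P = s ` {n..<n * n}"
  define w where "w i = X i powr q" for i
  define Y where "Y \<pi> = (\<Sum>i\<in>P. w i * of_bool (\<pi> (fst i) = snd i))" for \<pi> :: "nat \<Rightarrow> nat"
  let ?B = "X (s (n - 1)) powr q"
  have M: "?B < M" using False by (simp add: M_def)
  then have M0: "0 < M" using powr_ge_zero[of "X (s (n - 1))" q] by linarith
  \<comment> \<open>A positive mean requires ranks beyond n. The bound n \<ge> 2 is used below for
    n/(n - 1) \<le> 2.\<close>
  have n2: "2 \<le> n"
  proof (rule ccontr)
    assume "\<not> 2 \<le> n"
    then have "n = 1" using n by simp
    then have "M = 0" unfolding M_def rest_mean_def by simp
    then show False using M0 by simp
  qed
  have P: "P \<subseteq> {1..n} \<times> {1..n}" unfolding P_def by (rule s_image_sub) auto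
  have inj: "inj_on s {n..<n * n}"
    using s_bij by (auto simp: bij_betw_def intro: inj_on_subset)
  have sum_w: "(\<Sum>i\<in>P. w i) = n * M"
    unfolding P_def w_def M_def rest_mean_def using n by (simp add: sum.reindex[OF inj])
  have fn: "fact n = real n * fact (n - 1)" "fact n = real n * (real n - 1) * fact (n - 2)"
  proof -
    show "fact n = real n * fact (n - 1)" using n by (simp add: fact_reduce)
    moreover have "fact (n - 1) = (real n - 1) * fact (n - 2)"
      using n2 fact_reduce[of "n - 1", where 'a = real] by (simp add: of_nat_diff numeral_2_eq_2)
    ultimately show "fact n = real n * (real n - 1) * fact (n - 2)" by simp
  qed
  have mean: "(\<Sum>\<pi>\<in>perms n. Y \<pi>) / fact n = M"
    unfolding Y_def sum_incidence[OF P] sum_w fn(1) using n by simp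
  have w_le: "(\<Sum>i\<in>P. (w i)\<^sup>2) \<le> ?B * (n * M)"
  proof -
    have "(\<Sum>i\<in>P. (w i)\<^sup>2) \<le> (\<Sum>i\<in>P. ?B * w i)"
      unfolding power2_eq_square
    proof (intro sum_mono mult_right_mono)
      fix i assume "i \<in> P"
      then obtain k where k: "i = s k" "n \<le> k" "k < n * n" by (auto simp: P_def)
      then show "w i \<le> ?B" unfolding w_def using q by (auto intro!: powr_mono2 X_antimono X_nonneg)
    qed (simp add: w_def)
    then show ?thesis by (simp add: sum_distrib_left[symmetric] sum_w)
  qed
  have "(\<Sum>\<pi>\<in>perms n. (Y \<pi>)\<^sup>2) \<le> fact (n - 1) * (\<Sum>i\<in>P. (w i)\<^sup>2) + fact (n - 2) * (n * M)\<^sup>2"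
    unfolding Y_def sum_w[symmetric] by (rule sum_incidence_square_le[OF P]) (simp add: w_def)
  also have "\<dots> \<le> fact (n - 1) * (M * (n * M)) + fact (n - 2) * (n * M)\<^sup>2"
    using w_le M M0 by (intro add_right_mono mult_left_mono order_trans[OF w_le] mult_right_mono) auto
  also have "\<dots> = fact n * M\<^sup>2 + fact n * M\<^sup>2 * (n / (real n - 1))"
    using n2 unfolding power_mult_distrib
    by (subst fn(1), subst fn(2)) (simp add: power2_eq_square field_simps)
  also have "\<dots> \<le> fact n * M\<^sup>2 + fact n * M\<^sup>2 * 2"
    using n2 by (intro add_left_mono mult_left_mono) (auto simp: divide_le_eq)
  finally have second: "(\<Sum>\<pi>\<in>perms n. (Y \<pi>)\<^sup>2) / fact n \<le> 3 * M\<^sup>2"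
    by (simp add: divide_le_eq mult_ac)
  have Y0: "0 \<le> Y \<pi>" for \<pi> unfolding Y_def by (intro sum_nonneg) (auto simp: w_def)
  \<comment> \<open>With u = Y/M, the parabola u - u^2/4 lies below min(u, 1), hence below the root
    of u. As u has mean 1 and second moment at most 3, the parabola has mean at least 1/4; this is
    the constant 4 of the claim.\<close>
  have pt: "M powr (1 / q) * (Y \<pi> / M - (Y \<pi> / M)\<^sup>2 / 4) \<le> T \<pi>" for \<pi>
  proof -
    let ?u = "Y \<pi> / M"
    have u: "0 \<le> ?u" using Y0 M0 by simp
    have "?u - ?u\<^sup>2 / 4 \<le> ?u powr (1 / q)"
    proof (cases "?u \<le> 1")
      case True
      have "?u \<le> ?u powr (1 / q)" using powr_mono'[OF p(2) u True] u by (simp only: powr_one)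
      moreover have "0 \<le> ?u\<^sup>2" by simp
      ultimately show ?thesis by linarith
    next
      case False
      have "0 \<le> (1 - ?u / 2)\<^sup>2" by simp
      then have "?u - ?u\<^sup>2 / 4 \<le> 1" by (simp add: power2_eq_square algebra_simps)
      also have "1 \<le> ?u powr (1 / q)" using False p by (intro ge_one_powr_ge_zero) auto
      finally show ?thesis .
    qed
    then have "M powr (1 / q) * (?u - ?u\<^sup>2 / 4) \<le> M powr (1 / q) * ?u powr (1 / q)"
      by (intro mult_left_mono) auto
    also have "\<dots> = Y \<pi> powr (1 / q)" using M0 Y0 by (simp add: powr_mult[symmetric])
    also have "\<dots> \<le> T \<pi>"
      unfolding T_def Y_def w_def using P p
      by (intro powr_mono2 sum_mono2) (auto intro!: sum_nonneg)
    finally show ?thesis .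
  qed
  have "M powr (1 / q) / 4 \<le> M powr (1 / q) * (1 - 3 / 4)" by simp
  also have "\<dots> \<le> M powr (1 / q) * (((\<Sum>\<pi>\<in>perms n. Y \<pi>) / fact n) / M - ((\<Sum>\<pi>\<in>perms n. (Y \<pi>)\<^sup>2) / fact n) / (4 * M\<^sup>2))"
    unfolding mean using M0 second by (intro mult_left_mono diff_mono) (auto simp: divide_le_eq mult_ac)
  also have "\<dots> = (\<Sum>\<pi>\<in>perms n. M powr (1 / q) * (Y \<pi> / M - (Y \<pi> / M)\<^sup>2 / 4)) / fact n"
  proof -
    have "(\<Sum>\<pi>\<in>perms n. Y \<pi> / M - (Y \<pi> / M)\<^sup>2 / 4) = (\<Sum>\<pi>\<in>perms n. Y \<pi>) / M - (\<Sum>\<pi>\<in>perms n. (Y \<pi>)\<^sup>2) / (4 * M\<^sup>2)"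
      by (simp add: sum_subtractf sum_divide_distrib power_divide mult.commute)
    then show ?thesis unfolding sum_distrib_left[symmetric]
      by (simp add: diff_divide_distrib right_diff_distrib mult_ac)
  qed
  also have "\<dots> \<le> (\<Sum>\<pi>\<in>perms n. T \<pi>) / fact n"
    by (intro divide_right_mono sum_mono pt) simp
  also have "\<dots> \<le> dnorm \<phi> (perms n) T"
    using mean_le_dnorm[OF phi finite_perms, of n T] by (simp only: card_perms of_nat_fact) (simp add: T_def)
  finally show ?thesis using X_nonneg[of "s (n - 1)"] unfolding M_def by linarith
qed

end

text \<open>The partial sums of the ranked entries are at most J and at most m, as for m ones
  followed by zeros; the weights then telescope.\<close>

lemma (in ranked_matrix) U_val_le_Phi:
  assumes X1: "\<And>i. X i \<le> 1" and sum: "(\<Sum>i\<in>{1..n} \<times> {1..n}. X i) \<le> real m" and m: "m \<le> n"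
  shows "U_val \<le> \<phi> (real m / n)"
proof -
  have "U_val \<le> (\<Sum>k<n. weight \<phi> n k * of_bool (k < m))"
    unfolding U_val_def
  proof (rule abel_sum_mono)
    fix J assume J: "J \<le> n"
    have "(\<Sum>k<J. X (s k)) \<le> real J" using sum_mono[of "{..<J}" "\<lambda>k. X (s k)" "\<lambda>_. 1"] X1 by simp
    moreover have "(\<Sum>k<J. X (s k)) \<le> real m"
    proof -
      have "(\<Sum>k<J. X (s k)) \<le> (\<Sum>k<n * n. X (s k))"
        using order_trans[OF J n_le_sq] by (intro sum_mono2) (auto intro: X_nonneg)
      also have "\<dots> = (\<Sum>i\<in>{1..n} \<times> {1..n}. X i)" by (rule sum.reindex_bij_betw[OF s_bij])
      finally show ?thesis using sum by simp
    qed
    moreover have "(\<Sum>k<J. of_bool (k < m)) = real (min J m)"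
    proof -
      have "{..<J} \<inter> {k. k < m} = {..<min J m}" by auto
      then show ?thesis by (simp add: sum_of_bool_eq)
    qed
    ultimately show "(\<Sum>k<J. X (s k)) \<le> (\<Sum>k<J. of_bool (k < m))" by simp
  qed (use weight_antimono[OF phi] weight_nonneg[OF phi] in auto)
  also have "\<dots> = (\<Sum>k<m. weight \<phi> n k)"
    using m by (intro sum.mono_neutral_cong_right) auto
  also have "\<dots> = \<phi> (real m / n)" by (rule sum_weight[OF phi])
  finally show ?thesis .
qed

section \<open>From matrices and step functions to ranked entries\<close>

definition entry :: "(nat \<Rightarrow> nat \<Rightarrow> real) \<Rightarrow> nat \<times> nat \<Rightarrow> real" where
  "entry x i = \<bar>x (fst i) (snd i)\<bar>"

text \<open>A sorted list is determined by its multiset, so any ranking reproduces it, ties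
  included. The shift is due to ranks starting at 1 in \<open>entry_rearrangement\<close>.\<close>

lemma entry_rearrangement_eq:
  assumes s: "sorted_bij ({1..n} \<times> {1..n}) (entry x) s" and k: "k < n * n"
  shows "entry_rearrangement n x (Suc k) = entry x (s k)"
proof -
  let ?P = "{1..n} \<times> {1..n}"
  let ?L = "List.product [1..<Suc n] [1..<Suc n]"
  let ?M = "map s [0..<n * n]"
  have card: "card ?P = n * n" by (simp add: card_cartesian_product)
  have bij: "bij_betw s {..<n * n} ?P" using s by (simp add: sorted_bij_def card)
  have L: "[\<bar>x i j\<bar>. i \<leftarrow> [1..<Suc n], j \<leftarrow> [1..<Suc n]] = map (entry x) ?L"
    by (simp add: product_concat_map map_concat entry_def comp_def)
  have setL: "set ?L = ?P" by auto
  have distL: "distinct ?L" by (simp add: distinct_product)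
  have setM: "set ?M = ?P" using bij by (auto simp: bij_betw_def atLeast0LessThan)
  have distM: "distinct ?M" using bij by (auto simp: bij_betw_def distinct_map atLeast0LessThan)
  have "mset ?M = mset ?L"
    using distL distM setL setM by (metis set_eq_iff_mset_eq_distinct)
  then have "mset (rev (map (entry x) ?M)) = mset (map (entry x) ?L)"
    by (metis mset_map mset_rev)
  moreover have "sorted (rev (map (entry x) ?M))"
    using s unfolding sorted_rev_iff_nth_mono sorted_bij_def card by simp
  ultimately have "sort (map (entry x) ?L) = rev (map (entry x) ?M)"
    by (rule properties_for_sort)
  then show ?thesis
    using k unfolding entry_rearrangement_def L by simp
qed

lemma unit_cell_subset:
  assumes "1 \<le> k" "k \<le> N" shows "{(real k - 1) / real N..<real k / real N} \<subseteq> {0..1}"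
proof -
  have "0 \<le> (real k - 1) / real N" "real k / real N \<le> 1"
    using assms by (auto simp: divide_le_eq_1)
  then show ?thesis by (auto simp del: divide_le_eq_1_pos zero_le_divide_iff)
qed

lemma unit_cell_disjoint:
  assumes "i \<noteq> j"
  shows "{(real i - 1) / real N..<real i / real N} \<inter> {(real j - 1) / real N..<real j / real N} = {}"
proof -
  have "{(real i - 1) / real N..<real i / real N} \<inter> {(real j - 1) / real N..<real j / real N} = {}"
    if "i < j" for i j
  proof -
    have "real i / real N \<le> (real j - 1) / real N"
      using that by (intro divide_right_mono) auto
    then show ?thesis by auto
  qed
  then show ?thesis using assms by (metis Int_commute linorder_less_linear)
qed

text \<open>The enumeration only decides where the cells lie, so it disappears from the
  result.\<close>

lemma Lorentz_norm_T_op: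
  assumes phi: "\<phi> \<in> Phi" and l: "enumeration n l"
  shows "Lorentz_norm \<phi> (T_op q n l x) =
    ennreal (dnorm \<phi> (perms n) (\<lambda>\<pi>. (\<Sum>i=1..n. \<bar>x i (\<pi> i)\<bar> powr q) powr (1 / q)))"
proof -
  let ?X = "\<lambda>\<pi>. (\<Sum>i=1..n. \<bar>x i (\<pi> i)\<bar> powr q) powr (1 / q)"
  let ?N = "fact n :: nat"
  let ?I = "\<lambda>\<pi>. {(real (l \<pi>) - 1) / real ?N..<real (l \<pi>) / real ?N}"
  have l_inj: "inj_on l (perms n)" and l_range: "\<And>\<pi>. \<pi> \<in> perms n \<Longrightarrow> 1 \<le> l \<pi> \<and> l \<pi> \<le> ?N"
    using l by (auto simp: enumeration_def bij_betw_def)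
  obtain \<tau> where t: "sorted_bij (perms n) ?X \<tau>" using ex_sorted_bij[OF finite_perms] by blast
  have "Lorentz_norm \<phi> (T_op q n l x) = ennreal (\<Sum>k<?N. weight \<phi> ?N k * ?X (\<tau> k))"
  proof (rule Lorentz_norm_step[OF phi finite_perms card_perms, where I = ?I])
    show "bij_betw \<tau> {..<?N} (perms n)" "\<And>i j. i \<le> j \<Longrightarrow> j < ?N \<Longrightarrow> ?X (\<tau> j) \<le> ?X (\<tau> i)"
      using t unfolding sorted_bij_def card_perms by auto
    show "?I \<pi> \<subseteq> {0..1}" if "\<pi> \<in> perms n" for \<pi>
      using l_range[OF that] by (intro unit_cell_subset) auto
    show "disjoint_family_on ?I (perms n)"
      unfolding disjoint_family_on_def using l_inj
      by (intro ballI impI unit_cell_disjoint) (auto dest: inj_onD)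
    show "emeasure lebesgue (?I \<pi>) = ennreal (1 / ?N)" for \<pi>
    proof -
      have "(real (l \<pi>) - 1) / real ?N \<le> real (l \<pi>) / real ?N" by (intro divide_right_mono) auto
      then show ?thesis by (simp add: diff_divide_distrib)
    qed
    show "T_op q n l x u = (\<Sum>\<pi>\<in>perms n. ?X \<pi> * indicator (?I \<pi>) u)" for u
      unfolding T_op_def by simp
  qed auto
  also have "\<dots> = ennreal (dnorm \<phi> (perms n) ?X)"
    using dnorm_eq[OF phi t] unfolding card_perms by simp
  finally show ?thesis .
qed

lemma Lorentz_norm_U_op:
  assumes phi: "\<phi> \<in> Phi" and n: "1 \<le> n" and s: "sorted_bij ({1..n} \<times> {1..n}) (entry x) s"
  shows "Lorentz_norm \<phi> (U_op n x) = ennreal (\<Sum>k<n. weight \<phi> n k * entry x (s k))"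
proof -
  let ?X = "entry_rearrangement n x"
  let ?I = "\<lambda>k. {(real k - 1) / real n<..<real k / real n}"
  have le: "n \<le> n * n" using n by simp
  have X: "?X (Suc k) = entry x (s k)" if "k < n" for k
    using entry_rearrangement_eq[OF s] order_less_le_trans[OF that le] by simp
  have mono: "entry x (s j) \<le> entry x (s i)" if "i \<le> j" "j < n" for i j
    using s order_less_le_trans[OF that(2) le] that(1) by (simp add: sorted_bij_def card_cartesian_product)
  have sub: "?I k \<subseteq> {(real k - 1) / real n..<real k / real n}" for k by auto
  have "Lorentz_norm \<phi> (U_op n x) = ennreal (\<Sum>k<n. weight \<phi> n k * ?X (Suc k))"
  proof (rule Lorentz_norm_step[where A = "{1..n}" and I = ?I and \<tau> = Suc])
    show "0 \<le> ?X k" if "k \<in> {1..n}" for k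
    proof -
      have "k = Suc (k - 1)" "k - 1 < n" using that by auto
      then have "?X k = entry x (s (k - 1))" using X[of "k - 1"] by simp
      then show ?thesis by (simp add: entry_def)
    qed
    show "bij_betw Suc {..<n} {1..n}"
      by (rule bij_betw_byWitness[where f' = "\<lambda>k. k - 1"]) auto
    show "?X (Suc j) \<le> ?X (Suc i)" if "i \<le> j" "j < n" for i j
      using that X mono by simp
    show "?I k \<subseteq> {0..1}" if "k \<in> {1..n}" for k
      using order_trans[OF sub unit_cell_subset[of k n]] that by simp
    show "disjoint_family_on ?I {1..n}"
      unfolding disjoint_family_on_def
    proof (intro ballI impI)
      fix i j :: nat assume "i \<noteq> j"
      show "?I i \<inter> ?I j = {}"
        using Int_mono[OF sub[of i] sub[of j]] unfolding unit_cell_disjoint[OF \<open>i \<noteq> j\<close>] by (rule subset_empty[THEN iffD1])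
    qed
    show "emeasure lebesgue (?I k) = ennreal (1 / n)" for k
    proof -
      have "(real k - 1) / real n \<le> real k / real n" by (intro divide_right_mono) auto
      then show ?thesis by (simp add: diff_divide_distrib)
    qed
    show "U_op n x u = (\<Sum>k\<in>{1..n}. ?X k * indicator (?I k) u)" for u
      unfolding U_op_def by simp
  qed (use phi n in auto)
  also have "(\<Sum>k<n. weight \<phi> n k * ?X (Suc k)) = (\<Sum>k<n. weight \<phi> n k * entry x (s k))"
    using X by (intro sum.cong) auto
  finally show ?thesis .
qed

text \<open>One ranking serves U and the remaining mean simultaneously, which allows both to be
  treated inside the locale.\<close>

lemma Lorentz_norms_ranked:
  assumes phi: "\<phi> \<in> Phi" and q: "1 \<le> q" and n: "1 \<le> n" and l: "enumeration n l"
  obtains s where "ranked_matrix \<phi> q n (entry x) s"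
    "Lorentz_norm \<phi> (T_op q n l x) = ennreal (dnorm \<phi> (perms n) (ranked_matrix.T q n (entry x)))"
    "Lorentz_norm \<phi> (U_op n x) = ennreal (ranked_matrix.U_val \<phi> n (entry x) s)"
    "1 / real n * (\<Sum>k=n+1..n^2. entry_rearrangement n x k powr q) = ranked_matrix.rest_mean q n (entry x) s"
proof -
  obtain s where s: "sorted_bij ({1..n} \<times> {1..n}) (entry x) s"
    using ex_sorted_bij[of "{1..n} \<times> {1..n}"] by auto
  interpret ranked_matrix \<phi> q n "entry x" s
    by unfold_locales (use phi q n s in \<open>auto simp: entry_def\<close>)
  have "(\<Sum>i=1..n. \<bar>x i (\<pi> i)\<bar> powr q) powr (1 / q) = T \<pi>" if "\<pi> \<in> perms n" for \<pi>
  proof -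
    have "(\<Sum>i\<in>{1..n} \<times> {1..n}. entry x i powr q * of_bool (\<pi> (fst i) = snd i)) =
        (\<Sum>i=1..n. \<Sum>j=1..n. if j = \<pi> i then \<bar>x i j\<bar> powr q else 0)"
      unfolding sum.cartesian_product by (intro sum.cong) (auto simp: entry_def)
    also have "\<dots> = (\<Sum>i=1..n. \<bar>x i (\<pi> i)\<bar> powr q)"
      using that by (intro sum.cong refl) (auto simp: sum.delta dest: permutes_in_image)
    finally show ?thesis by (simp add: T_def)
  qed
  then have "dnorm \<phi> (perms n) (\<lambda>\<pi>. (\<Sum>i=1..n. \<bar>x i (\<pi> i)\<bar> powr q) powr (1 / q)) = dnorm \<phi> (perms n) T"
    by (rule dnorm_cong[OF phi finite_perms])
  then have 1: "Lorentz_norm \<phi> (T_op q n l x) = ennreal (dnorm \<phi> (perms n) T)"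
    using Lorentz_norm_T_op[OF phi l] by simp
  have "(\<Sum>k=n+1..n^2. entry_rearrangement n x k powr q) = (\<Sum>k\<in>{n..<n * n}. entry_rearrangement n x (Suc k) powr q)"
    by (rule sum.reindex_bij_witness[of _ Suc "\<lambda>k. k - 1"]) (auto simp: power2_eq_square)
  also have "\<dots> = (\<Sum>k\<in>{n..<n * n}. entry x (s k) powr q)"
    by (intro sum.cong refl) (simp add: entry_rearrangement_eq[OF s])
  finally have 2: "1 / real n * (\<Sum>k=n+1..n^2. entry_rearrangement n x k powr q) = rest_mean"
    by (simp add: rest_mean_def)
  show ?thesis
    by (rule that[OF ranked_matrix_axioms 1 _ 2]) (use Lorentz_norm_U_op[OF phi n s] in \<open>simp add: U_val_def\<close>)
qed

text \<open>Pigeonhole principle: a nonzero entry of such a rank would give more than n nonzero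
  entries, all on the diagonal.\<close>

lemma diagonal_rank_zero:
  assumes "ranked_matrix \<phi> q n (entry y) s" and y: "diagonal n y" and k: "n \<le> k" "k < n * n"
  shows "entry y (s k) = 0"
proof (rule ccontr)
  interpret ranked_matrix \<phi> q n "entry y" s by fact
  assume "entry y (s k) \<noteq> 0"
  then have pos: "0 < entry y (s k)" using X_nonneg[of "s k"] by simp
  let ?D = "(\<lambda>i. (i, i)) ` {1..n}"
  have sub: "{..k} \<subseteq> {..<n * n}" using k by auto
  have "s ` {..k} \<subseteq> ?D"
  proof
    fix r assume "r \<in> s ` {..k}"
    then obtain j where j: "r = s j" "j \<le> k" by auto
    then have "0 < entry y r" using X_antimono[of j k] k pos by simp
    moreover have "r \<in> {1..n} \<times> {1..n}" using s_image_sub[OF sub] j by auto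
    ultimately have "y (fst r) (snd r) \<noteq> 0" "fst r \<in> {1..n}" "snd r \<in> {1..n}"
      by (auto simp: entry_def)
    moreover from this have "fst r = snd r" using y unfolding diagonal_def by blast
    ultimately show "r \<in> ?D" by (intro image_eqI[of _ _ "fst r"]) (auto simp: prod_eq_iff)
  qed
  then have "card (s ` {..k}) \<le> card ?D" by (intro card_mono) auto
  also have "\<dots> = n" by (simp add: card_image inj_on_def)
  finally show False using card_s_image[OF sub] k by simp
qed

section \<open>The finite form of \<Gamma> and the diagonal test\<close>

lemma power_div_fact_le_1:
  fixes t :: real
  assumes "0 \<le> t" "t \<le> 1" shows "t ^ j / fact j \<le> 1"
proof -
  have "t ^ j / fact j \<le> 1 / 1"
    using assms power_le_one[of t j] fact_ge_1[of j, where 'a = real] by (intro frac_le) auto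
  then show ?thesis by simp
qed

lemma Gamma_const_le:
  assumes phi: "\<phi> \<in> Phi" and g: "Gamma_bound \<phi> (1 / q) g" and "0 \<le> g"
  shows "Gamma_const \<phi> q \<le> ennreal g"
  unfolding Gamma_const_def
proof (rule SUP_least)
  fix t :: real assume "t \<in> {0<..1}"
  then have t: "0 < t" "t \<le> 1" by auto
  have pos: "0 < \<phi> t" by (rule Phi_pos[OF phi t])
  let ?f = "\<lambda>j. real (Suc j) powr (1 / q - 1) * \<phi> (t ^ Suc j / fact (Suc j))"
  have f0: "0 \<le> ?f j" for j
    using t by (intro mult_nonneg_nonneg Phi_nonneg[OF phi] power_div_fact_le_1) auto
  have "(\<Sum>j. ennreal (?f j)) \<le> ennreal (g * \<phi> t)"
  proof (rule suminf_le_const)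
    fix J
    have "(\<Sum>j<J. ennreal (?f j)) = ennreal (\<Sum>j<J. ?f j)" using f0 by (intro sum_ennreal)
    also have "\<dots> \<le> ennreal (g * \<phi> t)"
      using g t unfolding Gamma_bound_def by (intro ennreal_leI) blast
    finally show "(\<Sum>j<J. ennreal (?f j)) \<le> ennreal (g * \<phi> t)" .
  qed simp
  then have "ennreal (1 / \<phi> t) * (\<Sum>j. ennreal (?f j)) \<le> ennreal (1 / \<phi> t) * ennreal (g * \<phi> t)"
    by (rule mult_left_mono) simp
  also have "\<dots> = ennreal g" using pos \<open>0 \<le> g\<close> by (simp add: ennreal_mult[symmetric])
  finally show "ennreal (1 / \<phi> t) * (\<Sum>j. ennreal (?f j)) \<le> ennreal g" .
qed

lemma Gamma_bound_of_Gamma_const: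
  assumes phi: "\<phi> \<in> Phi" and g: "Gamma_const \<phi> q = ennreal g" "0 \<le> g"
  shows "Gamma_bound \<phi> (1 / q) g"
  unfolding Gamma_bound_def
proof (intro allI impI)
  fix t :: real and J assume t: "0 < t" "t \<le> 1"
  have pos: "0 < \<phi> t" by (rule Phi_pos[OF phi t])
  let ?f = "\<lambda>j. real (Suc j) powr (1 / q - 1) * \<phi> (t ^ Suc j / fact (Suc j))"
  have f0: "0 \<le> ?f j" for j
    using t by (intro mult_nonneg_nonneg Phi_nonneg[OF phi] power_div_fact_le_1) auto
  have "ennreal (1 / \<phi> t * (\<Sum>j<J. ?f j)) = ennreal (1 / \<phi> t) * (\<Sum>j<J. ennreal (?f j))"
    unfolding sum_ennreal[OF f0] using pos by (intro ennreal_mult sum_nonneg f0) simp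
  also have "\<dots> \<le> ennreal (1 / \<phi> t) * (\<Sum>j. ennreal (?f j))"
    by (intro mult_left_mono sum_le_suminf) auto
  also have "\<dots> \<le> Gamma_const \<phi> q"
    unfolding Gamma_const_def using t by (intro SUP_upper) auto
  finally have "1 / \<phi> t * (\<Sum>j<J. ?f j) \<le> g"
    using g by (simp del: fact_Suc)
  then show "(\<Sum>j<J. ?f j) \<le> g * \<phi> t" using pos by (simp add: divide_le_eq del: fact_Suc)
qed

text \<open>The level sets are shrunk to the events of exactly j + 1 hits, whose limiting
  probabilities are explicit.\<close>

lemma dnorm_fixed_points_ge:
  assumes phi: "\<phi> \<in> Phi" and p: "0 < p" and K: "finite K"
  shows "(\<Sum>j<J. (real (Suc j) powr p - real j powr p) * \<phi> (real (card {\<pi>\<in>perms n. hits K \<pi> = Suc j}) / fact n))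
    \<le> dnorm \<phi> (perms n) (\<lambda>\<pi>. real (hits K \<pi>) powr p)"
proof -
  have c: "0 \<le> real (Suc j) powr p - real j powr p" for j using p by (simp add: powr_mono2)
  have unit: "0 \<le> real (card B) / fact n \<and> real (card B) / fact n \<le> 1" if "B \<subseteq> perms n" for B :: "(nat \<Rightarrow> nat) set"
    using prob_in_unit[OF finite_perms that] unfolding card_perms by simp
  have "(\<Sum>j<J. (real (Suc j) powr p - real j powr p) * \<phi> (real (card {\<pi>\<in>perms n. hits K \<pi> = Suc j}) / fact n))
     \<le> (\<Sum>j<J. (real (Suc j) powr p - real j powr p) * \<phi> (real (card {\<pi>\<in>perms n. Suc j \<le> hits K \<pi>}) / fact n))"
  proof (intro sum_mono mult_left_mono c Phi_mono[OF phi])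
    fix j
    show "0 \<le> real (card {\<pi>\<in>perms n. hits K \<pi> = Suc j}) / fact n" by simp
    show "real (card {\<pi>\<in>perms n. hits K \<pi> = Suc j}) / fact n \<le> real (card {\<pi>\<in>perms n. Suc j \<le> hits K \<pi>}) / fact n"
      using finite_perms[of n] by (intro divide_right_mono of_nat_mono card_mono) auto
    show "real (card {\<pi>\<in>perms n. Suc j \<le> hits K \<pi>}) / fact n \<le> 1"
      using unit[of "{\<pi>\<in>perms n. Suc j \<le> hits K \<pi>}"] by auto
  qed
  \<comment> \<open>The level-set formula needs a range that covers all values of the count;
    \<open>J + card K\<close> does so and contains the given range.\<close>
  also have "\<dots> \<le> (\<Sum>j<J + card K. (real (Suc j) powr p - real j powr p) * \<phi> (real (card {\<pi>\<in>perms n. Suc j \<le> hits K \<pi>}) / fact n))"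
  proof (intro sum_mono2 mult_nonneg_nonneg c Phi_nonneg[OF phi])
    fix j
    show "0 \<le> real (card {\<pi>\<in>perms n. Suc j \<le> hits K \<pi>}) / fact n" by simp
    show "real (card {\<pi>\<in>perms n. Suc j \<le> hits K \<pi>}) / fact n \<le> 1"
      using unit[of "{\<pi>\<in>perms n. Suc j \<le> hits K \<pi>}"] by auto
  qed auto
  also have "\<dots> = dnorm \<phi> (perms n) (\<lambda>\<pi>. real (hits K \<pi>) powr p)"
    using dnorm_powr_nat[OF phi finite_perms p, of n "hits K" "J + card K"] trans_le_add2[OF hits_le_card[OF K]]
    by (simp only: card_perms of_nat_fact)
  finally show ?thesis .
qed

text \<open>Testing the inequality on the diagonal matrix with \<open>\<lfloor>t n\<rfloor>\<close> ones: the number of fixed points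
  hit is asymptotically Poisson with parameter \<open>t\<close>.\<close>

lemma Gamma_bound_of_diagonal:
  assumes phi: "\<phi> \<in> Phi" and q: "1 \<le> q" and l: "\<And>n. 1 \<le> n \<Longrightarrow> enumeration n (l n)" and C: "0 \<le> C"
    and diag: "\<And>n y. 1 \<le> n \<Longrightarrow> diagonal n y \<Longrightarrow>
      Lorentz_norm \<phi> (T_op q n (l n) y) \<le> ennreal C * Lorentz_norm \<phi> (U_op n y)"
  shows "Gamma_bound \<phi> (1 / q) (q * exp 1 * C)"
  unfolding Gamma_bound_def
proof (intro allI impI)
  fix t :: real and J assume t: "0 < t" "t \<le> 1"
  let ?p = "1 / q"
  have p: "0 < ?p" "?p \<le> 1" using q by auto
  define k where "k n = nat \<lfloor>t * real n\<rfloor>" for n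
  define K where "K n = (\<lambda>i. (i, i)) ` {1..k n}" for n
  define c where "c j = real (Suc j) powr ?p - real j powr ?p" for j
  define P where "P j n = real (card {\<pi>\<in>perms n. hits (K n) \<pi> = Suc j}) / fact n" for j n
  define \<tau> where "\<tau> j = t ^ Suc j / fact (Suc j)" for j
  have c0: "0 \<le> c j" for j unfolding c_def using p by (simp add: powr_mono2)
  have k_le: "real (k n) \<le> t * real n" and k_gt: "t * real n - 1 \<le> real (k n)" for n
    using t unfolding k_def by auto
  have k_n: "k n \<le> n" for n
  proof -
    have "real (k n) \<le> 1 * real n" using k_le[of n] t by (intro order_trans[OF k_le] mult_right_mono) auto
    then show ?thesis by simp
  qed
  have k_lim: "(\<lambda>n. real (k n) / real n) \<longlonglongrightarrow> t"
  proof (rule tendsto_sandwich)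
    show "(\<lambda>n. t - 1 / real n) \<longlonglongrightarrow> t"
      using tendsto_diff[OF tendsto_const[of t] lim_const_over_n[of 1]] by simp
    show "\<forall>\<^sub>F n in sequentially. t - 1 / real n \<le> real (k n) / real n"
      using eventually_gt_at_top[of 0]
    proof eventually_elim
      case (elim n)
      have "(t * real n - 1) / real n \<le> real (k n) / real n" by (intro divide_right_mono k_gt) simp
      then show ?case using elim by (simp add: diff_divide_distrib)
    qed
    show "\<forall>\<^sub>F n in sequentially. real (k n) / real n \<le> t"
      using eventually_gt_at_top[of 0] by eventually_elim (use k_le in \<open>simp add: divide_le_eq\<close>)
  qed simp
  have \<tau>: "0 < \<tau> j" "\<tau> j \<le> 1" for j
    using t power_div_fact_le_1[of t "Suc j"] by (auto simp: \<tau>_def simp del: fact_Suc power_Suc)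
  have P_unit: "P j n \<le> 1" for j n
    using prob_in_unit[OF finite_perms, of "{\<pi>\<in>perms n. hits (K n) \<pi> = Suc j}" n] unfolding P_def card_perms by auto
  have P_lim: "(\<lambda>n. P j n) \<longlonglongrightarrow> \<tau> j * exp (- t)" for j
    unfolding P_def K_def \<tau>_def by (rule prob_fixed_tendsto[OF k_n k_lim])
  have bound: "(\<Sum>j<J. c j * \<phi> (P j n)) \<le> C * \<phi> t" if n: "1 \<le> n" for n
  proof -
    define y where "y i j = (if i = j \<and> i \<le> k n then 1 else 0 :: real)" for i j :: nat
    have y: "diagonal n y" by (simp add: diagonal_def y_def)
    obtain s where s: "ranked_matrix \<phi> q n (entry y) s"
      "Lorentz_norm \<phi> (T_op q n (l n) y) = ennreal (dnorm \<phi> (perms n) (ranked_matrix.T q n (entry y)))"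
      "Lorentz_norm \<phi> (U_op n y) = ennreal (ranked_matrix.U_val \<phi> n (entry y) s)"
      using Lorentz_norms_ranked[OF phi q n l[OF n]] by blast
    interpret ranked_matrix \<phi> q n "entry y" s by fact
    have e: "entry y i = of_bool (i \<in> K n)" if "i \<in> {1..n} \<times> {1..n}" for i
      using that by (cases i) (auto simp: entry_def y_def K_def)
    have sub: "K n \<subseteq> {1..n} \<times> {1..n}" using k_n[of n] by (fastforce simp: K_def)
    have card_K: "card (K n) = k n" by (simp add: K_def card_image inj_on_def)
    have Int: "({1..n} \<times> {1..n}) \<inter> K n = K n" using sub by blast
    have "T \<pi> = real (hits (K n) \<pi>) powr ?p" for \<pi>
    proof -
      have "(\<Sum>i\<in>{1..n} \<times> {1..n}. entry y i powr q * of_bool (\<pi> (fst i) = snd i)) =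
          (\<Sum>i\<in>{1..n} \<times> {1..n}. of_bool (i \<in> {i\<in>K n. \<pi> (fst i) = snd i}))"
        using q by (intro sum.cong refl) (auto simp: e)
      also have "\<dots> = real (card (({1..n} \<times> {1..n}) \<inter> {i\<in>K n. \<pi> (fst i) = snd i}))"
        by (simp add: sum_of_bool_eq)
      also have "({1..n} \<times> {1..n}) \<inter> {i\<in>K n. \<pi> (fst i) = snd i} = {i\<in>K n. \<pi> (fst i) = snd i}" using sub by blast
      finally show ?thesis unfolding T_def hits_def by simp
    qed
    then have T: "T = (\<lambda>\<pi>. real (hits (K n) \<pi>) powr ?p)" by auto
    have "(\<Sum>i\<in>{1..n} \<times> {1..n}. entry y i) = (\<Sum>i\<in>{1..n} \<times> {1..n}. of_bool (i \<in> K n))"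
      by (intro sum.cong refl e)
    also have "\<dots> = real (k n)" unfolding card_K[symmetric]
      by (simp only: sum_of_bool_eq finite_SigmaI finite_atLeastAtMost Collect_mem_eq Int)
    finally have "U_val \<le> \<phi> (real (k n) / n)"
      by (intro U_val_le_Phi k_n) (auto simp: entry_def y_def)
    also have "\<dots> \<le> \<phi> t"
      using k_le[of n] n t by (intro Phi_mono[OF phi]) (auto simp: divide_le_eq)
    finally have U: "U_val \<le> \<phi> t" .
    have U0: "0 \<le> U_val" using nth_le_U_val X_nonneg by (rule order_trans[rotated])
    have "(\<Sum>j<J. c j * \<phi> (P j n)) \<le> dnorm \<phi> (perms n) T"
      unfolding T c_def P_def by (rule dnorm_fixed_points_ge[OF phi p(1)]) (simp add: K_def)
    also have "\<dots> \<le> C * U_val"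
      using diag[OF n y] C U0 unfolding s by (simp add: ennreal_mult[symmetric] ennreal_le_iff)
    also have "\<dots> \<le> C * \<phi> t" using U C by (rule mult_left_mono)
    finally show ?thesis .
  qed
  \<comment> \<open>The number J of terms is fixed, so the limit may be taken termwise; \<phi> is
    continuous at the limits because they are positive.\<close>
  have "(\<lambda>n. \<Sum>j<J. c j * \<phi> (P j n)) \<longlonglongrightarrow> (\<Sum>j<J. c j * \<phi> (\<tau> j * exp (- t)))"
  proof (intro tendsto_sum tendsto_mult tendsto_const Phi_tendsto[OF phi P_lim])
    fix j
    show pos: "0 < \<tau> j * exp (- t)" using \<tau> by simp
    show "\<tau> j * exp (- t) \<le> 1" using \<tau>[of j] t by (intro mult_le_one) auto
    show "\<forall>\<^sub>F n in sequentially. 0 < P j n \<and> P j n \<le> 1"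
      using order_tendstoD(1)[OF P_lim pos] by eventually_elim (use P_unit in auto)
  qed
  then have lim: "(\<Sum>j<J. c j * \<phi> (\<tau> j * exp (- t))) \<le> C * \<phi> t"
    by (rule LIMSEQ_le_const2) (use bound in blast)
  \<comment> \<open>Both losses of the final constant occur here: p from the lower increment bound,
    and \<open>exp (- 1)\<close> from \<open>exp (- t)\<close> with t \<le> 1 and concavity.\<close>
  have "?p * exp (- 1) * (\<Sum>j<J. real (Suc j) powr (?p - 1) * \<phi> (\<tau> j)) =
      (\<Sum>j<J. (?p * real (Suc j) powr (?p - 1)) * (exp (- 1) * \<phi> (\<tau> j)))"
    by (simp add: sum_distrib_left mult_ac)
  also have "\<dots> \<le> (\<Sum>j<J. c j * \<phi> (\<tau> j * exp (- t)))"
  proof (intro sum_mono mult_mono)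
    fix j
    show "?p * real (Suc j) powr (?p - 1) \<le> c j" unfolding c_def by (rule powr_Suc_diff_bounds[OF p])
    have \<phi>0: "0 \<le> \<phi> (\<tau> j)" using \<tau>[of j] by (intro Phi_nonneg[OF phi]) auto
    then show "0 \<le> exp (- 1) * \<phi> (\<tau> j)" by simp
    have "exp (- 1) * \<phi> (\<tau> j) \<le> exp (- t) * \<phi> (\<tau> j)" using \<phi>0 t by (intro mult_right_mono) auto
    also have "\<dots> \<le> \<phi> (exp (- t) * \<tau> j)" using \<tau>[of j] t by (intro Phi_scale[OF phi]) auto
    finally show "exp (- 1) * \<phi> (\<tau> j) \<le> \<phi> (\<tau> j * exp (- t))" by (simp add: mult.commute)
  qed (rule c0)
  also note lim
  finally have main: "?p * exp (- 1) * (\<Sum>j<J. real (Suc j) powr (?p - 1) * \<phi> (\<tau> j)) \<le> C * \<phi> t" .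
  have "(\<Sum>j<J. real (Suc j) powr (?p - 1) * \<phi> (\<tau> j)) =
     (q * exp 1) * (?p * exp (- 1) * (\<Sum>j<J. real (Suc j) powr (?p - 1) * \<phi> (\<tau> j)))"
    using q by (simp add: exp_minus field_simps)
  also have "\<dots> \<le> (q * exp 1) * (C * \<phi> t)" using main q by (intro mult_left_mono) auto
  finally show "(\<Sum>j<J. real (Suc j) powr (1 / q - 1) * \<phi> (t ^ Suc j / fact (Suc j))) \<le> q * exp 1 * C * \<phi> t"
    by (simp add: \<tau>_def mult_ac)
qed

section \<open>The equivalence and the comparison of constants\<close>

lemma equivalence_of_Gamma_bound:
  assumes phi: "\<phi> \<in> Phi" and q: "1 \<le> q" and l: "\<And>n. 1 \<le> n \<Longrightarrow> enumeration n (l n)"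
    and g: "Gamma_bound \<phi> (1 / q) g" and n: "1 \<le> n"
  defines "R x \<equiv> Lorentz_norm \<phi> (U_op n x) +
      ennreal ((1 / real n * (\<Sum>k=n+1..n^2. entry_rearrangement n x k powr q)) powr (1 / q))"
  shows "ennreal (1 / 8) * R x \<le> Lorentz_norm \<phi> (T_op q n (l n) x)"
    and "Lorentz_norm \<phi> (T_op q n (l n) x) \<le> ennreal (3 + 4 * g) * R x"
proof -
  obtain s where s: "ranked_matrix \<phi> q n (entry x) s"
    "Lorentz_norm \<phi> (T_op q n (l n) x) = ennreal (dnorm \<phi> (perms n) (ranked_matrix.T q n (entry x)))"
    "Lorentz_norm \<phi> (U_op n x) = ennreal (ranked_matrix.U_val \<phi> n (entry x) s)"
    "1 / real n * (\<Sum>k=n+1..n^2. entry_rearrangement n x k powr q) = ranked_matrix.rest_mean q n (entry x) s"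
    using Lorentz_norms_ranked[OF phi q n l[OF n]] by blast
  interpret ranked_matrix \<phi> q n "entry x" s by fact
  have U0: "0 \<le> U_val" using nth_le_U_val X_nonneg by (rule order_trans[rotated])
  have R: "R x = ennreal (U_val + rest_mean powr (1 / q))"
    unfolding R_def s using U0 by (simp add: ennreal_plus)
  have g1: "1 \<le> g" by (rule Gamma_bound_ge_1[OF phi g])
  \<comment> \<open>With D the norm of T: \<open>U_val\<close> is at most 2 D and the other term at
    most \<open>U_val\<close> + 4 D \<le> 6 D, in total 8 D.\<close>
  have "1 / 8 * (U_val + rest_mean powr (1 / q)) \<le> dnorm \<phi> (perms n) T"
    using U_val_le order_trans[OF rest_mean_le add_right_mono[OF nth_le_U_val]] by simp
  then show "ennreal (1 / 8) * R x \<le> Lorentz_norm \<phi> (T_op q n (l n) x)"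
    unfolding R s using U0 by (subst ennreal_mult[symmetric]) (auto intro: ennreal_leI)
  show "Lorentz_norm \<phi> (T_op q n (l n) x) \<le> ennreal (3 + 4 * g) * R x"
    unfolding R s using dnorm_T_le[OF g] U0 g1 by (subst ennreal_mult[symmetric]) (auto intro: ennreal_leI)
qed

lemma diagonal_bound_of_Gamma_bound:
  assumes phi: "\<phi> \<in> Phi" and q: "1 \<le> q" and l: "enumeration n l"
    and g: "Gamma_bound \<phi> (1 / q) g" and n: "1 \<le> n" and y: "diagonal n y"
  shows "Lorentz_norm \<phi> (T_op q n l y) \<le> ennreal g * Lorentz_norm \<phi> (U_op n y)"
proof -
  obtain s where s: "ranked_matrix \<phi> q n (entry y) s"
    "Lorentz_norm \<phi> (T_op q n l y) = ennreal (dnorm \<phi> (perms n) (ranked_matrix.T q n (entry y)))"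
    "Lorentz_norm \<phi> (U_op n y) = ennreal (ranked_matrix.U_val \<phi> n (entry y) s)"
    using Lorentz_norms_ranked[OF phi q n l] by blast
  interpret ranked_matrix \<phi> q n "entry y" s by fact
  have U0: "0 \<le> U_val" using nth_le_U_val X_nonneg by (rule order_trans[rotated])
  show ?thesis
    unfolding s using dnorm_T_sparse_le[OF g diagonal_rank_zero[OF s(1) y]] U0 Gamma_bound_ge_1[OF phi g]
    by (subst ennreal_mult[symmetric]) (auto intro: ennreal_leI)
qed

text \<open>For diagonal matrices the equivalence becomes a bound of T by U, to which the Poisson
  test applies.\<close>

lemma diagonal_rest_zero:
  assumes phi: "\<phi> \<in> Phi" and q: "1 \<le> q" and l: "enumeration n l" and n: "1 \<le> n" and y: "diagonal n y"
  shows "(\<Sum>k=n+1..n^2. entry_rearrangement n y k powr q) = 0"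
proof -
  obtain s where s: "ranked_matrix \<phi> q n (entry y) s"
    "1 / real n * (\<Sum>k=n+1..n^2. entry_rearrangement n y k powr q) = ranked_matrix.rest_mean q n (entry y) s"
    using Lorentz_norms_ranked[OF phi q n l] by blast
  interpret ranked_matrix \<phi> q n "entry y" s by fact
  have "rest_mean = 0"
    unfolding rest_mean_def using diagonal_rank_zero[OF s(1) y] by (simp add: sum.neutral)
  with s(2) n show ?thesis by simp
qed

lemma Gamma_const_le_of_diagonal:
  assumes phi: "\<phi> \<in> Phi" and q: "1 \<le> q" and l: "\<And>n. 1 \<le> n \<Longrightarrow> enumeration n (l n)" and C: "0 \<le> C"
    and diag: "\<And>n y. 1 \<le> n \<Longrightarrow> diagonal n y \<Longrightarrow>
      Lorentz_norm \<phi> (T_op q n (l n) y) \<le> ennreal C * Lorentz_norm \<phi> (U_op n y)"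
  shows "Gamma_const \<phi> q \<le> ennreal (q * exp 1 * C)"
  using q C by (intro Gamma_const_le[OF phi Gamma_bound_of_diagonal[OF phi q l C diag]]) auto

theorem theorem10:
  fixes \<phi> :: "real \<Rightarrow> real" and q :: real and l :: "nat \<Rightarrow> (nat \<Rightarrow> nat) \<Rightarrow> nat"
  assumes "\<phi> \<in> Phi" and "1 \<le> q" and "\<And>n. 1 \<le> n \<Longrightarrow> enumeration n (l n)"
  shows "((\<exists>c C :: real. 0 < c \<and> 0 < C \<and> (\<forall>n\<ge>1. \<forall>x :: nat \<Rightarrow> nat \<Rightarrow> real.
            let R = Lorentz_norm \<phi> (U_op n x) +
              ennreal ((1 / real n * (\<Sum>k=n+1..n^2. entry_rearrangement n x k powr q)) powr (1 / q))
            in ennreal c * R \<le> Lorentz_norm \<phi> (T_op q n (l n) x) \<and>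
               Lorentz_norm \<phi> (T_op q n (l n) x) \<le> ennreal C * R))
          \<longleftrightarrow> Gamma_const \<phi> q < \<infinity>) \<and>
         T_norm \<phi> q l \<le> Gamma_const \<phi> q \<and>
         Gamma_const \<phi> q \<le> ennreal (q * exp 1) * T_norm \<phi> q l"
    (is "(?equiv \<longleftrightarrow> _) \<and> _ \<and> _")
proof (intro conjI iffI)
  assume ?equiv
  then obtain c C :: real where C: "0 < C" and *: "\<And>n x. 1 \<le> n \<Longrightarrow> Lorentz_norm \<phi> (T_op q n (l n) x) \<le>
      ennreal C * (Lorentz_norm \<phi> (U_op n x) +
        ennreal ((1 / real n * (\<Sum>k=n+1..n^2. entry_rearrangement n x k powr q)) powr (1 / q)))"
    unfolding Let_def by blast
  have "Lorentz_norm \<phi> (T_op q n (l n) y) \<le> ennreal C * Lorentz_norm \<phi> (U_op n y)"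
    if "1 \<le> n" "diagonal n y" for n y
    using *[OF that(1), of y] unfolding diagonal_rest_zero[OF assms(1,2) assms(3)[OF that(1)] that] by simp
  then have "Gamma_const \<phi> q \<le> ennreal (q * exp 1 * C)"
    using C by (intro Gamma_const_le_of_diagonal[OF assms]) auto
  then show "Gamma_const \<phi> q < \<infinity>" by (rule order_le_less_trans) simp
next
  assume "Gamma_const \<phi> q < \<infinity>"
  then obtain g where g: "0 \<le> g" "Gamma_const \<phi> q = ennreal g"
    by (cases "Gamma_const \<phi> q") auto
  have bound: "Gamma_bound \<phi> (1 / q) g" by (rule Gamma_bound_of_Gamma_const[OF assms(1) g(2,1)])
  show ?equiv
    unfolding Let_def
    by (rule exI[of _ "1 / 8"], rule exI[of _ "3 + 4 * g"])
      (use equivalence_of_Gamma_bound[OF assms bound] g(1) in auto)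
next
  show "T_norm \<phi> q l \<le> Gamma_const \<phi> q"
  proof (cases "Gamma_const \<phi> q")
    case (real g)
    have bound: "Gamma_bound \<phi> (1 / q) g" by (rule Gamma_bound_of_Gamma_const[OF assms(1) real(2,1)])
    show ?thesis
      unfolding T_norm_def real(2)
      using diagonal_bound_of_Gamma_bound[OF assms(1,2) assms(3) bound] by (intro Inf_lower) auto
  qed simp
next
  let ?e = "q * exp 1"
  have e: "0 < ?e" using assms(2) by simp
  have inv: "ennreal (1 / ?e) * ennreal ?e = 1"
    using e by (subst ennreal_mult[symmetric]) auto
  \<comment> \<open>The operator norm is an infimum, so the factor is divided off first and the
    inequality checked for each admissible C; an infinite C is trivial.\<close>
  have "ennreal (1 / ?e) * Gamma_const \<phi> q \<le> T_norm \<phi> q l"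
    unfolding T_norm_def
  proof (rule Inf_greatest)
    fix C assume C: "C \<in> {C. \<forall>n\<ge>1. \<forall>y. diagonal n y \<longrightarrow>
      Lorentz_norm \<phi> (T_op q n (l n) y) \<le> C * Lorentz_norm \<phi> (U_op n y)}"
    show "ennreal (1 / ?e) * Gamma_const \<phi> q \<le> C"
    proof (cases C)
      case (real r)
      have "Gamma_const \<phi> q \<le> ennreal (?e * r)"
        using C real by (intro Gamma_const_le_of_diagonal[OF assms]) auto
      then have "ennreal (1 / ?e) * Gamma_const \<phi> q \<le> ennreal (1 / ?e) * ennreal (?e * r)"
        by (rule mult_left_mono) simp
      also have "\<dots> = C"
        using e real inv by (simp add: ennreal_mult mult.assoc[symmetric])
      finally show ?thesis .
    qed simp
  qed
  then have "ennreal ?e * (ennreal (1 / ?e) * Gamma_const \<phi> q) \<le> ennreal ?e * T_norm \<phi> q l"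
    by (rule mult_left_mono) simp
  then show "Gamma_const \<phi> q \<le> ennreal ?e * T_norm \<phi> q l"
    unfolding mult.assoc[symmetric] mult.commute[of "ennreal ?e" "ennreal (1 / ?e)"] inv mult_1_left .
qed

end
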